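(* Let $n\ge 1$ and let $V=(V_1,\ldots,V_n)$ be an isometric $n$-tuple. Then $V$ decomposes as a direct sum $V=V_u\oplus V_a\oplus V_s\oplus V_d$ (along mutually orthogonal reducing subspaces, some possibly zero), where $V_u$ is a unilateral $n$-shift, $V_a$ is an absolutely continuous unitary $n$-tuple, $V_s$ is a singular unitary $n$-tuple, and $V_d$ is a unitary $n$-tuple of dilation type.
   Context: An $n$-tuple is isometric if $V_i^*V_j=\delta_{ij}I$ and unitary if moreover $\sum_iV_iV_i^*=I$. $F_n^2$ is the full Fock space over $\mathbb{C}^n$ with basis $\{\xi_w:w\in\mathbb{F}_n^*\}$ ($\mathbb{F}_n^*$ the unital free semigroup on $n$ letters, $\varnothing$ its unit), $L_i\xi_w=\xi_{iw}$; a unilateral $n$-shift is an isometric tuple unitarily equivalent to an ampliation $(L_1^{(\alpha)},\dots,L_n^{(\alpha)})$. $\mathcal{A}_n$ / $\mathcal{L}_n$ are the norm-closed / weakly closed unital algebras generated by $L_1,\dots,L_n$ (for $n=1$ these are the disk algebra and $H^\infty$). An isometric tuple is absolutely continuous if the homomorphism $L_w\mapsto V_w$ of $\mathcal{A}_n$ extends to a weak-* continuous representation of $\mathcal{L}_n$; singular if it has no absolutely continuous restriction to a nonzero invariant subspace; of dilation type if it has no nonzero direct summand that is absolutely continuous or singular. *)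

theory Defs
  imports "HOL-Analysis.Analysis" "HOL-Library.Function_Algebras"
begin

class cvec = ab_group_add +
  fixes scaleC :: "complex \<Rightarrow> 'a \<Rightarrow> 'a" (infixr "*\<^sub>C" 75)
  assumes scaleC_add_right: "a *\<^sub>C (x + y) = a *\<^sub>C x + a *\<^sub>C y"
    and scaleC_add_left: "(a + b) *\<^sub>C x = a *\<^sub>C x + b *\<^sub>C x"
    and scaleC_scaleC: "a *\<^sub>C (b *\<^sub>C x) = (a * b) *\<^sub>C x"
    and scaleC_one: "1 *\<^sub>C x = x"

instantiation complex :: cvec
begin
definition scaleC_complex :: "complex \<Rightarrow> complex \<Rightarrow> complex" where
  "scaleC_complex a z = a * z"
instance by standard (auto simp: scaleC_complex_def algebra_simps)
end

instantiation "fun" :: (type, cvec) cvec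
begin
definition scaleC_fun :: "complex \<Rightarrow> ('a \<Rightarrow> 'b) \<Rightarrow> 'a \<Rightarrow> 'b" where
  "scaleC_fun c f = (\<lambda>x. c *\<^sub>C f x)"
instance by standard (auto simp: scaleC_fun_def scaleC_add_right scaleC_add_left scaleC_scaleC scaleC_one)
end

definition csubspace :: "'a::cvec set \<Rightarrow> bool" where
  "csubspace M \<longleftrightarrow> 0 \<in> M \<and> (\<forall>x\<in>M. \<forall>y\<in>M. x + y \<in> M) \<and> (\<forall>c. \<forall>x\<in>M. c *\<^sub>C x \<in> M)"

definition cnorm :: "('a \<Rightarrow> 'a \<Rightarrow> complex) \<Rightarrow> 'a \<Rightarrow> real" where
  "cnorm ip x = sqrt (Re (ip x x))"

definition inner_product_on :: "'a::cvec set \<Rightarrow> ('a \<Rightarrow> 'a \<Rightarrow> complex) \<Rightarrow> bool" where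
  "inner_product_on M ip \<longleftrightarrow>
     (\<forall>x\<in>M. \<forall>y\<in>M. \<forall>z\<in>M. ip (x + y) z = ip x z + ip y z) \<and>
     (\<forall>c. \<forall>x\<in>M. \<forall>y\<in>M. ip (c *\<^sub>C x) y = c * ip x y) \<and>
     (\<forall>x\<in>M. \<forall>y\<in>M. ip y x = cnj (ip x y)) \<and>
     (\<forall>x\<in>M. Re (ip x x) \<ge> 0) \<and>
     (\<forall>x\<in>M. ip x x = 0 \<longrightarrow> x = 0)"

definition hilbert_space :: "'a::cvec set \<Rightarrow> ('a \<Rightarrow> 'a \<Rightarrow> complex) \<Rightarrow> bool" where
  "hilbert_space M ip \<longleftrightarrow> csubspace M \<and> inner_product_on M ip \<and>
     (\<forall>s. (\<forall>k. s k \<in> M) \<and> (\<forall>e>0. \<exists>N. \<forall>m\<ge>N. \<forall>k\<ge>N. cnorm ip (s m - s k) < e)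
          \<longrightarrow> (\<exists>x\<in>M. (\<lambda>k. cnorm ip (s k - x)) \<longlonglongrightarrow> 0))"

definition closed_subspace :: "'a::cvec set \<Rightarrow> ('a \<Rightarrow> 'a \<Rightarrow> complex) \<Rightarrow> 'a set \<Rightarrow> bool" where
  "closed_subspace M ip N \<longleftrightarrow> csubspace N \<and> N \<subseteq> M \<and>
     (\<forall>s x. (\<forall>k. s k \<in> N) \<and> x \<in> M \<and> (\<lambda>k. cnorm ip (s k - x)) \<longlonglongrightarrow> 0 \<longrightarrow> x \<in> N)"

text \<open>Bounded linear operators on M (only their values on M matter).\<close>
definition bounded_op :: "'a::cvec set \<Rightarrow> ('a \<Rightarrow> 'a \<Rightarrow> complex) \<Rightarrow> ('a \<Rightarrow> 'a) \<Rightarrow> bool" where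
  "bounded_op M ip T \<longleftrightarrow> (\<forall>x\<in>M. T x \<in> M) \<and>
     (\<forall>x\<in>M. \<forall>y\<in>M. T (x + y) = T x + T y) \<and>
     (\<forall>c. \<forall>x\<in>M. T (c *\<^sub>C x) = c *\<^sub>C T x) \<and>
     (\<exists>C. \<forall>x\<in>M. cnorm ip (T x) \<le> C * cnorm ip x)"

definition adj :: "'a set \<Rightarrow> ('a \<Rightarrow> 'a \<Rightarrow> complex) \<Rightarrow> ('a \<Rightarrow> 'a) \<Rightarrow> 'a \<Rightarrow> 'a" where
  "adj M ip T y = (THE z. z \<in> M \<and> (\<forall>x\<in>M. ip (T x) y = ip x z))"

text \<open>\<open>V_i^* V_j = \<delta>_ij I\<close>, i.e. \<open><V_j x, V_i y> = \<delta>_ij <x,y>\<close>.\<close>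
definition isometric_tuple :: "'a::cvec set \<Rightarrow> ('a \<Rightarrow> 'a \<Rightarrow> complex) \<Rightarrow> nat \<Rightarrow> (nat \<Rightarrow> 'a \<Rightarrow> 'a) \<Rightarrow> bool" where
  "isometric_tuple M ip n V \<longleftrightarrow> (\<forall>i<n. bounded_op M ip (V i)) \<and>
     (\<forall>i<n. \<forall>j<n. \<forall>x\<in>M. \<forall>y\<in>M. ip (V j x) (V i y) = (if i = j then ip x y else 0))"

definition unitary_tuple :: "'a::cvec set \<Rightarrow> ('a \<Rightarrow> 'a \<Rightarrow> complex) \<Rightarrow> nat \<Rightarrow> (nat \<Rightarrow> 'a \<Rightarrow> 'a) \<Rightarrow> bool" where
  "unitary_tuple M ip n V \<longleftrightarrow> isometric_tuple M ip n V \<and>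
     (\<forall>x\<in>M. (\<Sum>i<n. V i (adj M ip (V i) x)) = x)"

definition invariant_subspace :: "'a::cvec set \<Rightarrow> ('a \<Rightarrow> 'a \<Rightarrow> complex) \<Rightarrow> nat \<Rightarrow> (nat \<Rightarrow> 'a \<Rightarrow> 'a) \<Rightarrow> 'a set \<Rightarrow> bool" where
  "invariant_subspace M ip n V N \<longleftrightarrow> closed_subspace M ip N \<and> (\<forall>i<n. \<forall>x\<in>N. V i x \<in> N)"

definition reducing_subspace :: "'a::cvec set \<Rightarrow> ('a \<Rightarrow> 'a \<Rightarrow> complex) \<Rightarrow> nat \<Rightarrow> (nat \<Rightarrow> 'a \<Rightarrow> 'a) \<Rightarrow> 'a set \<Rightarrow> bool" where
  "reducing_subspace M ip n V N \<longleftrightarrow> invariant_subspace M ip n V N \<and>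
     (\<forall>i<n. \<forall>x\<in>N. adj M ip (V i) x \<in> N)"

definition words :: "nat \<Rightarrow> nat list set" where
  "words n = {w. \<forall>i\<in>set w. i < n}"

definition word_op :: "(nat \<Rightarrow> 'a \<Rightarrow> 'a) \<Rightarrow> nat list \<Rightarrow> 'a \<Rightarrow> 'a" where
  "word_op V w = foldr (\<lambda>i f. V i \<circ> f) w id"

definition l2 :: "'x set \<Rightarrow> ('x \<Rightarrow> complex) set" where
  "l2 X = {f. (\<forall>p. p \<notin> X \<longrightarrow> f p = 0) \<and> (\<lambda>p. (cmod (f p))\<^sup>2) summable_on X}"

definition l2_ip :: "'x set \<Rightarrow> ('x \<Rightarrow> complex) \<Rightarrow> ('x \<Rightarrow> complex) \<Rightarrow> complex" where
  "l2_ip X f g = (\<Sum>\<^sub>\<infinity>p\<in>X. f p * cnj (g p))"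

text \<open>\<open>L_i \<xi>_w = \<xi>_{iw}\<close> on \<open>F_n^2 = \<ell>^2(\<bbbF>_n^*)\<close>.\<close>
definition shift_op :: "nat \<Rightarrow> (nat list \<Rightarrow> complex) \<Rightarrow> nat list \<Rightarrow> complex" where
  "shift_op i f = (\<lambda>w. case w of [] \<Rightarrow> 0 | j # w' \<Rightarrow> if j = i then f w' else 0)"

text \<open>Ampliation \<open>L_i^{(\<alpha>)}\<close> on \<open>F_n^2 \<otimes> \<ell>^2(A) = \<ell>^2(\<bbbF>_n^* \<times> A)\<close>.\<close>
definition ampl_shift_op :: "nat \<Rightarrow> (nat list \<times> 'b \<Rightarrow> complex) \<Rightarrow> nat list \<times> 'b \<Rightarrow> complex" where
  "ampl_shift_op i f = (\<lambda>(w, a). case w of [] \<Rightarrow> 0 | j # w' \<Rightarrow> if j = i then f (w', a) else 0)"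

definition fock :: "nat \<Rightarrow> (nat list \<Rightarrow> complex) set" where
  "fock n = l2 (words n)"

definition fock_ip :: "nat \<Rightarrow> (nat list \<Rightarrow> complex) \<Rightarrow> (nat list \<Rightarrow> complex) \<Rightarrow> complex" where
  "fock_ip n = l2_ip (words n)"

definition unitarily_equivalent ::
  "'a::cvec set \<Rightarrow> ('a \<Rightarrow> 'a \<Rightarrow> complex) \<Rightarrow> nat \<Rightarrow> (nat \<Rightarrow> 'a \<Rightarrow> 'a) \<Rightarrow>
   'b::cvec set \<Rightarrow> ('b \<Rightarrow> 'b \<Rightarrow> complex) \<Rightarrow> (nat \<Rightarrow> 'b \<Rightarrow> 'b) \<Rightarrow> bool" where
  "unitarily_equivalent M ip n V M' ip' V' \<longleftrightarrow> (\<exists>U. U ` M = M' \<and>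
     (\<forall>x\<in>M. \<forall>y\<in>M. U (x + y) = U x + U y) \<and> (\<forall>c. \<forall>x\<in>M. U (c *\<^sub>C x) = c *\<^sub>C U x) \<and>
     (\<forall>x\<in>M. \<forall>y\<in>M. ip' (U x) (U y) = ip x y) \<and>
     (\<forall>i<n. \<forall>x\<in>M. U (V i x) = V' i (U x)))"

text \<open>Unilateral n-shift: unitarily equivalent to \<open>(L_1^{(\<alpha>)},\<dots>,L_n^{(\<alpha>)})\<close>; the
  multiplicity \<open>\<alpha>\<close> is the cardinality of an index set A, which may be taken inside the
  carrier type (multiplicity is at most the Hilbert dimension).\<close>
definition unilateral_shift :: "'a::cvec set \<Rightarrow> ('a \<Rightarrow> 'a \<Rightarrow> complex) \<Rightarrow> nat \<Rightarrow> (nat \<Rightarrow> 'a \<Rightarrow> 'a) \<Rightarrow> bool" where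
  "unilateral_shift M ip n V \<longleftrightarrow> isometric_tuple M ip n V \<and>
     (\<exists>A :: 'a set. unitarily_equivalent M ip n V
        (l2 (words n \<times> A)) (l2_ip (words n \<times> A)) ampl_shift_op)"

definition poly_ops :: "nat \<Rightarrow> ((nat list \<Rightarrow> complex) \<Rightarrow> (nat list \<Rightarrow> complex)) set" where
  "poly_ops n = {T. \<exists>W c. finite W \<and> W \<subseteq> words n \<and>
     (\<forall>f\<in>fock n. T f = (\<Sum>w\<in>W. c w *\<^sub>C word_op shift_op w f))}"

text \<open>\<open>\<L>_n\<close>: WOT-closure of the unital algebra generated by \<open>L_1,\<dots>,L_n\<close>.\<close>
definition Ln :: "nat \<Rightarrow> ((nat list \<Rightarrow> complex) \<Rightarrow> (nat list \<Rightarrow> complex)) set" where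
  "Ln n = {T. bounded_op (fock n) (fock_ip n) T \<and>
     (\<forall>(m::nat) x y (e::real). (\<forall>k<m. x k \<in> fock n \<and> y k \<in> fock n) \<and> e > 0 \<longrightarrow>
        (\<exists>p\<in>poly_ops n. \<forall>k<m. cmod (fock_ip n (T (x k)) (y k) - fock_ip n (p (x k)) (y k)) < e))}"

text \<open>The weak-* (ultraweak) topology on a set OPS of operators on M, generated by the
  normal functionals \<open>T \<mapsto> \<Sum>_k <T x_k, y_k>\<close> with \<open>\<Sum>\<parallel>x_k\<parallel>^2, \<Sum>\<parallel>y_k\<parallel>^2 < \<infinity>\<close>.\<close>
definition sigma_weak_top :: "'a::cvec set \<Rightarrow> ('a \<Rightarrow> 'a \<Rightarrow> complex) \<Rightarrow> ('a \<Rightarrow> 'a) set \<Rightarrow> ('a \<Rightarrow> 'a) topology" where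
  "sigma_weak_top M ip OPS = topology_generated_by (insert OPS
     {{T \<in> OPS. (\<Sum>k. ip (T (x k)) (y k)) \<in> U} | x y U. open U \<and> (\<forall>k. x k \<in> M \<and> y k \<in> M) \<and>
        summable (\<lambda>k. (cnorm ip (x k))\<^sup>2) \<and> summable (\<lambda>k. (cnorm ip (y k))\<^sup>2)})"

definition abs_continuous :: "'a::cvec set \<Rightarrow> ('a \<Rightarrow> 'a \<Rightarrow> complex) \<Rightarrow> nat \<Rightarrow> (nat \<Rightarrow> 'a \<Rightarrow> 'a) \<Rightarrow> bool" where
  "abs_continuous M ip n V \<longleftrightarrow> isometric_tuple M ip n V \<and>
     (\<exists>\<rho>. (\<forall>T\<in>Ln n. bounded_op M ip (\<rho> T)) \<and>
        (\<forall>S\<in>Ln n. \<forall>T\<in>Ln n. (\<forall>f\<in>fock n. S f = T f) \<longrightarrow> (\<forall>x\<in>M. \<rho> S x = \<rho> T x)) \<and>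
        (\<forall>S\<in>Ln n. \<forall>T\<in>Ln n. \<forall>x\<in>M. \<rho> (S + T) x = \<rho> S x + \<rho> T x) \<and>
        (\<forall>c. \<forall>S\<in>Ln n. \<forall>x\<in>M. \<rho> (c *\<^sub>C S) x = c *\<^sub>C \<rho> S x) \<and>
        (\<forall>S\<in>Ln n. \<forall>T\<in>Ln n. \<forall>x\<in>M. \<rho> (S \<circ> T) x = \<rho> S (\<rho> T x)) \<and>
        (\<forall>x\<in>M. \<rho> id x = x) \<and>
        (\<forall>i<n. \<forall>x\<in>M. \<rho> (shift_op i) x = V i x) \<and>
        continuous_map (sigma_weak_top (fock n) (fock_ip n) (Ln n))
                       (sigma_weak_top M ip {T. bounded_op M ip T}) \<rho>)"

definition singular_tuple :: "'a::cvec set \<Rightarrow> ('a \<Rightarrow> 'a \<Rightarrow> complex) \<Rightarrow> nat \<Rightarrow> (nat \<Rightarrow> 'a \<Rightarrow> 'a) \<Rightarrow> bool" where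
  "singular_tuple M ip n V \<longleftrightarrow> isometric_tuple M ip n V \<and>
     \<not> (\<exists>N. invariant_subspace M ip n V N \<and> N \<noteq> {0} \<and> abs_continuous N ip n V)"

definition dilation_type :: "'a::cvec set \<Rightarrow> ('a \<Rightarrow> 'a \<Rightarrow> complex) \<Rightarrow> nat \<Rightarrow> (nat \<Rightarrow> 'a \<Rightarrow> 'a) \<Rightarrow> bool" where
  "dilation_type M ip n V \<longleftrightarrow> isometric_tuple M ip n V \<and>
     \<not> (\<exists>N. reducing_subspace M ip n V N \<and> N \<noteq> {0} \<and>
            (abs_continuous N ip n V \<or> singular_tuple N ip n V))"

definition orth :: "('a \<Rightarrow> 'a \<Rightarrow> complex) \<Rightarrow> 'a set \<Rightarrow> 'a set \<Rightarrow> bool" where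
  "orth ip A B \<longleftrightarrow> (\<forall>x\<in>A. \<forall>y\<in>B. ip x y = 0)"

end

theory Submission
  imports Defs
begin

text \<open>The pure part is the Wold decomposition. For the rest, call a vector \<open>x\<close> absolutely continuous if every
  functional \<open>L\<^sub>w \<mapsto> \<langle>V\<^sub>w x, y\<rangle>\<close> extends to a weak-* continuous functional on \<open>\<L>\<^sub>n\<close>. These vectors form a closed
  invariant subspace \<open>Vac\<close>, and an invariant subspace is absolutely continuous iff it lies in \<open>Vac\<close>. Hence a reducing
  subspace is absolutely continuous iff it lies in \<open>Vac\<close> and singular iff it is orthogonal to \<open>Vac\<close>; the largest
  reducing subspaces of the unitary part inside \<open>Vac\<close> and inside its orthogonal complement exist, and what remains is
  of dilation type.

  That \<open>Vac\<close> is closed, and that a subspace of it carries a weak-* continuous representation, rests on the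
  von Neumann inequality \<open>\<parallel>p(V)\<parallel> \<le> \<parallel>p(L)\<parallel>\<close> and on the completeness of the predual of \<open>\<L>\<^sub>n\<close> in the functional
  norm taken over polynomials only. The latter follows from the Hahn--Banach theorem and from the contractivity of
  the Cesaro means on \<open>\<L>\<^sub>n\<close>.\<close>

subsection \<open>Hilbert spaces on a carrier set\<close>

text \<open>The von Neumann inequality controls the functional sending \<open>p\<close> to
  \<open><p(V)x, y>\<close> only through the norms of the polynomials \<open>p(L)\<close>, whereas
  weak-* continuity asks for a representation by square-summable sequences of Fock vectors.
  Representations chosen separately for each functional have no reason to add up, so a series of
  normal functionals with summable functional norms is not visibly normal. Hahn-Banach supplies
  representations almost as cheap as the functional norm: a functional that would force a costly one
  is an operator \<open>T\<close> of convolution, and the Cesaro means of \<open>T\<close> are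
  polynomials of no larger norm. The resulting statement on series, \<open>normal_suminf\<close>,
  serves twice: for limits of vectors in \<open>Vac\<close>, and for the countable sums of
  coefficients that define the weak-* topology on the image of the representation. The inequality
  itself comes from tensoring \<open>V\<close> with the unilateral shift: this makes the tuple pure,
  so that \<open>p(L)\<close> acts on its coordinates.\<close>

lemma scaleC_zero_left [simp]: "0 *\<^sub>C (x::'a::cvec) = 0"
  using scaleC_add_left[of 0 0 x] by simp

lemma scaleC_zero_right [simp]: "c *\<^sub>C (0::'a::cvec) = 0"
  using scaleC_add_right[of c 0 "0::'a"] by simp

lemma scaleC_minus_left: "(- c) *\<^sub>C (x::'a::cvec) = - (c *\<^sub>C x)"
  using scaleC_add_left[of "-c" c x] by (simp add: eq_neg_iff_add_eq_0)

lemma scaleC_minus_one [simp]: "(- 1) *\<^sub>C (x::'a::cvec) = - x"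
  by (simp add: scaleC_minus_left scaleC_one)

lemma scaleC_sum_right: "c *\<^sub>C (\<Sum>i\<in>A. f i) = (\<Sum>i\<in>A. c *\<^sub>C (f i::'a::cvec))"
  by (induction A rule: infinite_finite_induct) (auto simp: scaleC_add_right)

lemma scaleC_complex_eq [simp]: "c *\<^sub>C (z::complex) = c * z"
  by (simp add: scaleC_complex_def)

lemma scaleC_fun_apply [simp]: "(c *\<^sub>C f) x = c *\<^sub>C (f x)"
  by (simp add: scaleC_fun_def)

context
  fixes M :: "'a::cvec set"
  assumes M: "csubspace M"
begin

lemma csubspace_zero: "0 \<in> M" using M by (simp add: csubspace_def)
lemma csubspace_add: "x \<in> M \<Longrightarrow> y \<in> M \<Longrightarrow> x + y \<in> M" using M by (simp add: csubspace_def)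
lemma csubspace_scale: "x \<in> M \<Longrightarrow> c *\<^sub>C x \<in> M" using M by (simp add: csubspace_def)
lemma csubspace_minus: "x \<in> M \<Longrightarrow> - x \<in> M" using csubspace_scale[of x "-1"] by simp
lemma csubspace_diff: "x \<in> M \<Longrightarrow> y \<in> M \<Longrightarrow> x - y \<in> M"
  using csubspace_add[of x "-y"] csubspace_minus[of y] by simp
lemma csubspace_sum: "(\<And>i. i \<in> A \<Longrightarrow> f i \<in> M) \<Longrightarrow> sum f A \<in> M"
  by (induction A rule: infinite_finite_induct) (auto simp: csubspace_zero csubspace_add)

end

locale ip_space =
  fixes M :: "'a::cvec set" and ip :: "'a \<Rightarrow> 'a \<Rightarrow> complex"
  assumes csub: "csubspace M" and ipo: "inner_product_on M ip"
begin

lemmas zero_mem [simp, intro] = csubspace_zero[OF csub]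
  and add_mem [simp, intro] = csubspace_add[OF csub]
  and scale_mem [simp, intro] = csubspace_scale[OF csub]
  and minus_mem [simp, intro] = csubspace_minus[OF csub]
  and diff_mem [simp, intro] = csubspace_diff[OF csub]
  and sum_mem = csubspace_sum[OF csub]

abbreviation nm :: "'a \<Rightarrow> real" where "nm \<equiv> cnorm ip"

lemma ip_add_left: "x \<in> M \<Longrightarrow> y \<in> M \<Longrightarrow> z \<in> M \<Longrightarrow> ip (x + y) z = ip x z + ip y z"
  using ipo[unfolded inner_product_on_def, THEN conjunct1] by blast

lemma ip_scale_left: "x \<in> M \<Longrightarrow> y \<in> M \<Longrightarrow> ip (c *\<^sub>C x) y = c * ip x y"
  using ipo[unfolded inner_product_on_def, THEN conjunct2, THEN conjunct1] by blast

lemma ip_cnj: "x \<in> M \<Longrightarrow> y \<in> M \<Longrightarrow> ip y x = cnj (ip x y)"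
  using ipo[unfolded inner_product_on_def, THEN conjunct2, THEN conjunct2, THEN conjunct1] by blast

lemma ip_self_nonneg: "x \<in> M \<Longrightarrow> Re (ip x x) \<ge> 0"
  using ipo[unfolded inner_product_on_def, THEN conjunct2, THEN conjunct2, THEN conjunct2, THEN conjunct1] by blast

lemma ip_self_eq_0: "x \<in> M \<Longrightarrow> ip x x = 0 \<Longrightarrow> x = 0"
  using ipo[unfolded inner_product_on_def, THEN conjunct2, THEN conjunct2, THEN conjunct2, THEN conjunct2] by blast

lemma ip_add_right: "x \<in> M \<Longrightarrow> y \<in> M \<Longrightarrow> z \<in> M \<Longrightarrow> ip x (y + z) = ip x y + ip x z"
  using ip_cnj[of "y + z" x] ip_cnj[of y x] ip_cnj[of z x] by (simp add: ip_add_left)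

lemma ip_scale_right: "x \<in> M \<Longrightarrow> y \<in> M \<Longrightarrow> ip x (c *\<^sub>C y) = cnj c * ip x y"
  using ip_cnj[of "c *\<^sub>C y" x] ip_cnj[of y x] by (simp add: ip_scale_left)

lemma ip_zero_left [simp]: "x \<in> M \<Longrightarrow> ip 0 x = 0"
  using ip_scale_left[of 0 x 0] by simp

lemma ip_zero_right [simp]: "x \<in> M \<Longrightarrow> ip x 0 = 0"
  using ip_scale_right[of x 0 0] by simp

lemma ip_minus_left: "x \<in> M \<Longrightarrow> y \<in> M \<Longrightarrow> ip (- x) y = - ip x y"
  using ip_scale_left[of x y "-1"] by simp

lemma ip_minus_right: "x \<in> M \<Longrightarrow> y \<in> M \<Longrightarrow> ip x (- y) = - ip x y"
  using ip_scale_right[of x y "-1"] by simp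

lemma ip_diff_left: "x \<in> M \<Longrightarrow> y \<in> M \<Longrightarrow> z \<in> M \<Longrightarrow> ip (x - y) z = ip x z - ip y z"
  using ip_add_left[of x "-y" z] by (simp add: ip_minus_left)

lemma ip_diff_right: "x \<in> M \<Longrightarrow> y \<in> M \<Longrightarrow> z \<in> M \<Longrightarrow> ip x (y - z) = ip x y - ip x z"
  using ip_add_right[of x y "-z"] by (simp add: ip_minus_right)

lemma ip_sum_left: "(\<And>i. i \<in> A \<Longrightarrow> f i \<in> M) \<Longrightarrow> y \<in> M \<Longrightarrow> ip (sum f A) y = (\<Sum>i\<in>A. ip (f i) y)"
  by (induction A rule: infinite_finite_induct) (auto simp: ip_add_left sum_mem)

lemma ip_sum_right: "(\<And>i. i \<in> A \<Longrightarrow> f i \<in> M) \<Longrightarrow> y \<in> M \<Longrightarrow> ip y (sum f A) = (\<Sum>i\<in>A. ip y (f i))"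
  by (induction A rule: infinite_finite_induct) (auto simp: ip_add_right sum_mem)

lemma ip_self: "x \<in> M \<Longrightarrow> ip x x = of_real ((nm x)\<^sup>2)"
  using ip_self_nonneg[of x] ip_cnj[of x x] by (simp add: cnorm_def complex_eq_iff)

lemma nm_nonneg [simp]: "x \<in> M \<Longrightarrow> nm x \<ge> 0"
  by (simp add: cnorm_def ip_self_nonneg)

lemma nm_sq: "x \<in> M \<Longrightarrow> (nm x)\<^sup>2 = Re (ip x x)"
  by (simp add: cnorm_def ip_self_nonneg)

lemma nm_eq_0: "x \<in> M \<Longrightarrow> nm x = 0 \<longleftrightarrow> x = 0"
  using ip_self[of x] ip_self_eq_0[of x] by (auto simp: cnorm_def)

lemma nm_zero [simp]: "nm 0 = 0" using nm_eq_0[of 0] by simp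

lemma nm_scale: "x \<in> M \<Longrightarrow> nm (c *\<^sub>C x) = cmod c * nm x"
proof -
  assume x: "x \<in> M"
  have "ip (c *\<^sub>C x) (c *\<^sub>C x) = (c * cnj c) * ip x x"
    using x by (simp add: ip_scale_left ip_scale_right)
  also have "\<dots> = of_real ((cmod c * nm x)\<^sup>2)"
    unfolding complex_norm_square[symmetric] ip_self[OF x] by (simp add: power_mult_distrib)
  finally have "ip (c *\<^sub>C x) (c *\<^sub>C x) = of_real ((cmod c * nm x)\<^sup>2)" .
  then have "(nm (c *\<^sub>C x))\<^sup>2 = (cmod c * nm x)\<^sup>2"
    using x by (simp only: nm_sq scale_mem Re_complex_of_real)
  then show ?thesis using x by (simp add: power2_eq_iff_nonneg)
qed

lemma nm_minus: "x \<in> M \<Longrightarrow> nm (- x) = nm x" using nm_scale[of x "-1"] by simp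

lemma nm_sq_add: "x \<in> M \<Longrightarrow> y \<in> M \<Longrightarrow> (nm (x + y))\<^sup>2 = (nm x)\<^sup>2 + 2 * Re (ip x y) + (nm y)\<^sup>2"
  using ip_cnj[of x y] by (simp add: nm_sq ip_add_left ip_add_right)

lemma nm_sq_diff: "x \<in> M \<Longrightarrow> y \<in> M \<Longrightarrow> (nm (x - y))\<^sup>2 = (nm x)\<^sup>2 - 2 * Re (ip x y) + (nm y)\<^sup>2"
  using nm_sq_add[of x "-y"] by (simp add: nm_minus ip_minus_right)

lemma cauchy_schwarz: 
  assumes x: "x \<in> M" and y: "y \<in> M" shows "cmod (ip x y) \<le> nm x * nm y"
proof (cases "y = 0")
  case False
  then have ny: "nm y > 0" using nm_nonneg[OF y] nm_eq_0[OF y] by linarith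
  define c where "c = ip x y / of_real ((nm y)\<^sup>2)"
  have "0 \<le> (nm (x - c *\<^sub>C y))\<^sup>2" by simp
  also have "\<dots> = (nm x)\<^sup>2 - 2 * Re (cnj c * ip x y) + (cmod c * nm y)\<^sup>2"
    using x y by (simp add: nm_sq_diff ip_scale_right nm_scale)
  also have "cnj c * ip x y = of_real ((cmod (ip x y))\<^sup>2 / (nm y)\<^sup>2)"
    by (simp add: c_def complex_norm_square[of "ip x y", simplified] mult.commute)
  also have "cmod c * nm y = cmod (ip x y) / nm y"
    using ny by (simp add: c_def norm_divide norm_mult power2_eq_square)
  finally have "(cmod (ip x y))\<^sup>2 / (nm y)\<^sup>2 \<le> (nm x)\<^sup>2" by (simp add: power_divide)
  then have "(cmod (ip x y))\<^sup>2 \<le> (nm x * nm y)\<^sup>2" using ny by (simp add: field_simps)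
  then show ?thesis using x y by (simp add: abs_le_square_iff[symmetric] abs_mult)
qed (use assms in simp)

lemma nm_triangle: 
  assumes x: "x \<in> M" and y: "y \<in> M" shows "nm (x + y) \<le> nm x + nm y"
proof -
  have "(nm (x + y))\<^sup>2 \<le> (nm x + nm y)\<^sup>2"
    using cauchy_schwarz[OF x y] complex_Re_le_cmod[of "ip x y"] 
    by (simp add: nm_sq_add x y power2_sum)
  then show ?thesis using x y by (simp add: abs_le_square_iff[symmetric])
qed

lemma nm_triangle_diff: "x \<in> M \<Longrightarrow> y \<in> M \<Longrightarrow> nm (x - y) \<le> nm x + nm y"
  using nm_triangle[of x "-y"] by (simp add: nm_minus)

lemma nm_triangle_le: "x \<in> M \<Longrightarrow> y \<in> M \<Longrightarrow> nm x \<le> nm y + nm (x - y)"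
  using nm_triangle[of y "x - y"] by simp

lemma nm_sum: "(\<And>i. i \<in> A \<Longrightarrow> f i \<in> M) \<Longrightarrow> nm (sum f A) \<le> (\<Sum>i\<in>A. nm (f i))"
proof (induction A rule: infinite_finite_induct)
  case (insert a A)
  then have "nm (f a + sum f A) \<le> nm (f a) + nm (sum f A)" by (intro nm_triangle) (auto simp: sum_mem)
  then show ?case using insert by fastforce
qed auto

lemma ip_ext: "x \<in> M \<Longrightarrow> x' \<in> M \<Longrightarrow> (\<And>y. y \<in> M \<Longrightarrow> ip x y = ip x' y) \<Longrightarrow> x = x'"
  using ip_self_eq_0[of "x - x'"] by (simp add: ip_diff_left)

lemma ip_ext_right: "x \<in> M \<Longrightarrow> x' \<in> M \<Longrightarrow> (\<And>y. y \<in> M \<Longrightarrow> ip y x = ip y x') \<Longrightarrow> x = x'"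
  using ip_self_eq_0[of "x - x'"] by (simp add: ip_diff_right)

lemma tendsto_ip_left:
  assumes "\<And>k. s k \<in> M" "x \<in> M" "y \<in> M" "(\<lambda>k. nm (s k - x)) \<longlonglongrightarrow> 0"
  shows "(\<lambda>k. ip (s k) y) \<longlonglongrightarrow> ip x y"
proof (rule LIM_zero_cancel, rule Lim_null_comparison)
  show "\<forall>\<^sub>F k in sequentially. norm (ip (s k) y - ip x y) \<le> nm (s k - x) * nm y"
    using cauchy_schwarz[OF diff_mem[OF assms(1,2)] assms(3)] assms by (simp add: ip_diff_left)
  show "(\<lambda>k. nm (s k - x) * nm y) \<longlonglongrightarrow> 0" by (rule tendsto_mult_left_zero[OF assms(4)])
qed

lemma ip_space_subset: "csubspace N \<Longrightarrow> N \<subseteq> M \<Longrightarrow> ip_space N ip"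
  by (auto simp: ip_space_def inner_product_on_def subset_iff ip_add_left ip_scale_left ip_self_nonneg
      dest: ip_self_eq_0 intro: ip_cnj)

end

section \<open>Complete spaces: the Riesz representation and orthogonal projections\<close>

locale hspace =
  fixes M :: "'a::cvec set" and ip :: "'a \<Rightarrow> 'a \<Rightarrow> complex"
  assumes hilbert: "hilbert_space M ip"

sublocale hspace \<subseteq> ip_space
  using hilbert by unfold_locales (auto simp: hilbert_space_def)

context hspace begin

text \<open>The representing vector is the minimiser of \<open>\<parallel>z\<parallel>\<^sup>2 - 2 Re f(z)\<close>.\<close>
lemma riesz:
  assumes add: "\<And>x y. x \<in> M \<Longrightarrow> y \<in> M \<Longrightarrow> f (x + y) = f x + f y"
    and scale: "\<And>c x. x \<in> M \<Longrightarrow> f (c *\<^sub>C x) = c * f x"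
    and bound: "\<And>x. x \<in> M \<Longrightarrow> cmod (f x) \<le> C * nm x"
  obtains z where "z \<in> M" "\<And>x. x \<in> M \<Longrightarrow> f x = ip x z"
proof -
  define J where "J = (\<lambda>z. (nm z)\<^sup>2 - 2 * Re (f z))"
  have fdiff: "f (x - y) = f x - f y" if "x \<in> M" "y \<in> M" for x y
    using add[of x "(-1) *\<^sub>C y"] scale[of y "-1"] that by simp
  \<comment> \<open>Completing the square: \<open>J z\<close> is at least
    \<open>(nm z - C)^2 - C^2\<close>.\<close>
  have Jlow: "J z \<ge> - C\<^sup>2" if "z \<in> M" for z
  proof -
    have "2 * Re (f z) \<le> 2 * (C * nm z)" using bound[OF that] complex_Re_le_cmod[of "f z"] by linarith
    moreover have "0 \<le> (nm z - C)\<^sup>2" by simp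
    moreover have "(nm z - C)\<^sup>2 = (nm z)\<^sup>2 - 2 * (C * nm z) + C\<^sup>2" by (simp add: power2_diff)
    ultimately show ?thesis unfolding J_def by linarith
  qed
  define m where "m = Inf (J ` M)"
  have bdd: "bdd_below (J ` M)" using Jlow by (auto simp: bdd_below_def)
  have mle: "m \<le> J z" if "z \<in> M" for z unfolding m_def using bdd that by (auto intro: cInf_lower)
  have "\<exists>z\<in>M. J z < m + 1 / real (Suc k)" for k
  proof -
    have "\<exists>j\<in>J ` M. j < m + 1 / real (Suc k)"
      unfolding m_def using bdd by (subst cInf_less_iff[symmetric]) auto
    then show ?thesis by auto
  qed
  then obtain s where s: "\<And>k. s k \<in> M" "\<And>k. J (s k) < m + 1 / real (Suc k)" by metis
  have dist: "(nm (s j - s k))\<^sup>2 \<le> 2 / real (Suc j) + 2 / real (Suc k)" for j k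
  proof -
    \<comment> \<open>The parallelogram law at the midpoint makes the minimising sequence Cauchy,
      because \<open>J\<close> at the midpoint is still at least \<open>m\<close>.\<close>
    define c where "c = (1/2) *\<^sub>C (s j + s k)"
    have c: "c \<in> M" using s by (simp add: c_def)
    have "(nm c)\<^sup>2 = (nm (s j + s k))\<^sup>2 / 4" using s by (simp add: c_def nm_scale power_divide)
    moreover have "Re (f c) = (Re (f (s j)) + Re (f (s k))) / 2" using s by (simp add: c_def scale add)
    ultimately have "(nm (s j - s k))\<^sup>2 = 2 * J (s j) + 2 * J (s k) - 4 * J c"
      using s by (simp add: J_def nm_sq_add nm_sq_diff)
    then show ?thesis using mle[OF c] s(2)[of j] s(2)[of k] by simp
  qed
  have "\<exists>N. \<forall>m\<ge>N. \<forall>k\<ge>N. nm (s m - s k) < e" if e: "e > 0" for e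
  proof -
    obtain N where N: "4 / e\<^sup>2 < real N" using reals_Archimedean2 by blast
    have "nm (s j - s k) < e" if "j \<ge> N" "k \<ge> N" for j k
    proof -
      have pos: "4 / e\<^sup>2 > 0" using e by simp
      have r: "2 / real (Suc i) < e\<^sup>2 / 2" if "i \<ge> N" for i
      proof -
        have "4 / e\<^sup>2 < real (Suc i)" using N that by linarith
        then show ?thesis using e by (simp add: field_simps)
      qed
      have "(nm (s j - s k))\<^sup>2 < e\<^sup>2" using dist[of j k] r[OF that(1)] r[OF that(2)] by linarith
      then show ?thesis using e by (simp add: power2_less_imp_less)
    qed
    then show ?thesis by blast
  qed
  then obtain z where z: "z \<in> M" "(\<lambda>k. nm (s k - z)) \<longlonglongrightarrow> 0"
    using hilbert[unfolded hilbert_space_def, THEN conjunct2, THEN conjunct2, THEN spec, of s] s(1) by blast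
  have "J z \<le> m"
  proof (rule LIMSEQ_le_const)
    have "(\<lambda>k. m + 1 / real (Suc k) + (2 * nm z + 2 * C) * nm (s k - z)) \<longlonglongrightarrow> m + 0 + (2 * nm z + 2 * C) * 0"
      by (intro tendsto_intros z LIMSEQ_Suc[OF lim_1_over_n])
    then show "(\<lambda>k. m + 1 / real (Suc k) + (2 * nm z + 2 * C) * nm (s k - z)) \<longlonglongrightarrow> m" by simp
    show "\<exists>N. \<forall>k\<ge>N. J z \<le> m + 1 / real (Suc k) + (2 * nm z + 2 * C) * nm (s k - z)"
    proof (intro exI[of _ 0] allI impI)
      fix k
      define d where "d = s k - z"
      have d: "d \<in> M" "s k = z + d" using s z by (auto simp: d_def)
      have "J (s k) = J z + 2 * Re (ip z d) + (nm d)\<^sup>2 - 2 * Re (f d)"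
        using d z by (simp add: J_def nm_sq_add add)
      moreover have "\<bar>Re (ip z d)\<bar> \<le> nm z * nm d" using cauchy_schwarz[OF z(1) d(1)] abs_Re_le_cmod[of "ip z d"] by linarith
      moreover have "\<bar>Re (f d)\<bar> \<le> C * nm d" using bound[OF d(1)] abs_Re_le_cmod[of "f d"] by linarith
      moreover have "(2 * nm z + 2 * C) * nm d = 2 * (nm z * nm d) + 2 * (C * nm d)" by (simp add: algebra_simps)
      ultimately have "J z \<le> J (s k) + (2 * nm z + 2 * C) * nm d"
        using zero_le_power2[of "nm d"] by linarith
      then show "J z \<le> m + 1 / real (Suc k) + (2 * nm z + 2 * C) * nm (s k - z)"
        using s(2)[of k] by (simp add: d_def)
    qed
  qed
  then have min: "J z \<le> J y" if "y \<in> M" for y using mle[OF that] by simp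
  have Re0: "Re (f y) = Re (ip y z)" if y: "y \<in> M" for y
  proof (rule ccontr)
    define a where "a = Re (ip z y) - Re (f y)"
    assume "Re (f y) \<noteq> Re (ip y z)"
    then have a: "a \<noteq> 0" using ip_cnj[OF y z(1)] by (simp add: a_def)
    have J2: "0 \<le> 2 * t * a + t\<^sup>2 * (nm y)\<^sup>2" for t
    proof -
      have "J (z + complex_of_real t *\<^sub>C y) = J z + 2 * t * a + t\<^sup>2 * (nm y)\<^sup>2"
        using y z by (simp add: J_def nm_sq_add add scale ip_scale_right nm_scale a_def power_mult_distrib algebra_simps)
      then show ?thesis using min[of "z + complex_of_real t *\<^sub>C y"] y z by simp
    qed
    \<comment> \<open>The minimiser of the quadratic with \<open>(nm y)^2\<close> replaced by
      \<open>(nm y)^2 + 1\<close>: the denominator stays positive, and the value at \<open>t\<close>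
      is still strictly negative.\<close>
    define t where "t = - a / ((nm y)\<^sup>2 + 1)"
    have p: "(nm y)\<^sup>2 + 1 > 0" using zero_le_power2[of "nm y"] by linarith
    have ta: "t * ((nm y)\<^sup>2 + 1) = - a" using p by (simp add: t_def)
    have "2 * t * a + t\<^sup>2 * (nm y)\<^sup>2 = 2 * t * a + t * (t * ((nm y)\<^sup>2 + 1)) - t\<^sup>2"
      by (simp add: algebra_simps power2_eq_square)
    also have "\<dots> = t * a - t\<^sup>2" unfolding ta by simp
    also have "t * a = - (a\<^sup>2) / ((nm y)\<^sup>2 + 1)" by (simp add: t_def power2_eq_square)
    finally have e: "2 * t * a + t\<^sup>2 * (nm y)\<^sup>2 = - (a\<^sup>2 / ((nm y)\<^sup>2 + 1)) - t\<^sup>2" by simp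
    have "a\<^sup>2 / ((nm y)\<^sup>2 + 1) > 0" using a p by (intro divide_pos_pos) auto
    then have "2 * t * a + t\<^sup>2 * (nm y)\<^sup>2 < 0" using zero_le_power2[of t] e by linarith
    then show False using J2[of t] by simp
  qed
  have "f y = ip y z" if y: "y \<in> M" for y
  proof (rule complex_eqI)
    show "Re (f y) = Re (ip y z)" by (rule Re0[OF y])
    have "Re (f (\<i> *\<^sub>C y)) = Re (ip (\<i> *\<^sub>C y) z)" using y by (intro Re0) auto
    then show "Im (f y) = Im (ip y z)" using y z by (simp add: scale ip_scale_left)
  qed
  then show ?thesis using that z(1) by blast
qed

end

lemma (in ip_space) hilbert_closed_subspace:
  assumes "hilbert_space M ip" and "closed_subspace M ip N" shows "hilbert_space N ip"
proof -
  have N: "csubspace N" "N \<subseteq> M" using assms(2) by (auto simp: closed_subspace_def)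
  interpret N: ip_space N ip using N by (rule ip_space_subset)
  show ?thesis
    unfolding hilbert_space_def
  proof (intro conjI allI impI)
    fix s :: "nat \<Rightarrow> 'a" assume s: "(\<forall>k. s k \<in> N) \<and> (\<forall>e>0. \<exists>n. \<forall>m\<ge>n. \<forall>k\<ge>n. nm (s m - s k) < e)"
    then obtain x where "x \<in> M" "(\<lambda>k. nm (s k - x)) \<longlonglongrightarrow> 0"
      using assms(1)[unfolded hilbert_space_def, THEN conjunct2, THEN conjunct2, THEN spec, of s] N(2) by blast
    then show "\<exists>x\<in>N. (\<lambda>k. nm (s k - x)) \<longlonglongrightarrow> 0"
      using s assms(2)[unfolded closed_subspace_def, THEN conjunct2, THEN conjunct2, THEN spec, of s] by blast
  qed (use N N.ipo in auto)
qed

context hspace begin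

text \<open>The projection of \<open>x\<close> is the Riesz vector, in the complete space
  \<open>N\<close>, of the functional that \<open>x\<close> defines there.\<close>

lemma projection:
  assumes N: "closed_subspace M ip N" and x: "x \<in> M"
  obtains z where "z \<in> N" "\<And>y. y \<in> N \<Longrightarrow> ip (x - z) y = 0"
proof -
  have NM: "N \<subseteq> M" using N by (auto simp: closed_subspace_def)
  interpret N: hspace N ip using hilbert_closed_subspace[OF hilbert N] by unfold_locales
  obtain z where z: "z \<in> N" "\<And>y. y \<in> N \<Longrightarrow> ip y x = ip y z"
  proof (rule N.riesz[of "\<lambda>y. ip y x" "nm x"])
    show "cmod (ip y x) \<le> nm x * nm y" if "y \<in> N" for y
      using cauchy_schwarz[of y x] that x NM by (auto simp: mult.commute)
  qed (use x NM in \<open>auto simp: ip_add_left ip_scale_left subset_iff\<close>)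
  have "ip (x - z) y = 0" if "y \<in> N" for y
  proof -
    have mem: "y \<in> M" "z \<in> M" using that z NM by auto
    then show ?thesis using ip_cnj[of y "x - z"] z(2)[OF that] x by (simp add: ip_diff_right)
  qed
  then show ?thesis using that z(1) by blast
qed

end

subsection \<open>The Hahn--Banach theorem\<close>

text \<open>Homogeneity is asked as an inequality only; applied to \<open>s\<close> and to
  \<open>1/s\<close> it gives equality, and an inequality is easier to check for infima.\<close>

definition sublinear_on :: "'a::cvec set \<Rightarrow> ('a \<Rightarrow> real) \<Rightarrow> bool" where
  "sublinear_on X q \<longleftrightarrow> (\<forall>x\<in>X. \<forall>y\<in>X. q (x + y) \<le> q x + q y) \<and>
     (\<forall>s>0. \<forall>x\<in>X. q (complex_of_real s *\<^sub>C x) \<le> s * q x)"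

lemma sublinear_on_zero:
  assumes X: "csubspace X" and q: "sublinear_on X q" shows "q 0 = 0"
proof -
  have "q (complex_of_real s *\<^sub>C 0) \<le> s * q 0" if "s > 0" for s
    using q that csubspace_zero[OF X] unfolding sublinear_on_def by blast
  from this[of 2] this[of "1/2"] show ?thesis by simp
qed

lemma sublinear_on_scale:
  assumes X: "csubspace X" and q: "sublinear_on X q" and x: "x \<in> X" and s: "s \<ge> 0"
  shows "q (complex_of_real s *\<^sub>C x) = s * q x"
proof (cases "s = 0")
  case True
  then show ?thesis using sublinear_on_zero[OF X q] by simp
next
  case False
  then have s: "s > 0" using s by simp
  have le: "q (complex_of_real s *\<^sub>C x) \<le> s * q x" if "s > 0" "x \<in> X" for s x
    using q that unfolding sublinear_on_def by blast
  have "q (complex_of_real (1/s) *\<^sub>C complex_of_real s *\<^sub>C x) \<le> (1/s) * q (complex_of_real s *\<^sub>C x)"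
    using s x by (intro le csubspace_scale[OF X]) auto
  then have "s * q x \<le> q (complex_of_real s *\<^sub>C x)"
    using s by (simp add: scaleC_scaleC scaleC_one field_simps)
  then show ?thesis using le[OF s x] by simp
qed

text \<open>With \<open>t = 0\<close> the value is seen to be at most \<open>q x\<close>, and with
  \<open>t = 1\<close> at most \<open>- q y\<close> at \<open>- y\<close>: passing to this
  functional forces linearity along \<open>y\<close>. A minimal sublinear functional must equal it
  for every \<open>y\<close>, which is where additivity comes from.\<close>

definition sublinear_lower :: "('a::cvec \<Rightarrow> real) \<Rightarrow> 'a \<Rightarrow> 'a \<Rightarrow> real" where
  "sublinear_lower q y x = (INF t\<in>{0..}. q (x + complex_of_real t *\<^sub>C y) - t * q y)"

context
  fixes X :: "'a::cvec set" and q :: "'a \<Rightarrow> real" and y :: 'a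
  assumes X: "csubspace X" and q: "sublinear_on X q" and y: "y \<in> X"
begin

lemma sublinear_lower_le:
  assumes x: "x \<in> X" and t: "t \<ge> 0"
  shows "sublinear_lower q y x \<le> q (x + complex_of_real t *\<^sub>C y) - t * q y"
  unfolding sublinear_lower_def
proof (rule cINF_lower)
  have "- q (- x) \<le> q (x + complex_of_real t *\<^sub>C y) - t * q y" if t: "t \<ge> 0" for t
  proof -
    let ?u = "complex_of_real t *\<^sub>C y"
    have "q (- x + (x + ?u)) \<le> q (- x) + q (x + ?u)"
      using q x y csubspace_minus[OF X] csubspace_add[OF X] csubspace_scale[OF X]
      unfolding sublinear_on_def by blast
    moreover have "q ?u = t * q y" by (rule sublinear_on_scale[OF X q y t])
    ultimately show ?thesis by simp
  qed
  then show "bdd_below ((\<lambda>t. q (x + complex_of_real t *\<^sub>C y) - t * q y) ` {0..})"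
    by (intro bdd_belowI2[of _ "- q (- x)"]) auto
qed (use t in auto)

lemma sublinear_lower_greatest:
  assumes "\<And>t. t \<ge> 0 \<Longrightarrow> c \<le> q (x + complex_of_real t *\<^sub>C y) - t * q y"
  shows "c \<le> sublinear_lower q y x"
  unfolding sublinear_lower_def by (rule cINF_greatest) (use assms in auto)

lemma sublinear_on_lower: "sublinear_on X (sublinear_lower q y)"
  unfolding sublinear_on_def
proof (intro conjI ballI allI impI)
  fix x x' assume x: "x \<in> X" "x' \<in> X"
  have key: "sublinear_lower q y (x + x') \<le> (q (x + complex_of_real t *\<^sub>C y) - t * q y) + (q (x' + complex_of_real t' *\<^sub>C y) - t' * q y)"
    if "t \<ge> 0" "t' \<ge> 0" for t t'
  proof -
    have "sublinear_lower q y (x + x') \<le> q (x + x' + complex_of_real (t + t') *\<^sub>C y) - (t + t') * q y"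
      using x that by (intro sublinear_lower_le csubspace_add[OF X]) auto
    also have "x + x' + complex_of_real (t + t') *\<^sub>C y = (x + complex_of_real t *\<^sub>C y) + (x' + complex_of_real t' *\<^sub>C y)"
      by (simp add: scaleC_add_left algebra_simps)
    also have "q \<dots> \<le> q (x + complex_of_real t *\<^sub>C y) + q (x' + complex_of_real t' *\<^sub>C y)"
      using q x y csubspace_add[OF X] csubspace_scale[OF X] unfolding sublinear_on_def by blast
    finally show ?thesis by (simp add: algebra_simps)
  qed
  have "sublinear_lower q y (x + x') - (q (x + complex_of_real t *\<^sub>C y) - t * q y) \<le> sublinear_lower q y x'"
    if t: "t \<ge> 0" for t
  proof (rule sublinear_lower_greatest)
    fix t' :: real assume "t' \<ge> 0"
    from key[OF t this] show "sublinear_lower q y (x + x') - (q (x + complex_of_real t *\<^sub>C y) - t * q y)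
        \<le> q (x' + complex_of_real t' *\<^sub>C y) - t' * q y" by linarith
  qed
  then have "sublinear_lower q y (x + x') - sublinear_lower q y x' \<le> sublinear_lower q y x"
    by (intro sublinear_lower_greatest) (simp add: algebra_simps)
  then show "sublinear_lower q y (x + x') \<le> sublinear_lower q y x + sublinear_lower q y x'" by simp
next
  fix s :: real and x assume s: "s > 0" and x: "x \<in> X"
  have "sublinear_lower q y (complex_of_real s *\<^sub>C x) / s \<le> q (x + complex_of_real t *\<^sub>C y) - t * q y" if t: "t \<ge> 0" for t
  proof -
    have "sublinear_lower q y (complex_of_real s *\<^sub>C x) \<le> q (complex_of_real s *\<^sub>C x + complex_of_real (s * t) *\<^sub>C y) - (s * t) * q y"
      using s t x by (intro sublinear_lower_le csubspace_scale[OF X]) auto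
    also have "complex_of_real s *\<^sub>C x + complex_of_real (s * t) *\<^sub>C y = complex_of_real s *\<^sub>C (x + complex_of_real t *\<^sub>C y)"
      by (simp add: scaleC_add_right scaleC_scaleC)
    also have "q \<dots> = s * q (x + complex_of_real t *\<^sub>C y)"
      using s x y by (intro sublinear_on_scale[OF X q] csubspace_add[OF X] csubspace_scale[OF X]) auto
    finally show ?thesis using s by (simp add: field_simps)
  qed
  then have "sublinear_lower q y (complex_of_real s *\<^sub>C x) / s \<le> sublinear_lower q y x"
    by (rule sublinear_lower_greatest)
  then show "sublinear_lower q y (complex_of_real s *\<^sub>C x) \<le> s * sublinear_lower q y x"
    using s by (simp add: field_simps)
qed

end

text \<open>A minimal sublinear functional is additive.\<close>
lemma sublinear_dominates_additive:
  fixes X :: "'a::cvec set"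
  assumes X: "csubspace X" and p: "sublinear_on X p"
  obtains f where "sublinear_on X f" "\<And>x. x \<in> X \<Longrightarrow> f x \<le> p x"
    "\<And>x y. x \<in> X \<Longrightarrow> y \<in> X \<Longrightarrow> f (x + y) = f x + f y"
proof -
  define A where "A = {q. sublinear_on X q \<and> (\<forall>x\<in>X. q x \<le> p x) \<and> (\<forall>x. x \<notin> X \<longrightarrow> q x = 0)}"
  \<comment> \<open>The order is reversed, so that the maximal element delivered by Zorn's lemma is
    a minimal sublinear functional. Members of \<open>A\<close> are 0 off \<open>X\<close>, so that
    agreement on \<open>X\<close> is equality of functions.\<close>
  define P where "P = (\<lambda>q q' :: 'a \<Rightarrow> real. \<forall>x. q' x \<le> q x)"
  have AI: "(\<lambda>x. if x \<in> X then q x else 0) \<in> A" if "sublinear_on X q" "\<And>x. x \<in> X \<Longrightarrow> q x \<le> p x" for q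
    using that csubspace_add[OF X] csubspace_scale[OF X] by (auto simp: A_def sublinear_on_def)
  have "\<exists>m\<in>A. \<forall>a\<in>A. P m a \<longrightarrow> a = m"
  proof (rule predicate_Zorn)
    show "partial_order_on A (relation_of P A)"
      by (rule partial_order_on_relation_ofI) (auto simp: P_def intro!: ext intro: order.trans antisym)
    fix C assume C: "C \<in> Chains (relation_of P A)"
    show "\<exists>u\<in>A. \<forall>a\<in>C. P a u"
    proof (cases "C = {}")
      case True
      then show ?thesis using AI[OF p] by auto
    next
      case False
      have CA: "C \<subseteq> A" and lin: "\<And>a b. a \<in> C \<Longrightarrow> b \<in> C \<Longrightarrow> P a b \<or> P b a"
        using C by (auto simp: Chains_def relation_of_def)
      define u where "u = (\<lambda>x. INF q\<in>C. q x)"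
      have bdd: "bdd_below ((\<lambda>q. q x) ` C)" for x
      proof (cases "x \<in> X")
        case True
        have "- p (- x) \<le> q x" if "q \<in> C" for q
        proof -
          have q: "sublinear_on X q" "q (- x) \<le> p (- x)"
            using that CA True csubspace_minus[OF X] by (auto simp: A_def)
          have "q (x + - x) \<le> q x + q (- x)"
            using q(1) True csubspace_minus[OF X] unfolding sublinear_on_def by blast
          then show ?thesis using q sublinear_on_zero[OF X q(1)] by simp
        qed
        then show ?thesis by (intro bdd_belowI2)
      next
        case False
        then show ?thesis using CA by (intro bdd_belowI2[of _ 0]) (auto simp: A_def)
      qed
      have ule: "u x \<le> q x" if "q \<in> C" for q x
        unfolding u_def by (rule cINF_lower[OF bdd that])
      have ugr: "c \<le> u x" if "\<And>q. q \<in> C \<Longrightarrow> c \<le> q x" for c x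
        unfolding u_def using \<open>C \<noteq> {}\<close> that by (rule cINF_greatest)
      have sub: "sublinear_on X u"
        unfolding sublinear_on_def
      proof (intro conjI ballI allI impI)
        fix x y assume xy: "x \<in> X" "y \<in> X"
        \<comment> \<open>The infima at \<open>x\<close> and at \<open>y\<close> may come from
          different members \<open>a\<close>, \<open>b\<close> of the chain; the smaller of the two
          serves for both.\<close>
        have le: "u (x + y) \<le> a x + b y" if ab: "a \<in> C" "b \<in> C" for a b
        proof -
          have add: "u (x + y) \<le> q x + q y" if "q \<in> C" for q
          proof -
            have "q (x + y) \<le> q x + q y" using that CA xy by (auto simp: A_def sublinear_on_def)
            then show ?thesis using ule[OF that, of "x + y"] by simp
          qed
          consider "P a b" | "P b a" using lin[OF ab] by blast
          then show ?thesis
          proof cases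
            case 1
            then have "b x \<le> a x" by (simp add: P_def)
            then show ?thesis using add[OF ab(2)] by simp
          next
            case 2
            then have "a y \<le> b y" by (simp add: P_def)
            then show ?thesis using add[OF ab(1)] by simp
          qed
        qed
        have "u (x + y) - a x \<le> u y" if "a \<in> C" for a
          using le[OF that] by (intro ugr) (simp add: algebra_simps)
        then have "u (x + y) - u y \<le> u x" by (intro ugr) (simp add: algebra_simps)
        then show "u (x + y) \<le> u x + u y" by simp
      next
        fix s :: real and x assume s: "s > 0" and x: "x \<in> X"
        have "u (complex_of_real s *\<^sub>C x) / s \<le> q x" if "q \<in> C" for q
        proof -
          have "q (complex_of_real s *\<^sub>C x) \<le> s * q x" using that CA s x by (auto simp: A_def sublinear_on_def)
          then show ?thesis using ule[OF that, of "complex_of_real s *\<^sub>C x"] s by (simp add: field_simps)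
        qed
        then have "u (complex_of_real s *\<^sub>C x) / s \<le> u x" by (rule ugr)
        then show "u (complex_of_real s *\<^sub>C x) \<le> s * u x" using s by (simp add: field_simps)
      qed
      obtain q0 where q0: "q0 \<in> C" using \<open>C \<noteq> {}\<close> by blast
      have "u x \<le> p x" if "x \<in> X" for x
        using ule[OF q0, of x] q0 CA that by (fastforce simp: A_def)
      moreover have "u x = 0" if "x \<notin> X" for x
      proof (rule antisym)
        have z: "q x = 0" if "q \<in> C" for q using that CA \<open>x \<notin> X\<close> by (auto simp: A_def)
        show "u x \<le> 0" using ule[OF q0, of x] z[OF q0] by simp
        show "0 \<le> u x" by (intro ugr) (simp add: z)
      qed
      ultimately have "u \<in> A" using sub by (simp add: A_def)
      then show ?thesis using ule by (auto simp: P_def)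
    qed
  qed
  then obtain f where f: "f \<in> A" "\<And>a. a \<in> A \<Longrightarrow> P f a \<Longrightarrow> a = f" by blast
  have fs: "sublinear_on X f" and fp: "\<And>x. x \<in> X \<Longrightarrow> f x \<le> p x" and f0: "\<And>x. x \<notin> X \<Longrightarrow> f x = 0"
    using f(1) by (auto simp: A_def)
  have "f (x + y) = f x + f y" if xy: "x \<in> X" "y \<in> X" for x y
  proof (rule antisym)
    show "f (x + y) \<le> f x + f y" using fs xy unfolding sublinear_on_def by blast
    \<comment> \<open>Minimality forces \<open>f\<close> to equal its lower functional, whose bound
      at \<open>t = 1\<close> is superadditivity.\<close>
    define g where "g = (\<lambda>x. if x \<in> X then sublinear_lower f y x else 0)"
    have le: "sublinear_lower f y x \<le> f x" if "x \<in> X" for x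
      using sublinear_lower_le[OF X fs xy(2) that, of 0] by simp
    have "sublinear_lower f y x \<le> p x" if "x \<in> X" for x using le[OF that] fp[OF that] by simp
    then have "g \<in> A" unfolding g_def by (intro AI sublinear_on_lower[OF X fs xy(2)])
    moreover have "P f g" using le f0 by (auto simp: P_def g_def)
    ultimately have "g = f" by (rule f(2))
    then have "f x = g x" by simp
    also have "g x = sublinear_lower f y x" using xy(1) by (simp add: g_def)
    also have "\<dots> \<le> f (x + y) - f y" using sublinear_lower_le[OF X fs xy(2,1), of 1] by (simp add: scaleC_one)
    finally show "f x + f y \<le> f (x + y)" by simp
  qed
  then show ?thesis using that fs fp by blast
qed

text \<open>The additive functional is taken below \<open>sublinear_lower p x0\<close> instead of
  \<open>p\<close>: this is at most \<open>- p x0\<close> at \<open>- x0\<close>, which makes the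
  functional attain the seminorm at \<open>x0\<close>. Complexification and a rotation of the value
  then give the bound on the modulus.\<close>

lemma hahn_banach_seminorm:
  fixes X :: "'a::cvec set" and p :: "'a \<Rightarrow> real"
  assumes X: "csubspace X"
    and padd: "\<And>x y. x \<in> X \<Longrightarrow> y \<in> X \<Longrightarrow> p (x + y) \<le> p x + p y"
    and pscale: "\<And>c x. x \<in> X \<Longrightarrow> p (c *\<^sub>C x) = cmod c * p x"
    and x0: "x0 \<in> X"
  obtains F :: "'a \<Rightarrow> complex" where
    "\<And>x y. x \<in> X \<Longrightarrow> y \<in> X \<Longrightarrow> F (x + y) = F x + F y"
    "\<And>c x. x \<in> X \<Longrightarrow> F (c *\<^sub>C x) = c * F x"
    "\<And>x. x \<in> X \<Longrightarrow> cmod (F x) \<le> p x" "p x0 \<le> Re (F x0)"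
proof -
  have ps: "sublinear_on X p" using padd pscale by (auto simp: sublinear_on_def)
  obtain f where fs: "sublinear_on X f" and fl: "\<And>x. x \<in> X \<Longrightarrow> f x \<le> sublinear_lower p x0 x"
    and fadd: "\<And>x y. x \<in> X \<Longrightarrow> y \<in> X \<Longrightarrow> f (x + y) = f x + f y"
    using sublinear_dominates_additive[OF X sublinear_on_lower[OF X ps x0]] by metis
  have fp: "f x \<le> p x" if "x \<in> X" for x
    using fl[OF that] sublinear_lower_le[OF X ps x0 that, of 0] by simp
  note mem = csubspace_add[OF X] csubspace_scale[OF X] csubspace_minus[OF X]
  have fminus: "f (- x) = - f x" if "x \<in> X" for x
    using fadd[OF that mem(3)[OF that]] sublinear_on_zero[OF X fs] by simp
  have fscale: "f (complex_of_real s *\<^sub>C x) = s * f x" if "x \<in> X" for s x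
  proof (cases "s \<ge> 0")
    case False
    have "f (- (complex_of_real (- s) *\<^sub>C x)) = - (- s * f x)"
      using sublinear_on_scale[OF X fs that, of "- s"] False that mem by (simp add: fminus)
    then show ?thesis by (simp add: scaleC_minus_left)
  qed (use sublinear_on_scale[OF X fs that] in simp)
  define F where "F = (\<lambda>x. Complex (f x) (- f (\<i> *\<^sub>C x)))"
  have Fadd: "F (x + y) = F x + F y" if "x \<in> X" "y \<in> X" for x y
    using that mem by (simp add: F_def fadd scaleC_add_right complex_eq_iff)
  have Fscale: "F (c *\<^sub>C x) = c * F x" if "x \<in> X" for c x
  proof -
    obtain a b where c: "c = Complex a b" by (cases c)
    have c1: "c *\<^sub>C x = complex_of_real a *\<^sub>C x + complex_of_real b *\<^sub>C \<i> *\<^sub>C x"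
      unfolding c by (simp add: scaleC_scaleC scaleC_add_left[symmetric] Complex_eq mult.commute)
    have c2: "\<i> *\<^sub>C c *\<^sub>C x = complex_of_real a *\<^sub>C \<i> *\<^sub>C x + complex_of_real (- b) *\<^sub>C x"
      unfolding c by (simp add: scaleC_scaleC scaleC_add_left[symmetric] Complex_eq algebra_simps)
    have "f (c *\<^sub>C x) = a * f x + b * f (\<i> *\<^sub>C x)"
      unfolding c1 using that mem by (subst fadd) (simp_all only: fscale mem)
    moreover have "f (\<i> *\<^sub>C c *\<^sub>C x) = a * f (\<i> *\<^sub>C x) + (- b) * f x"
      unfolding c2 using that mem by (subst fadd) (simp_all only: fscale mem)
    ultimately show ?thesis by (simp add: F_def complex_eq_iff c)
  qed
  have Fbound: "cmod (F x) \<le> p x" if x: "x \<in> X" for x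
  proof (cases "F x = 0")
    case True
    have "0 \<le> p x + p (- x)" using padd[OF x mem(3)[OF x]] pscale[OF x, of 0] by simp
    then show ?thesis using True pscale[OF x, of "-1"] by simp
  next
    case False
    define c where "c = cnj (F x) / of_real (cmod (F x))"
    have cF: "c * F x = of_real (cmod (F x))"
      using False by (simp add: c_def complex_norm_square[symmetric] mult.commute[of _ "F x"] power2_eq_square field_simps)
    have "cmod (F x) = Re (F (c *\<^sub>C x))" using cF by (simp add: Fscale x)
    also have "\<dots> = f (c *\<^sub>C x)" by (simp add: F_def)
    also have "\<dots> \<le> p (c *\<^sub>C x)" using x mem by (intro fp) auto
    also have "\<dots> = p x" using False x by (simp add: pscale c_def norm_divide)
    finally show ?thesis .
  qed
  have "f (- x0) \<le> p (- x0 + x0) - p x0"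
    using fl[OF mem(3)[OF x0]] sublinear_lower_le[OF X ps x0 mem(3)[OF x0], of 1] by (simp add: scaleC_one)
  then have "p x0 \<le> Re (F x0)" using fminus[OF x0] pscale[OF x0, of 0] by (simp add: F_def)
  then show ?thesis using that Fadd Fscale Fbound by blast
qed

subsection \<open>The Fock space\<close>

lemma l2_summable_mult:
  assumes "f \<in> l2 X" "g \<in> l2 X"
  shows "(\<lambda>p. f p * cnj (g p)) summable_on X"
proof (rule abs_summable_summable, rule summable_on_comparison_test)
  show "(\<lambda>p. (cmod (f p))\<^sup>2 + (cmod (g p))\<^sup>2) summable_on X"
    using assms by (intro summable_on_add) (auto simp: l2_def)
  show "norm (f p * cnj (g p)) \<le> (cmod (f p))\<^sup>2 + (cmod (g p))\<^sup>2" for p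
  proof -
    have "0 \<le> (cmod (f p) - cmod (g p))\<^sup>2" "0 \<le> (cmod (f p))\<^sup>2" "0 \<le> (cmod (g p))\<^sup>2" "0 \<le> cmod (f p) * cmod (g p)" by simp_all
    then show ?thesis unfolding norm_mult complex_mod_cnj power2_diff mult.assoc by linarith
  qed
qed auto

lemma csubspace_l2: "csubspace (l2 X)"
  unfolding csubspace_def
proof (intro conjI ballI allI)
  show "0 \<in> l2 X" by (simp add: l2_def)
next
  fix f g assume f: "f \<in> l2 X" and g: "g \<in> l2 X"
  have "(\<lambda>p. (cmod ((f + g) p))\<^sup>2) summable_on X"
  proof (rule summable_on_comparison_test)
    show "(\<lambda>p. 2 * (cmod (f p))\<^sup>2 + 2 * (cmod (g p))\<^sup>2) summable_on X"
      using f g by (intro summable_on_add summable_on_cmult_right) (auto simp: l2_def)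
    show "(cmod ((f + g) p))\<^sup>2 \<le> 2 * (cmod (f p))\<^sup>2 + 2 * (cmod (g p))\<^sup>2" for p
    proof -
      have "(cmod ((f + g) p))\<^sup>2 \<le> (cmod (f p) + cmod (g p))\<^sup>2"
        by (intro power_mono) (auto intro: norm_triangle_ineq)
      moreover have "0 \<le> (cmod (f p) - cmod (g p))\<^sup>2" by simp
      ultimately show ?thesis by (simp add: power2_diff power2_sum)
    qed
  qed auto
  then show "f + g \<in> l2 X" using f g by (auto simp: l2_def)
next
  fix c f assume f: "f \<in> l2 X"
  then show "c *\<^sub>C f \<in> l2 X"
    by (auto simp: l2_def norm_mult power_mult_distrib intro!: summable_on_cmult_right)
qed

lemma l2_ip_self: "l2_ip X f f = of_real (\<Sum>\<^sub>\<infinity>p\<in>X. (cmod (f p))\<^sup>2)"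
  unfolding l2_ip_def complex_norm_square[symmetric]
  by (intro infsum_bounded_linear_strong summable_on_bounded_linear_iff[OF bounded_linear_of_real bounded_linear_Re]
      bounded_linear_of_real) simp

lemma inner_product_l2: "inner_product_on (l2 X) (l2_ip X)"
  unfolding inner_product_on_def
proof (intro conjI ballI allI impI)
  fix f g h assume "f \<in> l2 X" "g \<in> l2 X" "h \<in> l2 X"
  then show "l2_ip X (f + g) h = l2_ip X f h + l2_ip X g h"
    by (simp add: l2_ip_def distrib_right infsum_add l2_summable_mult)
next
  fix c f g show "l2_ip X (c *\<^sub>C f) g = c * l2_ip X f g"
    by (simp add: l2_ip_def mult.assoc infsum_cmult_right')
next
  fix f g show "l2_ip X g f = cnj (l2_ip X f g)"
    by (simp add: l2_ip_def infsum_cnj[symmetric] mult.commute)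
next
  fix f show "0 \<le> Re (l2_ip X f f)"
    by (simp add: l2_ip_self infsum_nonneg)
next
  fix f assume f: "f \<in> l2 X" "l2_ip X f f = 0"
  have "(cmod (f p))\<^sup>2 = 0" if "p \<in> X" for p
    using f that by (intro nonneg_infsum_le_0D[of "\<lambda>p. (cmod (f p))\<^sup>2" X]) (auto simp: l2_ip_self l2_def)
  then show "f = 0" using f(1) by (auto simp: l2_def fun_eq_iff)
qed

lemma ip_space_l2: "ip_space (l2 X) (l2_ip X)"
  by (simp add: ip_space_def csubspace_l2 inner_product_l2)

lemma l2_norm_sq: "(cnorm (l2_ip X) f)\<^sup>2 = (\<Sum>\<^sub>\<infinity>p\<in>X. (cmod (f p))\<^sup>2)"
  by (simp add: cnorm_def l2_ip_self infsum_nonneg)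

interpretation fock: ip_space "fock n" "fock_ip n" for n
  unfolding fock_def fock_ip_def by (rule ip_space_l2)

abbreviation fnorm :: "nat \<Rightarrow> (nat list \<Rightarrow> complex) \<Rightarrow> real" where
  "fnorm n \<equiv> cnorm (fock_ip n)"

lemma fock_norm_sq: "(fnorm n f)\<^sup>2 = (\<Sum>\<^sub>\<infinity>w\<in>words n. (cmod (f w))\<^sup>2)"
  by (simp add: fock_ip_def l2_norm_sq)

lemma fock_outside: "f \<in> fock n \<Longrightarrow> w \<notin> words n \<Longrightarrow> f w = 0"
  by (simp add: fock_def l2_def)

lemma words_Nil [simp]: "[] \<in> words n" by (simp add: words_def)
lemma words_append [simp]: "u @ v \<in> words n \<longleftrightarrow> u \<in> words n \<and> v \<in> words n" by (auto simp: words_def)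
lemma words_Cons [simp]: "i # v \<in> words n \<longleftrightarrow> i < n \<and> v \<in> words n" by (auto simp: words_def)
lemma words_take: "w \<in> words n \<Longrightarrow> take i w \<in> words n" by (auto simp: words_def dest: in_set_takeD)
lemma words_drop: "w \<in> words n \<Longrightarrow> drop i w \<in> words n" by (auto simp: words_def dest: in_set_dropD)

lemma word_op_Nil [simp]: "word_op V [] x = x" by (simp add: word_op_def)
lemma word_op_Cons [simp]: "word_op V (i # w) x = V i (word_op V w x)" by (simp add: word_op_def)
lemma word_op_append: "word_op V (u @ v) x = word_op V u (word_op V v x)" by (induction u) auto

lemma word_op_shift:
  "word_op shift_op u f w = (if take (length u) w = u then f (drop (length u) w) else 0)"
proof (induction u arbitrary: w)
  case (Cons i u)
  then show ?case by (cases w) (auto simp: shift_op_def)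
qed simp

lemma word_op_shift_append [simp]: "word_op shift_op u f (u @ w) = f w"
  by (simp add: word_op_shift)

lemma word_op_shift_eq_0: "w \<notin> (@) u ` words n \<Longrightarrow> f \<in> fock n \<Longrightarrow> w \<in> words n \<Longrightarrow> word_op shift_op u f w = 0"
  unfolding word_op_shift 
  by (metis append_take_drop_id image_eqI words_drop)

lemma fock_words_append:
  assumes u: "u \<in> words n" and h: "\<And>w. w \<in> words n \<Longrightarrow> w \<notin> (@) u ` words n \<Longrightarrow> h w = (0::'b::{comm_monoid_add,t2_space})"
  shows "infsum h (words n) = (\<Sum>\<^sub>\<infinity>w\<in>words n. h (u @ w))" "h summable_on words n \<longleftrightarrow> (\<lambda>w. h (u @ w)) summable_on words n"
proof -
  have sub: "(@) u ` words n \<subseteq> words n" using u by auto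
  have inj: "inj_on ((@) u) (words n)" by (simp add: inj_on_def)
  have "infsum h (words n) = infsum h ((@) u ` words n)"
    using sub h by (intro infsum_cong_neutral) auto
  then show "infsum h (words n) = (\<Sum>\<^sub>\<infinity>w\<in>words n. h (u @ w))"
    by (simp add: infsum_reindex[OF inj] o_def)
  have "h summable_on words n \<longleftrightarrow> h summable_on ((@) u ` words n)"
    using sub h by (intro summable_on_cong_neutral) auto
  then show "h summable_on words n \<longleftrightarrow> (\<lambda>w. h (u @ w)) summable_on words n"
    by (simp add: summable_on_reindex[OF inj] o_def)
qed

lemma word_op_shift_fock:
  assumes u: "u \<in> words n" and f: "f \<in> fock n" shows "word_op shift_op u f \<in> fock n"
proof -
  have "(\<lambda>w. (cmod (word_op shift_op u f w))\<^sup>2) summable_on words n"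
    using fock_words_append(2)[OF u, of "\<lambda>w. (cmod (word_op shift_op u f w))\<^sup>2"] f
    by (auto simp: word_op_shift_eq_0 fock_def l2_def)
  moreover have "word_op shift_op u f w = 0" if "w \<notin> words n" for w
    using that u f by (simp add: word_op_shift) (metis append_take_drop_id fock_outside words_append)
  ultimately show ?thesis by (auto simp: fock_def l2_def)
qed

definition word_adj :: "nat \<Rightarrow> nat list \<Rightarrow> (nat list \<Rightarrow> complex) \<Rightarrow> nat list \<Rightarrow> complex" where
  "word_adj n u g = (\<lambda>w. if w \<in> words n then g (u @ w) else 0)"

lemma word_adj_fock:
  assumes u: "u \<in> words n" and g: "g \<in> fock n" shows "word_adj n u g \<in> fock n"
proof -
  have "(\<lambda>w. (cmod (g w))\<^sup>2) summable_on (@) u ` words n"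
    by (rule summable_on_subset_banach[where A = "words n"]) (use g u in \<open>auto simp: fock_def l2_def\<close>)
  then have "(\<lambda>w. (cmod (g (u @ w)))\<^sup>2) summable_on words n"
    by (subst (asm) summable_on_reindex) (auto simp: inj_on_def o_def)
  then have "(\<lambda>w. (cmod (word_adj n u g w))\<^sup>2) summable_on words n"
    by (rule summable_on_cong[THEN iffD1, rotated]) (simp add: word_adj_def)
  then show ?thesis by (simp add: fock_def l2_def word_adj_def)
qed

lemma word_adj_ip:
  assumes u: "u \<in> words n" and f: "f \<in> fock n"
  shows "fock_ip n (word_op shift_op u f) g = fock_ip n f (word_adj n u g)"
  unfolding fock_ip_def l2_ip_def
  by (subst fock_words_append(1)[OF u]) (auto simp: word_op_shift_eq_0 f word_adj_def intro!: infsum_cong)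

lemma word_op_shift_isometry:
  assumes u: "u \<in> words n" and f: "f \<in> fock n"
  shows "fock_ip n (word_op shift_op u f) (word_op shift_op u g) = fock_ip n f g"
  unfolding word_adj_ip[OF u f] unfolding fock_ip_def l2_ip_def
  by (auto simp: word_adj_def intro!: infsum_cong)

lemma fnorm_word_op_shift [simp]:
  "u \<in> words n \<Longrightarrow> f \<in> fock n \<Longrightarrow> fnorm n (word_op shift_op u f) = fnorm n f"
  by (simp add: cnorm_def word_op_shift_isometry)

lemma fnorm_word_adj:
  assumes u: "u \<in> words n" and g: "g \<in> fock n" shows "fnorm n (word_adj n u g) \<le> fnorm n g"
proof (cases "fnorm n (word_adj n u g) = 0")
  case False
  let ?b = "word_adj n u g"
  have b: "?b \<in> fock n" by (rule word_adj_fock[OF u g])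
  have "of_real ((fnorm n ?b)\<^sup>2) = fock_ip n (word_op shift_op u ?b) g"
    by (simp add: word_adj_ip[OF u b] fock.ip_self[OF b])
  then have "(fnorm n ?b)\<^sup>2 = cmod (fock_ip n (word_op shift_op u ?b) g)"
    by (metis abs_power2 norm_of_real)
  also have "\<dots> \<le> fnorm n (word_op shift_op u ?b) * fnorm n g"
    by (rule fock.cauchy_schwarz[OF word_op_shift_fock[OF u b] g])
  finally show ?thesis using False u b fock.nm_nonneg[OF b] by (simp add: power2_eq_square)
qed (use g in simp)

section \<open>Basis vectors and truncation to finitely many degrees\<close>

definition ev :: "nat list \<Rightarrow> nat list \<Rightarrow> complex" where "ev w = (\<lambda>v. if v = w then 1 else 0)"

definition wd :: "nat \<Rightarrow> nat \<Rightarrow> nat list set" where "wd n K = {w \<in> words n. length w < K}"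

lemma finite_wd [simp]: "finite (wd n K)"
proof (rule finite_subset)
  show "wd n K \<subseteq> {w. set w \<subseteq> {..<n} \<and> length w \<le> K}" by (auto simp: wd_def words_def)
qed (simp add: finite_lists_length_le)

lemma wd_words: "wd n K \<subseteq> words n" by (auto simp: wd_def)

definition trunc :: "nat \<Rightarrow> (nat list \<Rightarrow> complex) \<Rightarrow> nat list \<Rightarrow> complex" where
  "trunc K f = (\<lambda>w. if length w < K then f w else 0)"

lemma fock_finite_support:
  assumes "finite A" "A \<subseteq> words n" "\<And>w. w \<notin> A \<Longrightarrow> f w = 0"
  shows "f \<in> fock n" "fock_ip n f g = (\<Sum>w\<in>A. f w * cnj (g w))" "(fnorm n f)\<^sup>2 = (\<Sum>w\<in>A. (cmod (f w))\<^sup>2)"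
proof -
  have "(\<lambda>w. (cmod (f w))\<^sup>2) summable_on words n \<longleftrightarrow> (\<lambda>w. (cmod (f w))\<^sup>2) summable_on A"
    using assms by (intro summable_on_cong_neutral) auto
  then show "f \<in> fock n" using assms by (auto simp: fock_def l2_def)
  have "infsum h (words n) = infsum h A" if "\<And>w. w \<notin> A \<Longrightarrow> h w = 0" for h :: "nat list \<Rightarrow> 'b::{comm_monoid_add,t2_space}"
    using assms(2) that by (intro infsum_cong_neutral) auto
  note r = this
  show "fock_ip n f g = (\<Sum>w\<in>A. f w * cnj (g w))"
    unfolding fock_ip_def l2_ip_def using assms by (subst r) auto
  show "(fnorm n f)\<^sup>2 = (\<Sum>w\<in>A. (cmod (f w))\<^sup>2)"
    unfolding fock_norm_sq using assms by (subst r) auto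
qed

lemma ev_fock [simp, intro]: "w \<in> words n \<Longrightarrow> ev w \<in> fock n"
  by (rule fock_finite_support(1)[of "{w}"]) (auto simp: ev_def)

lemma fock_ip_ev_left: "w \<in> words n \<Longrightarrow> fock_ip n (ev w) g = cnj (g w)"
  by (subst fock_finite_support(2)[of "{w}"]) (auto simp: ev_def)

lemma fock_ip_ev: "w \<in> words n \<Longrightarrow> f \<in> fock n \<Longrightarrow> fock_ip n f (ev w) = f w"
  using fock.ip_cnj[of "ev w" n f] by (simp add: fock_ip_ev_left)

lemma fnorm_ev [simp]: "w \<in> words n \<Longrightarrow> fnorm n (ev w) = 1"
  by (simp add: cnorm_def fock_ip_ev) (simp add: ev_def)

lemma trunc_eq: "f \<in> fock n \<Longrightarrow> w \<notin> wd n K \<Longrightarrow> trunc K f w = 0"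
  by (auto simp: trunc_def wd_def fock_outside)

lemma trunc_wd: "w \<in> wd n K \<Longrightarrow> trunc K f w = f w"
  by (simp add: trunc_def wd_def)

lemma trunc_fock [simp, intro]: "f \<in> fock n \<Longrightarrow> trunc K f \<in> fock n"
  by (rule fock_finite_support(1)[of "wd n K"]) (auto simp: trunc_eq wd_words)

lemma fock_ip_trunc: "f \<in> fock n \<Longrightarrow> fock_ip n (trunc K f) g = (\<Sum>w\<in>wd n K. f w * cnj (g w))"
  by (subst fock_finite_support(2)[of "wd n K"]) (auto simp: trunc_eq wd_words trunc_wd)

lemma fnorm_trunc_sq: "f \<in> fock n \<Longrightarrow> (fnorm n (trunc K f))\<^sup>2 = (\<Sum>w\<in>wd n K. (cmod (f w))\<^sup>2)"
  by (subst fock_finite_support(3)[of "wd n K"]) (auto simp: trunc_eq wd_words trunc_wd)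

lemma fnorm_trunc_diff_sq: "f \<in> fock n \<Longrightarrow> (fnorm n (f - trunc K f))\<^sup>2 = (fnorm n f)\<^sup>2 - (fnorm n (trunc K f))\<^sup>2"
proof -
  assume f: "f \<in> fock n"
  have "fock_ip n (trunc K f) f = of_real (\<Sum>w\<in>wd n K. (cmod (f w))\<^sup>2)"
    unfolding fock_ip_trunc[OF f] by (simp add: complex_norm_square[symmetric] of_real_sum del: of_real_power)
  then have "Re (fock_ip n f (trunc K f)) = (fnorm n (trunc K f))\<^sup>2"
    using fock.ip_cnj[of "trunc K f" n f] f by (simp add: fnorm_trunc_sq)
  then show ?thesis using f by (simp add: fock.nm_sq_diff)
qed

lemma fnorm_trunc_le: "f \<in> fock n \<Longrightarrow> fnorm n (trunc K f) \<le> fnorm n f"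
proof -
  assume f: "f \<in> fock n"
  have "(fnorm n (trunc K f))\<^sup>2 \<le> (fnorm n f)\<^sup>2"
    using fnorm_trunc_diff_sq[OF f, of K] zero_le_power2[of "fnorm n (f - trunc K f)"] by linarith
  then show ?thesis using f by (simp add: abs_le_square_iff[symmetric])
qed

lemma fnorm_trunc_tendsto: 
  assumes f: "f \<in> fock n" shows "(\<lambda>K. fnorm n (f - trunc K f)) \<longlonglongrightarrow> 0"
proof -
  have "filterlim (wd n) (finite_subsets_at_top (words n)) sequentially"
    unfolding filterlim_finite_subsets_at_top
  proof (intro allI impI)
    fix X assume X: "finite X \<and> X \<subseteq> words n"
    then obtain L where L: "\<And>w. w \<in> X \<Longrightarrow> length w < L"
      by (metis finite_imageI finite_nat_set_iff_bounded image_eqI)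
    have "finite (wd n y) \<and> X \<subseteq> wd n y \<and> wd n y \<subseteq> words n" if "y \<ge> L" for y
      using X that by (simp, auto simp: wd_def intro: less_le_trans[OF L])
    then show "\<forall>\<^sub>F y in sequentially. finite (wd n y) \<and> X \<subseteq> wd n y \<and> wd n y \<subseteq> words n"
      unfolding eventually_sequentially by blast
  qed
  moreover have "(sum (\<lambda>w. (cmod (f w))\<^sup>2) \<longlongrightarrow> (\<Sum>\<^sub>\<infinity>w\<in>words n. (cmod (f w))\<^sup>2)) (finite_subsets_at_top (words n))"
    using f by (intro infsum_tendsto) (simp add: fock_def l2_def)
  ultimately have "(\<lambda>K. \<Sum>w\<in>wd n K. (cmod (f w))\<^sup>2) \<longlonglongrightarrow> (fnorm n f)\<^sup>2"
    unfolding fock_norm_sq by (rule filterlim_compose[rotated])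
  then have "(\<lambda>K. sqrt ((fnorm n f)\<^sup>2 - (\<Sum>w\<in>wd n K. (cmod (f w))\<^sup>2))) \<longlonglongrightarrow> sqrt ((fnorm n f)\<^sup>2 - (fnorm n f)\<^sup>2)"
    by (intro tendsto_intros)
  moreover have "sqrt ((fnorm n f)\<^sup>2 - (\<Sum>w\<in>wd n K. (cmod (f w))\<^sup>2)) = fnorm n (f - trunc K f)" for K
    using fnorm_trunc_diff_sq[OF f, of K, symmetric] f by (simp add: fnorm_trunc_sq)
  ultimately show ?thesis by simp
qed

lemma fnorm_le_if_trunc_le:
  assumes f: "f \<in> fock n" and "\<And>K. fnorm n (trunc K f) \<le> C" shows "fnorm n f \<le> C"
proof (rule LIMSEQ_le_const)
  show "(\<lambda>K. C + fnorm n (f - trunc K f)) \<longlonglongrightarrow> C"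
    using tendsto_add[OF tendsto_const fnorm_trunc_tendsto[OF f]] by simp
  have "fnorm n f \<le> C + fnorm n (f - trunc K f)" for K
    using fock.nm_triangle_le[OF f trunc_fock[OF f], of K] assms(2)[of K] by linarith
  then show "\<exists>N. \<forall>K\<ge>N. fnorm n f \<le> C + fnorm n (f - trunc K f)" by blast
qed

text \<open>Boundedness in norm reduces the test vector \<open>g\<close> to one of finite support,
  where coordinatewise convergence is enough.\<close>

lemma fock_weak_limit:
  assumes h: "\<And>j. h j \<in> fock n" "\<And>j. fnorm n (h j) \<le> C" and h': "h' \<in> fock n" and g: "g \<in> fock n"
    and lim: "\<And>w. w \<in> words n \<Longrightarrow> (\<lambda>j. h j w) \<longlonglongrightarrow> h' w"
  shows "(\<lambda>j. fock_ip n (h j) g) \<longlonglongrightarrow> fock_ip n h' g"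
proof (rule LIMSEQ_I)
  fix e :: real assume e: "e > 0"
  define D where "D = C + fnorm n h' + 1"
  have D: "D > 0" using fock.nm_nonneg[OF h(1)[of 0]] h(2)[of 0] fock.nm_nonneg[OF h'] by (simp add: D_def)
  have "\<forall>\<^sub>F K in sequentially. fnorm n (g - trunc K g) < e / 2 / D"
    using fnorm_trunc_tendsto[OF g] e D by (intro order_tendstoD) auto
  then obtain K where K: "fnorm n (g - trunc K g) < e / 2 / D" by (auto simp: eventually_sequentially)
  have ipK: "fock_ip n f (trunc K g) = (\<Sum>w\<in>wd n K. f w * cnj (g w))" if "f \<in> fock n" for f
    using fock.ip_cnj[of "trunc K g" n f] that g by (simp add: fock_ip_trunc mult.commute)
  have "(\<lambda>j. \<Sum>w\<in>wd n K. (h j w - h' w) * cnj (g w)) \<longlonglongrightarrow> (\<Sum>w\<in>wd n K. (h' w - h' w) * cnj (g w))"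
    using lim wd_words by (intro tendsto_intros) auto
  then have "(\<lambda>j. \<Sum>w\<in>wd n K. (h j w - h' w) * cnj (g w)) \<longlonglongrightarrow> 0" by simp
  from LIMSEQ_D[OF this, of "e/2"] e obtain N where
    N: "\<And>j. j \<ge> N \<Longrightarrow> cmod (\<Sum>w\<in>wd n K. (h j w - h' w) * cnj (g w)) < e / 2" by auto
  have "norm (fock_ip n (h j) g - fock_ip n h' g) < e" if j: "j \<ge> N" for j
  proof -
    let ?d = "h j - h'"
    have d: "?d \<in> fock n" using h h' by simp
    have eq: "fock_ip n (h j) g - fock_ip n h' g = fock_ip n ?d (trunc K g) + fock_ip n ?d (g - trunc K g)"
      using h h' g d by (simp add: fock.ip_diff_left fock.ip_diff_right)
    have 1: "cmod (fock_ip n (h j) g - fock_ip n h' g) \<le> cmod (fock_ip n ?d (trunc K g)) + fnorm n ?d * fnorm n (g - trunc K g)"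
      unfolding eq using d g by (intro norm_triangle_mono[OF order_refl fock.cauchy_schwarz]) auto
    have 2: "fnorm n ?d * fnorm n (g - trunc K g) \<le> D * (e / 2 / D)"
    proof (rule mult_mono)
      show "fnorm n ?d \<le> D" using fock.nm_triangle_diff[OF h(1)[of j] h'] h(2)[of j] by (simp add: D_def)
      show "0 \<le> fnorm n (g - trunc K g)" using g by (intro fock.nm_nonneg) auto
    qed (use K D in auto)
    have 3: "cmod (fock_ip n ?d (trunc K g)) < e / 2" using N[OF j] d by (simp add: ipK)
    show ?thesis using 1 2 3 D by simp
  qed
  then show "\<exists>N. \<forall>j\<ge>N. norm (fock_ip n (h j) g - fock_ip n h' g) < e" by blast
qed

subsection \<open>Convolution operators\<close>

text \<open>The index \<open>i\<close> runs over the \<open>length w + 1\<close> ways to split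
  \<open>w\<close> in two, so this is the product of formal power series in noncommuting
  variables.\<close>

definition conv :: "(nat list \<Rightarrow> complex) \<Rightarrow> (nat list \<Rightarrow> complex) \<Rightarrow> nat list \<Rightarrow> complex" where
  "conv a f w = (\<Sum>i\<le>length w. a (take i w) * f (drop i w))"

definition poly_op :: "nat list set \<Rightarrow> (nat list \<Rightarrow> complex) \<Rightarrow> (nat list \<Rightarrow> complex) \<Rightarrow> nat list \<Rightarrow> complex" where
  "poly_op W c f = (\<Sum>u\<in>W. c u *\<^sub>C word_op shift_op u f)"

lemma sum_fun_apply: "(\<Sum>i\<in>A. f i) x = (\<Sum>i\<in>A. f i x)"
  by (induction A rule: infinite_finite_induct) auto

lemma poly_op_conv:
  assumes "finite W" shows "poly_op W c f w = conv (\<lambda>u. if u \<in> W then c u else 0) f w"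
proof -
  have "poly_op W c f w = (\<Sum>u\<in>W. if take (length u) w = u then c u * f (drop (length u) w) else 0)"
    by (auto simp: poly_op_def sum_fun_apply word_op_shift intro!: sum.cong)
  also have "\<dots> = (\<Sum>u\<in>{u\<in>W. take (length u) w = u}. c u * f (drop (length u) w))"
    using assms by (simp add: sum.inter_filter)
  also have "\<dots> = (\<Sum>i\<in>{i\<in>{..length w}. take i w \<in> W}. c (take i w) * f (drop i w))"
  proof (rule sum.reindex_bij_witness[of _ "\<lambda>i. take i w" length])
    fix u assume u: "u \<in> {u \<in> W. take (length u) w = u}"
    then have "length (take (length u) w) = length u" by simp
    then show "length u \<in> {i \<in> {..length w}. take i w \<in> W}" using u by (simp add: min_def split: if_splits)
  qed auto
  also have "\<dots> = (\<Sum>i\<le>length w. if take i w \<in> W then c (take i w) * f (drop i w) else 0)"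
    by (simp only: sum.inter_filter finite_atMost)
  also have "\<dots> = conv (\<lambda>u. if u \<in> W then c u else 0) f w"
    unfolding conv_def by (intro sum.cong) auto
  finally show ?thesis .
qed

lemma conv_cong:
  assumes "\<And>i. i \<le> length w \<Longrightarrow> a (take i w) = b (take i w)" "\<And>i. i \<le> length w \<Longrightarrow> f (drop i w) = g (drop i w)"
  shows "conv a f w = conv b g w"
  unfolding conv_def using assms by (intro sum.cong) auto

lemma conv_ev_Nil [simp]: "conv a (ev []) w = a w"
proof -
  have "conv a (ev []) w = (\<Sum>i\<le>length w. if i = length w then a w else 0)"
    unfolding conv_def by (intro sum.cong) (auto simp: ev_def)
  then show ?thesis by simp
qed

lemma conv_assoc: "conv a (conv b f) w = conv (conv a b) f w"
proof -
  have "conv a (conv b f) w = (\<Sum>i\<le>length w. \<Sum>j\<le>length w - i. a (take i w) * (b (take j (drop i w)) * f (drop (i + j) w)))"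
    by (simp add: conv_def sum_distrib_left add.commute)
  also have "\<dots> = (\<Sum>(i,k)\<in>(SIGMA i:{..length w}. {..length w - i}). a (take i w) * (b (take k (drop i w)) * f (drop (i + k) w)))"
    by (simp add: sum.Sigma)
  also have "\<dots> = (\<Sum>(k,i)\<in>(SIGMA k:{..length w}. {..k}). a (take i w) * (b (take (k - i) (drop i w)) * f (drop k w)))"
    by (rule sum.reindex_bij_witness[of _ "\<lambda>(k,i). (i, k - i)" "\<lambda>(i,j). (i + j, i)"]) auto
  also have "\<dots> = (\<Sum>k\<le>length w. \<Sum>i\<le>k. a (take i w) * (b (take (k - i) (drop i w)) * f (drop k w)))"
    by (simp add: sum.Sigma)
  also have "\<dots> = conv (conv a b) f w"
    unfolding conv_def by (intro sum.cong refl) (auto simp: sum_distrib_right mult.assoc min_def drop_take intro!: sum.cong)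
  finally show ?thesis .
qed

lemma poly_op_fock: "W \<subseteq> words n \<Longrightarrow> f \<in> fock n \<Longrightarrow> poly_op W c f \<in> fock n"
  unfolding poly_op_def by (intro fock.sum_mem) (auto simp: word_op_shift_fock subset_iff)

text \<open>Bounded operators of convolution from the left: the commutant of the right shifts. It
  contains \<open>\<L>\<^sub>n\<close> (and equals it, but only the inclusion matters here).\<close>
definition conv_ops :: "nat \<Rightarrow> ((nat list \<Rightarrow> complex) \<Rightarrow> nat list \<Rightarrow> complex) set" where
  "conv_ops n = {T. bounded_op (fock n) (fock_ip n) T \<and> (\<forall>f\<in>fock n. \<forall>w\<in>words n. T f w = conv (T (ev [])) f w)}"

lemma conv_ops_fock: "T \<in> conv_ops n \<Longrightarrow> f \<in> fock n \<Longrightarrow> T f \<in> fock n"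
  by (simp add: conv_ops_def bounded_op_def)

text \<open>For fixed \<open>f\<close> and \<open>w\<close> the convolution identity involves
  finitely many matrix coefficients of \<open>T\<close>, so it passes from polynomials to their
  limits in the weak operator topology.\<close>

lemma Ln_conv_ops: "Ln n \<subseteq> conv_ops n"
proof
  fix T assume T: "T \<in> Ln n"
  have bT: "bounded_op (fock n) (fock_ip n) T" using T by (simp add: Ln_def)
  have Tf: "T f \<in> fock n" if "f \<in> fock n" for f using bT that by (simp add: bounded_op_def)
  have "T f w = conv (T (ev [])) f w" if f: "f \<in> fock n" and w: "w \<in> words n" for f w
  proof -
    \<comment> \<open>One unit for the error in \<open>T f w\<close> and
      \<open>cmod (f (drop i w))\<close> for the error at each prefix; a tolerance of
      \<open>e / S\<close> then adds up to \<open>e\<close>.\<close>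
    define S where "S = 1 + (\<Sum>i\<le>length w. cmod (f (drop i w)))"
    have S: "S > 0" unfolding S_def by (intro add_pos_nonneg sum_nonneg) auto
    have "cmod (T f w - conv (T (ev [])) f w) \<le> 0 + e" if e: "e > 0" for e
    proof -
      \<comment> \<open>Index 0 tests the coefficient \<open>T f w\<close>; index
        \<open>i + 1\<close> tests \<open>T (ev [])\<close> at the prefix of length
        \<open>i\<close>. Counting the empty and the full prefix, these are
        \<open>length w + 2\<close> pairs.\<close>
      define x where "x = (\<lambda>k::nat. if k = 0 then f else ev [])"
      define y where "y = (\<lambda>k::nat. if k = 0 then ev w else ev (take (k - 1) w))"
      have xy: "\<forall>k<length w + 2. x k \<in> fock n \<and> y k \<in> fock n"
        using f w by (auto simp: x_def y_def words_take)
      have "e / S > 0" using e S by simp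
      then obtain p where p: "p \<in> poly_ops n"
        "\<And>k. k < length w + 2 \<Longrightarrow> cmod (fock_ip n (T (x k)) (y k) - fock_ip n (p (x k)) (y k)) < e / S"
        using T xy unfolding Ln_def by blast
      obtain W c where W: "finite W" "W \<subseteq> words n" and pc: "\<And>f. f \<in> fock n \<Longrightarrow> p f = poly_op W c f"
        using p(1) by (auto simp: poly_ops_def poly_op_def)
      have pf: "p f \<in> fock n" if "f \<in> fock n" for f using that W by (simp add: pc poly_op_fock)
      have pconv: "p f w = conv (p (ev [])) f w"
      proof -
        have "conv (poly_op W c (ev [])) f w = conv (\<lambda>u. if u \<in> W then c u else 0) f w"
          by (intro conv_cong) (simp_all add: poly_op_conv[OF W(1)])
        then show ?thesis using f W by (simp add: pc poly_op_conv)
      qed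
      have 1: "cmod (T f w - p f w) < e / S"
        using p(2)[of 0] f w by (simp add: x_def y_def fock_ip_ev Tf pf)
      have 2: "cmod (T (ev []) (take i w) - p (ev []) (take i w)) < e / S" if "i \<le> length w" for i
        using p(2)[of "Suc i"] that f w by (simp add: x_def y_def fock_ip_ev Tf pf words_take)
      have "T f w - conv (T (ev [])) f w = (T f w - p f w) + (\<Sum>i\<le>length w. (p (ev []) (take i w) - T (ev []) (take i w)) * f (drop i w))"
        by (simp add: pconv conv_def sum_subtractf left_diff_distrib)
      also have "cmod \<dots> \<le> e / S + (\<Sum>i\<le>length w. e / S * cmod (f (drop i w)))"
      proof (intro norm_triangle_mono sum_norm_le)
        show "cmod (T f w - p f w) \<le> e / S" using 1 by simp
        show "cmod ((p (ev []) (take i w) - T (ev []) (take i w)) * f (drop i w)) \<le> e / S * cmod (f (drop i w))"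
          if "i \<in> {..length w}" for i
          using 2[of i] that unfolding norm_mult by (intro mult_right_mono) (auto simp: norm_minus_commute)
      qed
      also have "\<dots> = e / S * S" by (simp only: S_def sum_distrib_left[symmetric] distrib_left mult_1_right)
      also have "\<dots> = e" using S by simp
      finally show ?thesis by simp
    qed
    then have "cmod (T f w - conv (T (ev [])) f w) \<le> 0" by (rule field_le_epsilon)
    then show ?thesis by simp
  qed
  then show "T \<in> conv_ops n" using bT by (simp add: conv_ops_def)
qed

text \<open>Multiplicativity of the functional calculus is proved on \<open>conv_ops\<close>, so
  this class has to be closed under products; associativity of convolution provides that.\<close>

lemma conv_ops_comp:
  assumes S: "S \<in> conv_ops n" and T: "T \<in> conv_ops n" shows "S \<circ> T \<in> conv_ops n"
proof -
  obtain C where C: "\<And>f. f \<in> fock n \<Longrightarrow> fnorm n (S f) \<le> C * fnorm n f"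
    using S unfolding conv_ops_def bounded_op_def by blast
  obtain D where D: "\<And>f. f \<in> fock n \<Longrightarrow> fnorm n (T f) \<le> D * fnorm n f"
    using T unfolding conv_ops_def bounded_op_def by blast
  have "fnorm n (S (T f)) \<le> (\<bar>C\<bar> * D) * fnorm n f" if f: "f \<in> fock n" for f
  proof -
    have Tf: "T f \<in> fock n" by (rule conv_ops_fock[OF T f])
    have "fnorm n (S (T f)) \<le> C * fnorm n (T f)" using C[OF Tf] .
    also have "\<dots> \<le> \<bar>C\<bar> * fnorm n (T f)" using Tf by (intro mult_right_mono) auto
    also have "\<dots> \<le> \<bar>C\<bar> * (D * fnorm n f)" by (intro mult_left_mono D[OF f]) auto
    finally show ?thesis by (simp add: mult.assoc)
  qed
  then have b: "bounded_op (fock n) (fock_ip n) (S \<circ> T)"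
    using S T unfolding conv_ops_def bounded_op_def by auto
  have cT: "T f v = conv (T (ev [])) f v" if "f \<in> fock n" "v \<in> words n" for f v
    using T that by (simp add: conv_ops_def)
  have cS: "S f v = conv (S (ev [])) f v" if "f \<in> fock n" "v \<in> words n" for f v
    using S that by (simp add: conv_ops_def)
  have "S (T f) w = conv (S (T (ev []))) f w" if f: "f \<in> fock n" and w: "w \<in> words n" for f w
  proof -
    have "S (T f) w = conv (S (ev [])) (T f) w" by (rule cS[OF conv_ops_fock[OF T f] w])
    also have "\<dots> = conv (S (ev [])) (conv (T (ev [])) f) w"
      using f w by (intro conv_cong) (simp_all add: cT words_drop)
    also have "\<dots> = conv (conv (S (ev [])) (T (ev []))) f w" by (rule conv_assoc)
    also have "\<dots> = conv (S (T (ev []))) f w"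
      using w by (intro conv_cong) (simp_all add: cS conv_ops_fock[OF T] words_take)
    finally show ?thesis .
  qed
  then show ?thesis using b by (simp add: conv_ops_def)
qed

subsection \<open>Cesaro means\<close>

text \<open>Fejer weights for the grading of words by length.\<close>

definition cesaro :: "nat \<Rightarrow> (nat list \<Rightarrow> complex) \<Rightarrow> nat list \<Rightarrow> complex" where
  "cesaro j a u = (if length u < j then (1 - of_nat (length u) / of_nat j) * a u else 0)"

lemma poly_op_cesaro:
  assumes "w \<in> words n" shows "poly_op (wd n j) (cesaro j a) f w = conv (cesaro j a) f w"
  unfolding poly_op_conv[OF finite_wd] using assms
  by (intro conv_cong) (auto simp: wd_def words_take cesaro_def)

lemma cesaro_tendsto: "(\<lambda>j. cesaro j a u) \<longlonglongrightarrow> a u"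
proof (rule tendsto_cong[THEN iffD1])
  show "\<forall>\<^sub>F j in sequentially. (1 - of_nat (length u) / of_nat j) * a u = cesaro j a u"
    using eventually_gt_at_top[of "length u"] by eventually_elim (simp add: cesaro_def)
  have "(\<lambda>j. (1 - of_nat (length u) / of_nat j) * a u) \<longlonglongrightarrow> (1 - 0) * a u"
    by (intro tendsto_intros lim_const_over_n)
  then show "(\<lambda>j. (1 - of_nat (length u) / of_nat j) * a u) \<longlonglongrightarrow> a u" by simp
qed

text \<open>The Fejer kernel is an average of compressions: \<open>\<sigma>\<^sub>j(T)\<close> is \<open>1/j\<close> times the sum of the
  compressions of \<open>T\<close> to the windows of \<open>j\<close> consecutive degrees, and each vector
  component lies in exactly \<open>j\<close> windows.\<close>
lemma cesaro_bound:
  assumes T: "T \<in> conv_ops n" and B: "\<And>f. f \<in> fock n \<Longrightarrow> fnorm n (T f) \<le> B * fnorm n f"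
    and f: "f \<in> fock n" and j: "j > 0"
  shows "fnorm n (poly_op (wd n j) (cesaro j (T (ev []))) f) \<le> B * fnorm n f"
proof -
  define a where "a = T (ev [])"
  define h where "h = poly_op (wd n j) (cesaro j a) f"
  have h: "h \<in> fock n" unfolding h_def by (rule poly_op_fock[OF wd_words f])
  have B0: "B \<ge> 0" using B[of "ev []"] fock.nm_nonneg[OF conv_ops_fock[OF T, of "ev []"]] by simp
  have "fnorm n (trunc K h) \<le> B * fnorm n f" for K
  proof -
    \<comment> \<open>Window \<open>s\<close> keeps the degrees from \<open>s - j + 1\<close> to
      \<open>s\<close>. Cutting at degree \<open>K\<close> makes every sum finite, and every window
      meeting a degree below \<open>K\<close> has \<open>s < K + j\<close>.\<close>
    define win where "win = (\<lambda>s p w. if length w \<le> s \<and> s < length w + j then trunc K p w else 0 :: complex)"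
    have win0: "win s p w = 0" if "p \<in> fock n" "w \<notin> wd n K" for s p w
      using that by (simp add: win_def trunc_eq)
    note win_fs = fock_finite_support[OF finite_wd wd_words win0]
    have win: "win s p \<in> fock n" if "p \<in> fock n" for s p using win_fs(1)[OF that] .
    have win_sq: "(\<Sum>s<K + j. (fnorm n (win s p))\<^sup>2) = j * (fnorm n (trunc K p))\<^sup>2" if p: "p \<in> fock n" for p
    proof -
      have "(\<Sum>s<K + j. (fnorm n (win s p))\<^sup>2) = (\<Sum>s<K + j. \<Sum>w\<in>wd n K. if length w \<le> s \<and> s < length w + j then (cmod (p w))\<^sup>2 else 0)"
        by (simp only: win_fs(3)[OF p], intro sum.cong) (auto simp: win_def trunc_wd)
      also have "\<dots> = (\<Sum>w\<in>wd n K. \<Sum>s<K + j. if length w \<le> s \<and> s < length w + j then (cmod (p w))\<^sup>2 else 0)"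
        by (rule sum.swap)
      also have "\<dots> = (\<Sum>w\<in>wd n K. j * (cmod (p w))\<^sup>2)"
      proof (rule sum.cong[OF refl])
        fix w assume "w \<in> wd n K"
        then have "{s\<in>{..<K + j}. length w \<le> s \<and> s < length w + j} = {length w..<length w + j}" by (auto simp: wd_def)
        then show "(\<Sum>s<K + j. if length w \<le> s \<and> s < length w + j then (cmod (p w))\<^sup>2 else 0) = j * (cmod (p w))\<^sup>2"
          by (simp add: sum.inter_filter[symmetric])
      qed
      finally show ?thesis by (simp add: fnorm_trunc_sq[OF p] sum_distrib_left)
    qed
    \<comment> \<open>The windows of \<open>f\<close> are paired with those of \<open>h\<close>
      itself: the sum is \<open>j\<close> times the squared norm of \<open>trunc K h\<close>, while
      Cauchy-Schwarz bounds it by a multiple of the first power of that norm.\<close>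
    have "(\<Sum>s<K + j. fock_ip n (T (win s f)) (win s h))
        = (\<Sum>s<K + j. \<Sum>w\<in>wd n K. \<Sum>i\<le>length w. a (take i w) * win s f (drop i w) * cnj (win s h w))"
    proof (rule sum.cong[OF refl])
      fix s
      have "fock_ip n (T (win s f)) (win s h) = cnj (fock_ip n (win s h) (T (win s f)))"
        by (rule fock.ip_cnj[OF win[OF h] conv_ops_fock[OF T win[OF f]]])
      also have "\<dots> = (\<Sum>w\<in>wd n K. T (win s f) w * cnj (win s h w))"
        by (simp add: win_fs(2)[OF h] mult.commute)
      also have "\<dots> = (\<Sum>w\<in>wd n K. conv a (win s f) w * cnj (win s h w))"
        using T win[OF f] unfolding conv_ops_def a_def by (intro sum.cong) (auto dest: wd_words[THEN subsetD])
      finally show "fock_ip n (T (win s f)) (win s h)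
          = (\<Sum>w\<in>wd n K. \<Sum>i\<le>length w. a (take i w) * win s f (drop i w) * cnj (win s h w))"
        by (simp add: conv_def sum_distrib_right)
    qed
    also have "\<dots> = (\<Sum>w\<in>wd n K. \<Sum>s<K + j. \<Sum>i\<le>length w. a (take i w) * win s f (drop i w) * cnj (win s h w))"
      by (rule sum.swap)
    also have "\<dots> = (\<Sum>w\<in>wd n K. \<Sum>i\<le>length w. \<Sum>s<K + j. a (take i w) * win s f (drop i w) * cnj (win s h w))"
      by (rule sum.cong[OF refl], rule sum.swap)
    also have "\<dots> = (\<Sum>w\<in>wd n K. \<Sum>i\<le>length w. of_nat j * (cesaro j a (take i w) * f (drop i w) * cnj (h w)))"
    proof (intro sum.cong refl)
      fix w i assume w: "w \<in> wd n K" and i: "i \<in> {..length w}"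
      define x where "x = a (take i w) * f (drop i w) * cnj (h w)"
      have "(\<Sum>s<K + j. a (take i w) * win s f (drop i w) * cnj (win s h w))
          = (\<Sum>s<K + j. if length w \<le> s \<and> s < length w - i + j then x else 0)"
        using w i by (intro sum.cong) (auto simp: win_def trunc_def wd_def x_def)
      also have "\<dots> = (\<Sum>s\<in>{s\<in>{..<K + j}. length w \<le> s \<and> s < length w - i + j}. x)"
        by (rule sum.inter_filter[symmetric]) simp
      also have "{s\<in>{..<K + j}. length w \<le> s \<and> s < length w - i + j} = {length w..<length w - i + j}"
        using w i by (auto simp: wd_def)
      \<comment> \<open>The degrees \<open>length w\<close> and \<open>length w - i\<close> share
        \<open>j - i\<close> windows, none if \<open>i \<ge> j\<close>; dividing by \<open>j\<close>
        gives exactly the weight in \<open>cesaro\<close>.\<close>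
      also have "(\<Sum>s\<in>{length w..<length w - i + j}. x) = of_nat (j - i) * x" using i by simp
      also have "\<dots> = of_nat j * (cesaro j a (take i w) * f (drop i w) * cnj (h w))"
        using i j by (auto simp: cesaro_def x_def of_nat_diff min_absorb2 field_simps)
      finally show "(\<Sum>s<K + j. a (take i w) * win s f (drop i w) * cnj (win s h w))
          = of_nat j * (cesaro j a (take i w) * f (drop i w) * cnj (h w))" .
    qed
    also have "\<dots> = of_nat j * (\<Sum>w\<in>wd n K. conv (cesaro j a) f w * cnj (h w))"
      by (simp add: conv_def sum_distrib_left sum_distrib_right)
    also have "(\<Sum>w\<in>wd n K. conv (cesaro j a) f w * cnj (h w)) = (\<Sum>w\<in>wd n K. h w * cnj (h w))"
      by (intro sum.cong refl) (simp add: h_def poly_op_cesaro wd_words[THEN subsetD])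
    also have "\<dots> = of_real ((fnorm n (trunc K h))\<^sup>2)"
      unfolding fnorm_trunc_sq[OF h] by (simp add: complex_norm_square[symmetric] of_real_sum del: of_real_power)
    finally have eq: "(\<Sum>s<K + j. fock_ip n (T (win s f)) (win s h)) = of_real (j * (fnorm n (trunc K h))\<^sup>2)" by simp
    have "j * (fnorm n (trunc K h))\<^sup>2 = cmod (\<Sum>s<K + j. fock_ip n (T (win s f)) (win s h))"
      unfolding eq norm_of_real by simp
    also have "\<dots> \<le> (\<Sum>s<K + j. B * (fnorm n (win s f) * fnorm n (win s h)))"
    proof (rule sum_norm_le)
      fix s
      have "cmod (fock_ip n (T (win s f)) (win s h)) \<le> fnorm n (T (win s f)) * fnorm n (win s h)"
        by (intro fock.cauchy_schwarz conv_ops_fock[OF T] win f h)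
      also have "\<dots> \<le> (B * fnorm n (win s f)) * fnorm n (win s h)"
        by (intro mult_right_mono B win f fock.nm_nonneg h)
      finally show "cmod (fock_ip n (T (win s f)) (win s h)) \<le> B * (fnorm n (win s f) * fnorm n (win s h))"
        by (simp add: mult.assoc)
    qed
    also have "\<dots> = B * (\<Sum>s<K + j. \<bar>fnorm n (win s f)\<bar> * \<bar>fnorm n (win s h)\<bar>)"
      using win f h by (simp add: sum_distrib_left)
    also have "\<dots> \<le> B * (L2_set (\<lambda>s. fnorm n (win s f)) {..<K + j} * L2_set (\<lambda>s. fnorm n (win s h)) {..<K + j})"
      by (intro mult_left_mono L2_set_mult_ineq B0)
    also have "\<dots> = j * (B * fnorm n (trunc K f) * fnorm n (trunc K h))"
      using f h by (simp add: L2_set_def win_sq real_sqrt_mult)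
    finally have "(fnorm n (trunc K h))\<^sup>2 \<le> B * fnorm n (trunc K f) * fnorm n (trunc K h)" using j by simp
    then have "fnorm n (trunc K h) * fnorm n (trunc K h) \<le> B * fnorm n (trunc K f) * fnorm n (trunc K h)"
      by (simp add: power2_eq_square)
    moreover have "fnorm n (trunc K h) \<ge> 0" "fnorm n (trunc K f) \<ge> 0" using h f by simp_all
    ultimately have "fnorm n (trunc K h) \<le> B * fnorm n (trunc K f)"
      using B0 by (cases "fnorm n (trunc K h) = 0") (auto simp: mult_le_cancel_right)
    also have "\<dots> \<le> B * fnorm n f" by (intro mult_left_mono fnorm_trunc_le f B0)
    finally show ?thesis .
  qed
  then have "fnorm n h \<le> B * fnorm n f" by (rule fnorm_le_if_trunc_le[OF h])
  then show ?thesis by (simp add: h_def a_def)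
qed

text \<open>The coefficients converge and \<open>cesaro_bound\<close> keeps the means bounded, so
  \<open>fock_weak_limit\<close> applies. The index is shifted by one because the bound is for
  \<open>j > 0\<close>.\<close>

lemma cesaro_weak_tendsto:
  assumes T: "T \<in> conv_ops n" and f: "f \<in> fock n" and g: "g \<in> fock n"
  shows "(\<lambda>j. fock_ip n (poly_op (wd n j) (cesaro j (T (ev []))) f) g) \<longlonglongrightarrow> fock_ip n (T f) g"
proof -
  obtain B where B: "\<And>f. f \<in> fock n \<Longrightarrow> fnorm n (T f) \<le> B * fnorm n f"
    using T unfolding conv_ops_def bounded_op_def by blast
  have "(\<lambda>j. fock_ip n (poly_op (wd n (Suc j)) (cesaro (Suc j) (T (ev []))) f) g) \<longlonglongrightarrow> fock_ip n (T f) g"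
  proof (rule fock_weak_limit)
    show "fnorm n (poly_op (wd n (Suc j)) (cesaro (Suc j) (T (ev []))) f) \<le> B * fnorm n f" for j
      by (rule cesaro_bound[OF T B f]) auto
    show "(\<lambda>j. poly_op (wd n (Suc j)) (cesaro (Suc j) (T (ev []))) f w) \<longlonglongrightarrow> T f w" if w: "w \<in> words n" for w
    proof -
      have "(\<lambda>j. conv (cesaro j (T (ev []))) f w) \<longlonglongrightarrow> conv (T (ev [])) f w"
        unfolding conv_def by (intro tendsto_intros cesaro_tendsto)
      then show ?thesis
        using T f w LIMSEQ_Suc by (fastforce simp: poly_op_cesaro[OF w] conv_ops_def)
    qed
  qed (use f g T in \<open>auto intro: poly_op_fock[OF wd_words] conv_ops_fock\<close>)
  then show ?thesis by (rule LIMSEQ_imp_Suc)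
qed

subsection \<open>Square-summable sequences of vectors\<close>

definition sq_summable :: "'a::cvec set \<Rightarrow> ('a \<Rightarrow> 'a \<Rightarrow> complex) \<Rightarrow> (nat \<Rightarrow> 'a) \<Rightarrow> bool" where
  "sq_summable M ip x \<longleftrightarrow> (\<forall>k. x k \<in> M) \<and> summable (\<lambda>k. (cnorm ip (x k))\<^sup>2)"

lemma sq_summable_mem: "sq_summable M ip x \<Longrightarrow> x k \<in> M"
  by (simp add: sq_summable_def)

context ip_space begin

lemma sq_summable_bounded:
  assumes x: "sq_summable M ip x" and x': "\<And>k. x' k \<in> M" "\<And>k. nm (x' k) \<le> B * nm (x k)"
  shows "sq_summable M ip x'"
proof -
  have "summable (\<lambda>k. B\<^sup>2 * (nm (x k))\<^sup>2)" using x by (auto simp: sq_summable_def intro: summable_mult)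
  then have "summable (\<lambda>k. (nm (x' k))\<^sup>2)"
  proof (rule summable_comparison_test_ev[rotated], intro always_eventually allI)
    fix k show "norm ((nm (x' k))\<^sup>2) \<le> B\<^sup>2 * (nm (x k))\<^sup>2"
      using power_mono[OF x'(2)[of k], of 2] x'(1) by (simp add: power_mult_distrib)
  qed
  then show ?thesis using x' by (simp add: sq_summable_def)
qed

text \<open>The arithmetic mean of the squares replaces the product of norms, so that two summable
  square sequences give a summable majorant at once.\<close>

lemma ip_le_sum_sq:
  assumes x: "x \<in> M" "x' \<in> M" "nm x' \<le> B * nm x" and y: "y \<in> M" and B: "B \<ge> 0"
  shows "cmod (ip x' y) \<le> B * (((nm x)\<^sup>2 + (nm y)\<^sup>2) / 2)"
proof -
  have "cmod (ip x' y) \<le> nm x' * nm y" by (rule cauchy_schwarz[OF x(2) y])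
  also have "\<dots> \<le> (B * nm x) * nm y" using x y by (intro mult_right_mono) auto
  also have "\<dots> = B * (nm x * nm y)" by simp
  also have "nm x * nm y \<le> ((nm x)\<^sup>2 + (nm y)\<^sup>2) / 2"
    using zero_le_power2[of "nm x - nm y"] unfolding power2_diff by argo
  finally show ?thesis using B by (simp add: mult_left_mono)
qed

lemma sq_summable_ip:
  assumes x: "sq_summable M ip x" and y: "sq_summable M ip y"
    and x': "\<And>k. x' k \<in> M" "\<And>k. nm (x' k) \<le> B * nm (x k)" and B: "B \<ge> 0"
  shows "summable (\<lambda>k. norm (ip (x' k) (y k)))"
    "norm (\<Sum>k. ip (x' k) (y k)) \<le> B * (((\<Sum>k. (nm (x k))\<^sup>2) + (\<Sum>k. (nm (y k))\<^sup>2)) / 2)"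
    "summable (\<lambda>k. B * (((nm (x k))\<^sup>2 + (nm (y k))\<^sup>2) / 2))"
proof -
  have s: "summable (\<lambda>k. (nm (x k))\<^sup>2)" "summable (\<lambda>k. (nm (y k))\<^sup>2)"
    using x y by (auto simp: sq_summable_def)
  then show sb: "summable (\<lambda>k. B * (((nm (x k))\<^sup>2 + (nm (y k))\<^sup>2) / 2))"
    by (intro summable_mult summable_divide summable_add)
  have le: "norm (ip (x' k) (y k)) \<le> B * (((nm (x k))\<^sup>2 + (nm (y k))\<^sup>2) / 2)" for k
    by (rule ip_le_sum_sq[OF _ x' _ B]) (use x y in \<open>auto simp: sq_summable_def\<close>)
  then show sn: "summable (\<lambda>k. norm (ip (x' k) (y k)))"
    by (intro summable_comparison_test_ev[OF _ sb] always_eventually) auto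
  have "norm (\<Sum>k. ip (x' k) (y k)) \<le> (\<Sum>k. norm (ip (x' k) (y k)))" by (rule summable_norm[OF sn])
  also have "\<dots> \<le> (\<Sum>k. B * (((nm (x k))\<^sup>2 + (nm (y k))\<^sup>2) / 2))" by (rule suminf_le[OF le sn sb])
  also have "\<dots> = B * (((\<Sum>k. (nm (x k))\<^sup>2) + (\<Sum>k. (nm (y k))\<^sup>2)) / 2)"
    using s by (simp add: suminf_mult suminf_divide suminf_add summable_add summable_divide)
  finally show "norm (\<Sum>k. ip (x' k) (y k)) \<le> B * (((\<Sum>k. (nm (x k))\<^sup>2) + (\<Sum>k. (nm (y k))\<^sup>2)) / 2)" .
qed

end

section \<open>Double series along the Cantor pairing\<close>

lemma summable_prod_decode_nonneg:
  fixes a :: "nat \<Rightarrow> nat \<Rightarrow> real"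
  assumes "\<And>k i. a k i \<ge> 0" "\<And>k. summable (a k)" "\<And>k. suminf (a k) \<le> b k" "summable b"
  shows "summable (\<lambda>m. case prod_decode m of (k, i) \<Rightarrow> a k i)"
    "(\<Sum>m. case prod_decode m of (k, i) \<Rightarrow> a k i) \<le> suminf b"
proof -
  have le: "(\<Sum>m<M. case prod_decode m of (k, i) \<Rightarrow> a k i) \<le> suminf b" for M
  proof -
    have "(\<Sum>m<M. case prod_decode m of (k, i) \<Rightarrow> a k i) = (\<Sum>(k, i)\<in>prod_decode ` {..<M}. a k i)"
      by (subst sum.reindex) (auto intro: inj_on_subset[OF inj_prod_decode])
    \<comment> \<open>Both components of a pair are at most its code, so the first \<open>M\<close>
      pairs lie in a square of side \<open>M\<close>.\<close>
    also have "\<dots> \<le> (\<Sum>(k, i)\<in>{..<M} \<times> {..<M}. a k i)"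
    proof (rule sum_mono2)
      show "prod_decode ` {..<M} \<subseteq> {..<M} \<times> {..<M}"
      proof
        fix z assume "z \<in> prod_decode ` {..<M}"
        then obtain k i where z: "z = (k, i)" "prod_encode (k, i) < M" by (cases z) auto
        then show "z \<in> {..<M} \<times> {..<M}" using le_prod_encode_1[of k i] le_prod_encode_2[of i k] by auto
      qed
    qed (use assms in auto)
    also have "\<dots> = (\<Sum>k<M. \<Sum>i<M. a k i)" by (simp add: sum.cartesian_product)
    also have "\<dots> \<le> (\<Sum>k<M. b k)"
    proof (rule sum_mono)
      fix k show "(\<Sum>i<M. a k i) \<le> b k"
        using sum_le_suminf[OF assms(2), of "{..<M}" k] assms(1,3)[of k] by (metis finite_lessThan order_trans)
    qed
    also have "\<dots> \<le> suminf b"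
    proof (rule sum_le_suminf[OF assms(4)])
      show "0 \<le> b k" for k using suminf_nonneg[OF assms(2,1), of k] assms(3)[of k] by linarith
    qed auto
    finally show ?thesis .
  qed
  show "summable (\<lambda>m. case prod_decode m of (k, i) \<Rightarrow> a k i)"
    by (rule summableI_nonneg_bounded[OF _ le]) (auto simp: assms(1) split: prod.split)
  then show "(\<Sum>m. case prod_decode m of (k, i) \<Rightarrow> a k i) \<le> suminf b"
    by (rule suminf_le_const[OF _ le])
qed

lemma suminf_eq_infsum:
  fixes f :: "nat \<Rightarrow> 'a::{topological_comm_monoid_add, t2_space}"
  shows "f summable_on UNIV \<Longrightarrow> suminf f = infsum f UNIV"
  using has_sum_imp_sums[OF has_sum_infsum] sums_unique by metis

lemma suminf_prod_decode:
  fixes c :: "nat \<Rightarrow> nat \<Rightarrow> 'a::banach"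
  assumes "summable (\<lambda>m. norm (case prod_decode m of (k, i) \<Rightarrow> c k i))"
  shows "(\<Sum>m. case prod_decode m of (k, i) \<Rightarrow> c k i) = (\<Sum>k. \<Sum>i. c k i)"
proof -
  let ?h = "\<lambda>m. case prod_decode m of (k, i) \<Rightarrow> c k i"
  have h: "?h summable_on UNIV" by (rule norm_summable_imp_summable_on[OF assms])
  then have s: "(\<lambda>(k, i). c k i) summable_on (UNIV \<times> UNIV)"
    using summable_on_reindex_bij_betw[OF bij_prod_decode, of "\<lambda>(k, i). c k i"] by simp
  have "suminf ?h = infsum (\<lambda>(k, i). c k i) (UNIV \<times> UNIV)"
    using infsum_reindex_bij_betw[OF bij_prod_decode, of "\<lambda>(k, i). c k i"] by (simp add: suminf_eq_infsum[OF h])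
  also have "\<dots> = (\<Sum>\<^sub>\<infinity>k. \<Sum>\<^sub>\<infinity>i. c k i)" by (rule infsum_Sigma'_banach[OF s, symmetric])
  also have "\<dots> = (\<Sum>k. \<Sum>\<^sub>\<infinity>i. c k i)"
    by (rule suminf_eq_infsum[symmetric]) (rule summable_on_Sigma_banach[OF s])
  also have "\<dots> = (\<Sum>k. \<Sum>i. c k i)"
  proof -
    have "c k summable_on UNIV" for k
    proof -
      have "(\<lambda>(k, i). c k i) summable_on Pair k ` UNIV" by (rule summable_on_subset_banach[OF s]) auto
      then show ?thesis by (subst (asm) summable_on_reindex) (auto simp: o_def inj_on_def)
    qed
    then show ?thesis by (simp add: suminf_eq_infsum)
  qed
  finally show ?thesis .
qed

subsection \<open>Normal functionals\<close>

definition normal_rep :: "nat \<Rightarrow> (nat list \<Rightarrow> complex) \<Rightarrow> (nat \<Rightarrow> nat list \<Rightarrow> complex) \<Rightarrow> (nat \<Rightarrow> nat list \<Rightarrow> complex) \<Rightarrow> bool" where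
  "normal_rep n \<phi> \<xi> \<eta> \<longleftrightarrow> sq_summable (fock n) (fock_ip n) \<xi> \<and> sq_summable (fock n) (fock_ip n) \<eta> \<and>
     (\<forall>w\<in>words n. \<phi> w = (\<Sum>k. fock_ip n (word_op shift_op w (\<xi> k)) (\<eta> k)))"

text \<open>Scaling \<open>\<xi>\<close> up and \<open>\<eta>\<close> down leaves the functional
  unchanged, so one bound for both square sums costs no more than a bound for the product of their
  roots. The infimum of all \<open>b\<close> is therefore the quotient of the trace norm.\<close>

definition normal_bd :: "nat \<Rightarrow> (nat list \<Rightarrow> complex) \<Rightarrow> real \<Rightarrow> bool" where
  "normal_bd n \<phi> b \<longleftrightarrow> (\<exists>\<xi> \<eta>. normal_rep n \<phi> \<xi> \<eta> \<and>
     (\<Sum>k. (fnorm n (\<xi> k))\<^sup>2) \<le> b \<and> (\<Sum>k. (fnorm n (\<eta> k))\<^sup>2) \<le> b)"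

text \<open>A function \<open>\<phi>\<close> on words stands for the linear functional \<open>L\<^sub>w \<mapsto> \<phi> w\<close> on polynomials in \<open>L\<close>;
  \<open>normal\<close> says that it is weak-* continuous, and \<open>poly_bd\<close> bounds its norm.\<close>
definition normal :: "nat \<Rightarrow> (nat list \<Rightarrow> complex) \<Rightarrow> bool" where
  "normal n \<phi> \<longleftrightarrow> (\<exists>\<xi> \<eta>. normal_rep n \<phi> \<xi> \<eta>)"

definition poly_bd :: "nat \<Rightarrow> (nat list \<Rightarrow> complex) \<Rightarrow> real \<Rightarrow> bool" where
  "poly_bd n \<phi> b \<longleftrightarrow> (\<forall>W c B. finite W \<longrightarrow> W \<subseteq> words n \<longrightarrow>
     (\<forall>f\<in>fock n. fnorm n (poly_op W c f) \<le> B * fnorm n f) \<longrightarrow> cmod (\<Sum>w\<in>W. c w * \<phi> w) \<le> b * B)"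

lemma normal_iff_bd: "normal n \<phi> \<longleftrightarrow> (\<exists>b. normal_bd n \<phi> b)"
proof
  assume "normal n \<phi>"
  then obtain \<xi> \<eta> where "normal_rep n \<phi> \<xi> \<eta>" by (auto simp: normal_def)
  then have "normal_bd n \<phi> (max (\<Sum>k. (fnorm n (\<xi> k))\<^sup>2) (\<Sum>k. (fnorm n (\<eta> k))\<^sup>2))"
    unfolding normal_bd_def by (intro exI[of _ \<xi>] exI[of _ \<eta>]) auto
  then show "\<exists>b. normal_bd n \<phi> b" by blast
qed (auto simp: normal_def normal_bd_def)

lemma normal_bd_mono: "normal_bd n \<phi> b \<Longrightarrow> b \<le> b' \<Longrightarrow> normal_bd n \<phi> b'"
  unfolding normal_bd_def using order_trans by blast

lemma normal_rep_cong: "normal_rep n \<phi> \<xi> \<eta> \<Longrightarrow> (\<And>w. w \<in> words n \<Longrightarrow> \<psi> w = \<phi> w) \<Longrightarrow> normal_rep n \<psi> \<xi> \<eta>"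
  by (simp add: normal_rep_def)

lemma normal_bd_cong: "normal_bd n \<phi> b \<Longrightarrow> (\<And>w. w \<in> words n \<Longrightarrow> \<psi> w = \<phi> w) \<Longrightarrow> normal_bd n \<psi> b"
  unfolding normal_bd_def using normal_rep_cong by blast

lemma normal_cong: "normal n \<phi> \<Longrightarrow> (\<And>w. w \<in> words n \<Longrightarrow> \<psi> w = \<phi> w) \<Longrightarrow> normal n \<psi>"
  unfolding normal_def using normal_rep_cong by blast

lemma normal_bd_nonneg: "normal_bd n \<phi> b \<Longrightarrow> b \<ge> 0"
  unfolding normal_bd_def normal_rep_def sq_summable_def
  by (meson order_trans suminf_nonneg zero_le_power2)

lemma normal_rep_summable:
  assumes "normal_rep n \<phi> \<xi> \<eta>" "w \<in> words n"
  shows "summable (\<lambda>k. norm (fock_ip n (word_op shift_op w (\<xi> k)) (\<eta> k)))"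
    and "norm (\<phi> w) \<le> ((\<Sum>k. (fnorm n (\<xi> k))\<^sup>2) + (\<Sum>k. (fnorm n (\<eta> k))\<^sup>2)) / 2"
proof -
  have *: "sq_summable (fock n) (fock_ip n) \<xi>" "sq_summable (fock n) (fock_ip n) \<eta>"
    and \<phi>: "\<phi> w = (\<Sum>k. fock_ip n (word_op shift_op w (\<xi> k)) (\<eta> k))"
    using assms by (auto simp: normal_rep_def)
  note m = sq_summable_mem[OF *(1)]
  show "summable (\<lambda>k. norm (fock_ip n (word_op shift_op w (\<xi> k)) (\<eta> k)))"
    by (rule fock.sq_summable_ip(1)[OF *, of _ 1]) (use assms(2) m in \<open>auto simp: word_op_shift_fock\<close>)
  have "norm (\<Sum>k. fock_ip n (word_op shift_op w (\<xi> k)) (\<eta> k)) \<le> 1 * (((\<Sum>k. (fnorm n (\<xi> k))\<^sup>2) + (\<Sum>k. (fnorm n (\<eta> k))\<^sup>2)) / 2)"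
    by (rule fock.sq_summable_ip(2)[OF *, of _ 1]) (use assms(2) m in \<open>auto simp: word_op_shift_fock\<close>)
  then show "norm (\<phi> w) \<le> ((\<Sum>k. (fnorm n (\<xi> k))\<^sup>2) + (\<Sum>k. (fnorm n (\<eta> k))\<^sup>2)) / 2" by (simp add: \<phi>)
qed

text \<open>The countably many representations are interleaved along \<open>prod_decode\<close> into
  a single one, whose square sums are at most the sum of the given bounds. This is completeness of
  the predual for its own gauge.\<close>

lemma normal_bd_suminf:
  assumes \<phi>: "\<And>k. normal_bd n (\<phi> k) (b k)" and b: "summable b"
  shows "normal_bd n (\<lambda>w. \<Sum>k. \<phi> k w) (suminf b)"
    and "w \<in> words n \<Longrightarrow> summable (\<lambda>k. norm (\<phi> k w))"
proof -
  obtain \<xi> \<eta> where rep: "\<And>k. normal_rep n (\<phi> k) (\<xi> k) (\<eta> k)"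
    and bd: "\<And>k. (\<Sum>i. (fnorm n (\<xi> k i))\<^sup>2) \<le> b k" "\<And>k. (\<Sum>i. (fnorm n (\<eta> k i))\<^sup>2) \<le> b k"
    using \<phi> unfolding normal_bd_def by metis
  have sq: "sq_summable (fock n) (fock_ip n) (\<xi> k)" "sq_summable (fock n) (fock_ip n) (\<eta> k)" for k
    using rep[of k] by (auto simp: normal_rep_def)
  define X where "X = (\<lambda>m. case prod_decode m of (k, i) \<Rightarrow> \<xi> k i)"
  define Y where "Y = (\<lambda>m. case prod_decode m of (k, i) \<Rightarrow> \<eta> k i)"
  have eqX: "(fnorm n (X m))\<^sup>2 = (case prod_decode m of (k, i) \<Rightarrow> (fnorm n (\<xi> k i))\<^sup>2)" for m
    by (simp add: X_def split: prod.split)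
  have memX: "X m \<in> fock n" for m using sq(1) by (auto simp: X_def sq_summable_def split: prod.split)
  have X: "sq_summable (fock n) (fock_ip n) X" "(\<Sum>m. (fnorm n (X m))\<^sup>2) \<le> suminf b"
    using summable_prod_decode_nonneg[of "\<lambda>k i. (fnorm n (\<xi> k i))\<^sup>2", OF _ _ bd(1) b] sq(1)
    by (simp_all add: sq_summable_def eqX memX)
  have eqY: "(fnorm n (Y m))\<^sup>2 = (case prod_decode m of (k, i) \<Rightarrow> (fnorm n (\<eta> k i))\<^sup>2)" for m
    by (simp add: Y_def split: prod.split)
  have memY: "Y m \<in> fock n" for m using sq(2) by (auto simp: Y_def sq_summable_def split: prod.split)
  have Y: "sq_summable (fock n) (fock_ip n) Y" "(\<Sum>m. (fnorm n (Y m))\<^sup>2) \<le> suminf b"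
    using summable_prod_decode_nonneg[of "\<lambda>k i. (fnorm n (\<eta> k i))\<^sup>2", OF _ _ bd(2) b] sq(2)
    by (simp_all add: sq_summable_def eqY memY)
  have "(\<Sum>k. \<phi> k w) = (\<Sum>m. fock_ip n (word_op shift_op w (X m)) (Y m))" if w: "w \<in> words n" for w
  proof -
    let ?c = "\<lambda>k i. fock_ip n (word_op shift_op w (\<xi> k i)) (\<eta> k i)"
    have eq: "fock_ip n (word_op shift_op w (X m)) (Y m) = (case prod_decode m of (k, i) \<Rightarrow> ?c k i)" for m
      by (simp add: X_def Y_def split: prod.split)
    have "summable (\<lambda>m. norm (fock_ip n (word_op shift_op w (X m)) (Y m)))"
      by (rule fock.sq_summable_ip(1)[OF X(1) Y(1), of _ 1])
        (use w sq_summable_mem[OF X(1)] in \<open>auto simp: word_op_shift_fock\<close>)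
    then have "(\<Sum>m. fock_ip n (word_op shift_op w (X m)) (Y m)) = (\<Sum>k. \<Sum>i. ?c k i)"
      unfolding eq by (rule suminf_prod_decode)
    then show ?thesis using rep w by (simp add: normal_rep_def)
  qed
  then have "normal_rep n (\<lambda>w. \<Sum>k. \<phi> k w) X Y" using X(1) Y(1) by (simp add: normal_rep_def)
  then show "normal_bd n (\<lambda>w. \<Sum>k. \<phi> k w) (suminf b)" using X(2) Y(2) unfolding normal_bd_def by blast
  assume w: "w \<in> words n"
  have le: "norm (\<phi> k w) \<le> b k" for k using normal_rep_summable(2)[OF rep w, of k] bd[of k] by argo
  show "summable (\<lambda>k. norm (\<phi> k w))"
    by (rule summable_comparison_test_ev[OF _ b]) (use le in \<open>auto intro: always_eventually\<close>)
qed

lemma normal_bd_zero: "normal_bd n (\<lambda>w. 0) 0"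
  unfolding normal_bd_def normal_rep_def sq_summable_def
proof (intro exI[of _ "\<lambda>k. 0"] conjI ballI)
  fix w assume "w \<in> words n"
  then have "fock_ip n (word_op shift_op w 0) 0 = 0" by (intro fock.ip_zero_right word_op_shift_fock) auto
  then show "0 = (\<Sum>k. fock_ip n (word_op shift_op w ((\<lambda>k. 0) k)) ((\<lambda>k. 0) k))" by simp
qed auto

lemma normal_bd_add:
  assumes "normal_bd n \<phi> b" "normal_bd n \<psi> c" shows "normal_bd n (\<phi> + \<psi>) (b + c)"
proof -
  \<comment> \<open>A series with two nonzero terms, so that the interleaving argument covers finite
    sums as well.\<close>
  define f where "f = (\<lambda>k::nat. if k = 0 then \<phi> else if k = 1 then \<psi> else (\<lambda>w. 0))"
  define d where "d = (\<lambda>k::nat. if k = 0 then b else if k = 1 then c else 0)"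
  have sf: "(\<lambda>k. f k w) sums (\<phi> w + \<psi> w)" for w
    using sums_finite[of "{0,1}" "\<lambda>k. f k w"] by (simp add: f_def)
  have sd: "d sums (b + c)"
    using sums_finite[of "{0,1}" d] by (simp add: d_def)
  have "normal_bd n (\<lambda>w. \<Sum>k. f k w) (suminf d)"
    by (rule normal_bd_suminf(1)) (use assms normal_bd_zero sd in \<open>auto simp: f_def d_def sums_iff\<close>)
  then show ?thesis using sd sf by (auto simp: sums_iff plus_fun_def)
qed

lemma normal_rep_compose:
  assumes rep: "normal_rep n \<phi> \<xi> \<eta>"
    and A: "\<And>f. f \<in> fock n \<Longrightarrow> A f \<in> fock n" "\<And>f. f \<in> fock n \<Longrightarrow> fnorm n (A f) \<le> a * fnorm n f"
    and B: "\<And>f. f \<in> fock n \<Longrightarrow> B f \<in> fock n" "\<And>f. f \<in> fock n \<Longrightarrow> fnorm n (B f) \<le> b * fnorm n f"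
  shows "normal_rep n (\<lambda>w. \<Sum>k. fock_ip n (word_op shift_op w (A (\<xi> k))) (B (\<eta> k))) (\<lambda>k. A (\<xi> k)) (\<lambda>k. B (\<eta> k))"
proof -
  have sq: "sq_summable (fock n) (fock_ip n) \<xi>" "sq_summable (fock n) (fock_ip n) \<eta>"
    using rep by (auto simp: normal_rep_def)
  note mem = sq_summable_mem[OF sq(1)] sq_summable_mem[OF sq(2)]
  have "sq_summable (fock n) (fock_ip n) (\<lambda>k. A (\<xi> k))"
    by (rule fock.sq_summable_bounded[OF sq(1) A(1)[OF mem(1)] A(2)[OF mem(1)]])
  moreover have "sq_summable (fock n) (fock_ip n) (\<lambda>k. B (\<eta> k))"
    by (rule fock.sq_summable_bounded[OF sq(2) B(1)[OF mem(2)] B(2)[OF mem(2)]])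
  ultimately show ?thesis by (simp add: normal_rep_def)
qed

lemma word_op_shift_scale: "word_op shift_op w (c *\<^sub>C f) = c *\<^sub>C word_op shift_op w f"
  by (auto simp: word_op_shift fun_eq_iff)

lemma word_op_shift_add: "word_op shift_op w (f + g) = word_op shift_op w f + word_op shift_op w g"
  by (auto simp: word_op_shift fun_eq_iff)

lemma normal_bd_scale:
  assumes "normal_bd n \<phi> b" shows "normal_bd n (c *\<^sub>C \<phi>) (cmod c * b)"
proof (cases "c = 0")
  case True
  then show ?thesis using normal_bd_zero by (simp add: zero_fun_def)
next
  case False
  \<comment> \<open>The scalar is split as \<open>(c / s) * s\<close> with both factors of modulus
    \<open>sqrt (cmod c)\<close>, so each of the two square sums is multiplied by
    \<open>cmod c\<close>.\<close>
  define s where "s = complex_of_real (sqrt (cmod c))"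
  have s: "s \<noteq> 0" "cnj s = s" "(cmod s)\<^sup>2 = cmod c" "s * s = of_real (cmod c)"
    using False by (auto simp: s_def of_real_mult[symmetric] simp del: of_real_mult)
  have cs: "(cmod (c / s))\<^sup>2 = cmod c"
    using False s(3) by (simp add: norm_divide power_divide) (simp add: power2_eq_square)
  obtain \<xi> \<eta> where rep: "normal_rep n \<phi> \<xi> \<eta>" and bd: "(\<Sum>k. (fnorm n (\<xi> k))\<^sup>2) \<le> b" "(\<Sum>k. (fnorm n (\<eta> k))\<^sup>2) \<le> b"
    using assms unfolding normal_bd_def by blast
  note sq = rep[unfolded normal_rep_def, THEN conjunct1] rep[unfolded normal_rep_def, THEN conjunct2, THEN conjunct1]
  note mem = sq_summable_mem[OF sq(1)] sq_summable_mem[OF sq(2)]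
  have "normal_rep n (\<lambda>w. \<Sum>k. fock_ip n (word_op shift_op w ((c / s) *\<^sub>C \<xi> k)) (s *\<^sub>C \<eta> k)) (\<lambda>k. (c / s) *\<^sub>C \<xi> k) (\<lambda>k. s *\<^sub>C \<eta> k)"
    by (rule normal_rep_compose[OF rep, where A = "\<lambda>f. (c / s) *\<^sub>C f" and a = "cmod (c / s)"
          and B = "\<lambda>f. s *\<^sub>C f" and b = "cmod s"]) (simp_all add: fock.nm_scale)
  then have "normal_rep n (c *\<^sub>C \<phi>) (\<lambda>k. (c / s) *\<^sub>C \<xi> k) (\<lambda>k. s *\<^sub>C \<eta> k)"
  proof (rule normal_rep_cong)
    fix w assume w: "w \<in> words n"
    have "(c *\<^sub>C \<phi>) w = c * (\<Sum>k. fock_ip n (word_op shift_op w (\<xi> k)) (\<eta> k))"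
      using rep w by (simp add: normal_rep_def)
    also have "\<dots> = (\<Sum>k. c * fock_ip n (word_op shift_op w (\<xi> k)) (\<eta> k))"
      by (rule suminf_mult[symmetric, OF summable_norm_cancel[OF normal_rep_summable(1)[OF rep w]]])
    finally show "(c *\<^sub>C \<phi>) w = (\<Sum>k. fock_ip n (word_op shift_op w ((c / s) *\<^sub>C \<xi> k)) (s *\<^sub>C \<eta> k))"
      using s(1,2) w mem by (simp add: word_op_shift_scale fock.ip_scale_left fock.ip_scale_right word_op_shift_fock)
  qed
  moreover have "(\<Sum>k. (fnorm n ((c / s) *\<^sub>C \<xi> k))\<^sup>2) \<le> cmod c * b"
    using mem bd sq cs by (simp add: fock.nm_scale power_mult_distrib suminf_mult sq_summable_def mult_left_mono)
  moreover have "(\<Sum>k. (fnorm n (s *\<^sub>C \<eta> k))\<^sup>2) \<le> cmod c * b"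
    using mem bd sq s by (simp add: fock.nm_scale power_mult_distrib suminf_mult sq_summable_def mult_left_mono)
  ultimately show ?thesis unfolding normal_bd_def by blast
qed

lemma normal_add: "normal n \<phi> \<Longrightarrow> normal n \<psi> \<Longrightarrow> normal n (\<phi> + \<psi>)"
  unfolding normal_iff_bd using normal_bd_add by blast

lemma normal_scale: "normal n \<phi> \<Longrightarrow> normal n (c *\<^sub>C \<phi>)"
  unfolding normal_iff_bd using normal_bd_scale by blast

lemma normal_poly_eval:
  assumes rep: "normal_rep n \<phi> \<xi> \<eta>" and W: "finite W" "W \<subseteq> words n"
  shows "(\<Sum>w\<in>W. c w * \<phi> w) = (\<Sum>k. fock_ip n (poly_op W c (\<xi> k)) (\<eta> k))"
proof -
  have mem: "\<xi> k \<in> fock n" "\<eta> k \<in> fock n" for k using rep by (auto simp: normal_rep_def sq_summable_def)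
  have s: "summable (\<lambda>k. fock_ip n (word_op shift_op w (\<xi> k)) (\<eta> k))" if "w \<in> W" for w
    using summable_norm_cancel[OF normal_rep_summable(1)[OF rep]] that W by blast
  have "(\<Sum>w\<in>W. c w * \<phi> w) = (\<Sum>w\<in>W. \<Sum>k. c w * fock_ip n (word_op shift_op w (\<xi> k)) (\<eta> k))"
    using rep W s by (intro sum.cong) (auto simp: normal_rep_def suminf_mult)
  also have "\<dots> = (\<Sum>k. \<Sum>w\<in>W. c w * fock_ip n (word_op shift_op w (\<xi> k)) (\<eta> k))"
    by (rule suminf_sum[symmetric]) (intro summable_mult s)
  also have "\<dots> = (\<Sum>k. fock_ip n (poly_op W c (\<xi> k)) (\<eta> k))"
    unfolding poly_op_def using W mem
    by (intro suminf_cong, subst fock.ip_sum_left) (auto simp: word_op_shift_fock fock.ip_scale_left subset_iff)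
  finally show ?thesis .
qed

text \<open>The value of a representation at \<open>T\<close> is a limit of numbers depending on
  \<open>\<phi>\<close> and \<open>T\<close> alone, hence it is the same for all representations of
  \<open>\<phi>\<close>. The limit passes through the sum over \<open>k\<close> by domination,
  uniform in \<open>j\<close> thanks to \<open>cesaro_bound\<close>.\<close>

lemma normal_cesaro_tendsto:
  assumes rep: "normal_rep n \<phi> \<xi> \<eta>" and T: "T \<in> conv_ops n"
  shows "(\<lambda>j. \<Sum>w\<in>wd n j. cesaro j (T (ev [])) w * \<phi> w) \<longlonglongrightarrow> (\<Sum>k. fock_ip n (T (\<xi> k)) (\<eta> k))"
proof -
  obtain B0 where B0: "\<And>f. f \<in> fock n \<Longrightarrow> fnorm n (T f) \<le> B0 * fnorm n f"
    using T unfolding conv_ops_def bounded_op_def by blast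
  have B: "fnorm n (T f) \<le> \<bar>B0\<bar> * fnorm n f" if "f \<in> fock n" for f
    using B0[OF that] mult_right_mono[OF abs_ge_self, of "fnorm n f" B0] that by simp
  have sq: "sq_summable (fock n) (fock_ip n) \<xi>" "sq_summable (fock n) (fock_ip n) \<eta>"
    using rep by (auto simp: normal_rep_def)
  note mem = sq_summable_mem[OF sq(1)] sq_summable_mem[OF sq(2)]
  let ?p = "\<lambda>j. poly_op (wd n (Suc j)) (cesaro (Suc j) (T (ev [])))"
  have "(\<lambda>j. \<Sum>k. fock_ip n (?p j (\<xi> k)) (\<eta> k)) \<longlonglongrightarrow> (\<Sum>k. fock_ip n (T (\<xi> k)) (\<eta> k))"
  proof (rule tannerys_theorem[THEN conjunct2, THEN conjunct2])
    show "summable (\<lambda>k. \<bar>B0\<bar> * (((fnorm n (\<xi> k))\<^sup>2 + (fnorm n (\<eta> k))\<^sup>2) / 2))"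
      by (rule fock.sq_summable_ip(3)[OF sq, of "\<lambda>k. T (\<xi> k)"]) (use B mem T in \<open>auto intro: conv_ops_fock\<close>)
    show "(\<lambda>j. fock_ip n (?p j (\<xi> k)) (\<eta> k)) \<longlonglongrightarrow> fock_ip n (T (\<xi> k)) (\<eta> k)" for k
      by (rule LIMSEQ_Suc[OF cesaro_weak_tendsto[OF T mem(1,2)]])
    have "norm (fock_ip n (?p j (\<xi> k)) (\<eta> k)) \<le> \<bar>B0\<bar> * (((fnorm n (\<xi> k))\<^sup>2 + (fnorm n (\<eta> k))\<^sup>2) / 2)" for j k
      by (rule fock.ip_le_sum_sq) (use mem in \<open>auto intro: poly_op_fock[OF wd_words] cesaro_bound[OF T B]\<close>)
    then show "\<forall>\<^sub>F (k, j) in sequentially \<times>\<^sub>F sequentially. norm (fock_ip n (?p j (\<xi> k)) (\<eta> k))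
        \<le> \<bar>B0\<bar> * (((fnorm n (\<xi> k))\<^sup>2 + (fnorm n (\<eta> k))\<^sup>2) / 2)"
      by (intro always_eventually) auto
  qed auto
  then have "(\<lambda>j. \<Sum>w\<in>wd n (Suc j). cesaro (Suc j) (T (ev [])) w * \<phi> w) \<longlonglongrightarrow> (\<Sum>k. fock_ip n (T (\<xi> k)) (\<eta> k))"
    by (simp add: normal_poly_eval[OF rep finite_wd wd_words])
  then show ?thesis by (rule LIMSEQ_imp_Suc)
qed

lemma word_op_shift_ev_Nil: "word_op shift_op u (ev []) w = (if w = u then 1 else 0)"
proof (cases "take (length u) w = u")
  case True
  then have "w = u \<longleftrightarrow> drop (length u) w = []" using append_take_drop_id[of "length u" w] by auto
  then show ?thesis using True by (simp add: word_op_shift ev_def)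
qed (auto simp: word_op_shift)

section \<open>The predual: rank-one functionals and completeness\<close>

definition coefn :: "nat \<Rightarrow> (nat list \<Rightarrow> complex) \<Rightarrow> (nat list \<Rightarrow> complex) \<Rightarrow> nat list \<Rightarrow> complex" where
  "coefn n f g = (\<lambda>u. fock_ip n (word_op shift_op u f) g)"

lemma suminf_at_0: "(\<And>k. k > 0 \<Longrightarrow> f k = 0) \<Longrightarrow> suminf f = (f 0 :: 'a::{t2_space,comm_monoid_add})"
  "(\<And>k. k > 0 \<Longrightarrow> f k = 0) \<Longrightarrow> summable f"
  using suminf_finite[of "{0}" f] summable_finite[of "{0}" f] by auto

lemma normal_rep_coefn:
  assumes "f \<in> fock n" "g \<in> fock n"
  shows "normal_rep n (coefn n f g) (\<lambda>k. if k = 0 then f else 0) (\<lambda>k. if k = 0 then g else 0)"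
  unfolding normal_rep_def sq_summable_def coefn_def
proof (intro conjI allI ballI)
  show "summable (\<lambda>k. (fnorm n (if k = 0 then f else 0))\<^sup>2)" by (rule suminf_at_0) simp
  show "summable (\<lambda>k. (fnorm n (if k = 0 then g else 0))\<^sup>2)" by (rule suminf_at_0) simp
  fix w assume w: "w \<in> words n"
  show "fock_ip n (word_op shift_op w f) g = (\<Sum>k. fock_ip n (word_op shift_op w (if k = 0 then f else 0)) (if k = 0 then g else 0))"
    by (subst suminf_at_0) (use w in \<open>auto intro!: fock.ip_zero_right word_op_shift_fock\<close>)
qed (use assms in auto)

text \<open>The obvious representation only gives the larger of the two squared norms; normalising
  \<open>f\<close> and \<open>g\<close> first turns this into their product, the bound that makes a
  functional on the predual a bounded sesquilinear form.\<close>

lemma normal_bd_coefn: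
  assumes f: "f \<in> fock n" and g: "g \<in> fock n"
  shows "normal_bd n (coefn n f g) (fnorm n f * fnorm n g)"
proof (cases "fnorm n f = 0 \<or> fnorm n g = 0")
  case True
  have "coefn n f g w = 0" if w: "w \<in> words n" for w
    using fock.cauchy_schwarz[OF word_op_shift_fock[OF w f] g] True f w by (auto simp: coefn_def)
  then show ?thesis using True by (intro normal_bd_cong[OF normal_bd_zero[THEN normal_bd_mono]]) auto
next
  case False
  define f' g' where "f' = complex_of_real (1 / fnorm n f) *\<^sub>C f" and "g' = complex_of_real (1 / fnorm n g) *\<^sub>C g"
  have f': "f' \<in> fock n" "fnorm n f' = 1" and g': "g' \<in> fock n" "fnorm n g' = 1"
    using f g False by (auto simp: f'_def g'_def fock.nm_scale norm_divide)
  have "(\<Sum>k. (fnorm n (if k = 0 then f' else 0))\<^sup>2) \<le> 1" "(\<Sum>k. (fnorm n (if k = 0 then g' else 0))\<^sup>2) \<le> 1"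
    by (subst suminf_at_0; use f' g' in simp)+
  with normal_rep_coefn[OF f'(1) g'(1)] have "normal_bd n (coefn n f' g') 1" unfolding normal_bd_def by blast
  from normal_bd_scale[OF this, of "of_real (fnorm n f * fnorm n g)"]
  have "normal_bd n (complex_of_real (fnorm n f * fnorm n g) *\<^sub>C coefn n f' g') (fnorm n f * fnorm n g)"
    using f g by (simp add: norm_mult)
  then show ?thesis
    by (rule normal_bd_cong) (use False f g in \<open>simp add: coefn_def f'_def g'_def word_op_shift_scale
      fock.ip_scale_left fock.ip_scale_right word_op_shift_fock\<close>)
qed

text \<open>The predual of the convolution operators is a Banach space whose norm is the functional norm:
  a Hahn--Banach functional on the normal functionals is given by a convolution operator \<open>T\<close>
  of norm at most 1, and \<open>\<phi> (T)\<close> is the limit of \<open>\<phi>\<close> at the Cesaro means of \<open>T\<close>.\<close>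
lemma normal_bd_approx:
  assumes norm0: "normal n \<phi>0" and bd: "poly_bd n \<phi>0 b" and e: "e > 0"
  shows "normal_bd n \<phi>0 (b + e)"
proof -
  define X where "X = {\<phi>. normal n \<phi>}"
  \<comment> \<open>The predual norm as a gauge. A functional \<open>F\<close> that norms
    \<open>\<phi>0\<close> will show \<open>p \<phi>0 \<le> b\<close>; the excess \<open>e\<close>
    is spent on choosing a representation close to the infimum.\<close>
  define p where "p = (\<lambda>\<phi>. Inf {b. normal_bd n \<phi> b})"
  have X: "csubspace X"
    using normal_bd_zero normal_add normal_scale by (auto simp: csubspace_def X_def normal_iff_bd zero_fun_def)
  have bdd: "bdd_below {b. normal_bd n \<phi> b}" for \<phi> using normal_bd_nonneg by (intro bdd_belowI[of _ 0]) auto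
  have ple: "p \<phi> \<le> b" if "normal_bd n \<phi> b" for \<phi> b unfolding p_def using that bdd by (intro cInf_lower) auto
  have pgr: "c \<le> p \<phi>" if "\<phi> \<in> X" "\<And>b. normal_bd n \<phi> b \<Longrightarrow> c \<le> b" for \<phi> c
    unfolding p_def using that by (intro cInf_greatest) (auto simp: X_def normal_iff_bd)
  have XI: "\<phi> \<in> X" if "normal_bd n \<phi> b" for \<phi> b using that by (auto simp: X_def normal_iff_bd)
  have p0: "p \<phi> \<ge> 0" if "\<phi> \<in> X" for \<phi> using that by (intro pgr normal_bd_nonneg)
  have padd: "p (\<phi> + \<psi>) \<le> p \<phi> + p \<psi>" if "\<phi> \<in> X" "\<psi> \<in> X" for \<phi> \<psi>
  proof -
    have "p (\<phi> + \<psi>) - c \<le> p \<phi>" if c: "normal_bd n \<psi> c" for c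
      using ple[OF normal_bd_add[OF _ c]] by (intro pgr \<open>\<phi> \<in> X\<close>) (simp add: algebra_simps)
    then have "p (\<phi> + \<psi>) - p \<phi> \<le> p \<psi>" by (intro pgr \<open>\<psi> \<in> X\<close>) (simp add: algebra_simps)
    then show ?thesis by simp
  qed
  have pscale_le: "p (c *\<^sub>C \<phi>) \<le> cmod c * p \<phi>" if "\<phi> \<in> X" "c \<noteq> 0" for c \<phi>
  proof -
    have "p (c *\<^sub>C \<phi>) / cmod c \<le> p \<phi>"
      using ple[OF normal_bd_scale, of \<phi> _ c] that by (intro pgr) (auto simp: field_simps)
    then show ?thesis using that by (simp add: field_simps)
  qed
  have pscale: "p (c *\<^sub>C \<phi>) = cmod c * p \<phi>" if \<phi>: "\<phi> \<in> X" for c \<phi>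
  proof (cases "c = 0")
    case True
    have "p 0 = 0" using ple[OF normal_bd_zero] p0[OF csubspace_zero[OF X]] by (simp add: zero_fun_def)
    then show ?thesis using True by simp
  next
    case False
    have "p ((1 / c) *\<^sub>C (c *\<^sub>C \<phi>)) \<le> cmod (1 / c) * p (c *\<^sub>C \<phi>)"
      using False \<phi> by (intro pscale_le csubspace_scale[OF X]) auto
    then have "cmod c * p \<phi> \<le> p (c *\<^sub>C \<phi>)" using False by (simp add: scaleC_scaleC scaleC_one norm_divide field_simps)
    then show ?thesis using pscale_le[OF \<phi> False] by simp
  qed
  have \<phi>0: "\<phi>0 \<in> X" using norm0 by (simp add: X_def)
  obtain F where Fadd: "\<And>x y. x \<in> X \<Longrightarrow> y \<in> X \<Longrightarrow> F (x + y) = F x + F y"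
    and Fscale: "\<And>c x. x \<in> X \<Longrightarrow> F (c *\<^sub>C x) = c * F x"
    and Fbd: "\<And>x. x \<in> X \<Longrightarrow> cmod (F x) \<le> p x" and F0: "p \<phi>0 \<le> Re (F \<phi>0)"
    by (rule hahn_banach_seminorm[OF X padd pscale \<phi>0]) auto
  have Fdiff: "F (x - y) = F x - F y" if "x \<in> X" "y \<in> X" for x y
    using Fadd[of x "(-1) *\<^sub>C y"] Fscale[of y "-1"] csubspace_scale[OF X, of y "-1"] that by simp
  have Fsum: "F (\<Sum>i\<in>A. c i *\<^sub>C x i) = (\<Sum>i\<in>A. c i * F (x i))" if "finite A" "\<And>i. i \<in> A \<Longrightarrow> x i \<in> X" for A and c :: "'b \<Rightarrow> complex" and x
    using that
  proof (induction A rule: finite_induct)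
    case empty
    have "F 0 = 0" using Fscale[OF csubspace_zero[OF X], of 0] by simp
    then show ?case by (simp only: sum.empty)
  next
    case (insert a A)
    have xa: "x a \<in> X" using insert.prems by simp
    have xA: "x i \<in> X" if "i \<in> A" for i using insert.prems that by simp
    have sA: "(\<Sum>i\<in>A. c i *\<^sub>C x i) \<in> X" by (intro csubspace_sum[OF X] csubspace_scale[OF X] xA)
    have "F (\<Sum>i\<in>insert a A. c i *\<^sub>C x i) = F (c a *\<^sub>C x a + (\<Sum>i\<in>A. c i *\<^sub>C x i))"
      by (rule arg_cong[where f = F], rule sum.insert[OF insert.hyps])
    also have "\<dots> = c a * F (x a) + F (\<Sum>i\<in>A. c i *\<^sub>C x i)"
      by (simp only: Fadd[OF csubspace_scale[OF X xa] sA] Fscale[OF xa])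
    also have "F (\<Sum>i\<in>A. c i *\<^sub>C x i) = (\<Sum>i\<in>A. c i * F (x i))" by (rule insert.IH[OF xA])
    also have "c a * F (x a) + (\<Sum>i\<in>A. c i * F (x i)) = (\<Sum>i\<in>insert a A. c i * F (x i))"
      by (rule sum.insert[OF insert.hyps, symmetric])
    finally show ?case .
  qed
  \<comment> \<open>Functions that agree on \<open>words n\<close> differ by one of gauge 0, which
    \<open>F\<close> cannot see.\<close>
  have Fcong: "F \<phi> = F \<psi>" if "\<psi> \<in> X" "\<And>w. w \<in> words n \<Longrightarrow> \<phi> w = \<psi> w" for \<phi> \<psi>
  proof -
    have \<phi>: "\<phi> \<in> X" using that normal_cong[of n \<psi> \<phi>] by (simp add: X_def)
    have b: "normal_bd n (\<phi> - \<psi>) 0" by (rule normal_bd_cong[OF normal_bd_zero]) (simp add: that)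
    have "cmod (F (\<phi> - \<psi>)) \<le> 0" by (rule order_trans[OF Fbd[OF XI[OF b]] ple[OF b]])
    then show ?thesis unfolding Fdiff[OF \<phi> that(1)] by simp
  qed
  have cX: "coefn n f g \<in> X" if "f \<in> fock n" "g \<in> fock n" for f g by (rule XI[OF normal_bd_coefn[OF that]])
  have Fc: "cmod (F (coefn n f g)) \<le> fnorm n f * fnorm n g" if "f \<in> fock n" "g \<in> fock n" for f g
    using Fbd[OF cX[OF that]] ple[OF normal_bd_coefn[OF that]] by linarith
  \<comment> \<open>The operator whose matrix coefficients are the values of \<open>F\<close> on the
    rank-one functionals.\<close>
  define T where "T = (\<lambda>f w. if w \<in> words n then F (coefn n f (ev w)) else 0)"
  have T_ip: "F (coefn n f g) = (\<Sum>w\<in>A. T f w * cnj (g w))"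
    if f: "f \<in> fock n" and A: "finite A" "A \<subseteq> words n" and g0: "\<And>w. w \<notin> A \<Longrightarrow> g w = 0" for f g A
  proof -
    have g: "g \<in> fock n" by (rule fock_finite_support(1)[OF A g0])
    have gs: "g = (\<Sum>w\<in>A. g w *\<^sub>C ev w)"
    proof
      fix v show "g v = (\<Sum>w\<in>A. g w *\<^sub>C ev w) v"
        using A(1) g0[of v] by (cases "v \<in> A") (auto simp: sum_fun_apply ev_def if_distrib[of "(*) _"] cong: if_cong)
    qed
    have "F (coefn n f g) = F (\<Sum>w\<in>A. cnj (g w) *\<^sub>C coefn n f (ev w))"
    proof (rule Fcong)
      show "(\<Sum>w\<in>A. cnj (g w) *\<^sub>C coefn n f (ev w)) \<in> X"
        using f A by (intro csubspace_sum[OF X] csubspace_scale[OF X] cX) auto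
      fix u assume u: "u \<in> words n"
      have "coefn n f (\<Sum>w\<in>A. g w *\<^sub>C ev w) u = (\<Sum>w\<in>A. cnj (g w) * coefn n f (ev w) u)"
        unfolding coefn_def using A u f
        by (subst fock.ip_sum_right) (auto simp: word_op_shift_fock fock.ip_scale_right subset_iff)
      then show "coefn n f g u = (\<Sum>w\<in>A. cnj (g w) *\<^sub>C coefn n f (ev w)) u"
        unfolding gs[symmetric] by (simp add: sum_fun_apply)
    qed
    also have "\<dots> = (\<Sum>w\<in>A. cnj (g w) * F (coefn n f (ev w)))"
      by (rule Fsum) (use A f in \<open>auto intro: cX\<close>)
    finally show ?thesis using A by (auto simp: T_def mult.commute intro!: sum.cong)
  qed
  have T_sum: "(\<Sum>w\<in>A. (cmod (T f w))\<^sup>2) \<le> (fnorm n f)\<^sup>2" if f: "f \<in> fock n" and A: "finite A" "A \<subseteq> words n" for f A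
  proof -
    \<comment> \<open>Testing \<open>T f\<close> against its own restriction to \<open>A\<close>
      bounds the partial square sum, so \<open>T f\<close> is square summable with norm at most that
      of \<open>f\<close>.\<close>
    define g where "g = (\<lambda>w. if w \<in> A then T f w else 0)"
    have g0: "g w = 0" if "w \<notin> A" for w using that by (simp add: g_def)
    have g: "g \<in> fock n" "(fnorm n g)\<^sup>2 = (\<Sum>w\<in>A. (cmod (g w))\<^sup>2)"
      by (rule fock_finite_support[OF A g0], assumption)+
    define S where "S = (\<Sum>w\<in>A. (cmod (T f w))\<^sup>2)"
    have gS: "(fnorm n g)\<^sup>2 = S" unfolding g(2) S_def by (intro sum.cong) (auto simp: g_def)
    have "F (coefn n f g) = (\<Sum>w\<in>A. T f w * cnj (g w))" by (rule T_ip[OF f A g0])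
    also have "\<dots> = of_real S"
      unfolding S_def of_real_sum
      by (intro sum.cong) (auto simp: g_def complex_norm_square[symmetric] simp del: of_real_power)
    finally have "F (coefn n f g) = of_real S" .
    then have "\<bar>S\<bar> \<le> fnorm n f * fnorm n g" using Fc[OF f g(1)] by simp
    then have "fnorm n g * fnorm n g \<le> fnorm n f * fnorm n g" using gS by (simp add: power2_eq_square)
    then have "fnorm n g \<le> fnorm n f"
      using fock.nm_nonneg[OF g(1)] fock.nm_nonneg[OF f] by (cases "fnorm n g = 0") (auto simp: mult_le_cancel_right)
    from power_mono[OF this fock.nm_nonneg[OF g(1)], of 2] show ?thesis using gS by (simp add: S_def)
  qed
  have T_summable: "(\<lambda>w. (cmod (T f w))\<^sup>2) summable_on words n" if f: "f \<in> fock n" for f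
    by (rule nonneg_bdd_above_summable_on) (use T_sum[OF f] in \<open>auto intro!: bdd_aboveI2\<close>)
  have T_fock: "T f \<in> fock n" if f: "f \<in> fock n" for f
    using T_summable[OF f] by (auto simp: fock_def l2_def T_def)
  have T_norm: "fnorm n (T f) \<le> 1 * fnorm n f" if f: "f \<in> fock n" for f
  proof -
    have "(fnorm n (T f))\<^sup>2 \<le> (fnorm n f)\<^sup>2"
      unfolding fock_norm_sq[of n "T f"] by (rule infsum_le_finite_sums[OF T_summable[OF f] T_sum[OF f]])
    then show ?thesis using f T_fock[OF f] by (simp add: abs_le_square_iff[symmetric])
  qed
  have T_F: "fock_ip n (T f) g = F (coefn n f g)" if f: "f \<in> fock n" and g: "g \<in> fock n" for f g
  proof -
    have "cmod (fock_ip n (T f) g - F (coefn n f g)) \<le> 2 * fnorm n f * fnorm n (g - trunc K g)" for K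
    proof -
      have tr: "trunc K g \<in> fock n" using g by simp
      have "fock_ip n (T f) (trunc K g) = (\<Sum>w\<in>wd n K. T f w * cnj (trunc K g w))"
        using fock.ip_cnj[OF tr T_fock[OF f]] by (simp add: fock_ip_trunc[OF g] trunc_wd mult.commute)
      also have "\<dots> = F (coefn n f (trunc K g))" by (rule T_ip[OF f finite_wd wd_words trunc_eq[OF g], symmetric])
      finally have eq: "fock_ip n (T f) (trunc K g) = F (coefn n f (trunc K g))" .
      have "F (coefn n f g) = F (coefn n f (g - trunc K g) + coefn n f (trunc K g))"
        using f g by (intro Fcong csubspace_add[OF X] cX) (auto simp: coefn_def fock.ip_diff_right word_op_shift_fock)
      also have "\<dots> = F (coefn n f (g - trunc K g)) + F (coefn n f (trunc K g))"
        using f g by (intro Fadd cX) auto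
      finally have eq2: "F (coefn n f g) = F (coefn n f (g - trunc K g)) + F (coefn n f (trunc K g))" .
      have "fock_ip n (T f) g - F (coefn n f g) = fock_ip n (T f) (g - trunc K g) - F (coefn n f (g - trunc K g))"
        unfolding eq2 using g T_fock[OF f] by (simp add: fock.ip_diff_right eq)
      then have "cmod (fock_ip n (T f) g - F (coefn n f g)) \<le> cmod (fock_ip n (T f) (g - trunc K g)) + cmod (F (coefn n f (g - trunc K g)))"
        by (simp add: norm_triangle_ineq4)
      also have "\<dots> \<le> fnorm n (T f) * fnorm n (g - trunc K g) + fnorm n f * fnorm n (g - trunc K g)"
        using f g T_fock[OF f] by (intro add_mono fock.cauchy_schwarz Fc) auto
      also have "\<dots> \<le> fnorm n f * fnorm n (g - trunc K g) + fnorm n f * fnorm n (g - trunc K g)"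
        using T_norm[OF f] g by (intro add_mono mult_right_mono) auto
      finally show ?thesis by simp
    qed
    moreover have "(\<lambda>K. 2 * fnorm n f * fnorm n (g - trunc K g)) \<longlonglongrightarrow> 2 * fnorm n f * 0"
      by (intro tendsto_intros fnorm_trunc_tendsto g)
    ultimately have "cmod (fock_ip n (T f) g - F (coefn n f g)) \<le> 0"
      by (intro LIMSEQ_le_const[of _ 0]) auto
    then show ?thesis by simp
  qed
  have T_conv: "T \<in> conv_ops n"
    unfolding conv_ops_def bounded_op_def
  proof (intro CollectI conjI ballI allI exI[of _ 1])
    fix f g assume fg: "f \<in> fock n" "g \<in> fock n"
    have "F (coefn n (f + g) (ev w)) = F (coefn n f (ev w)) + F (coefn n g (ev w))" if w: "w \<in> words n" for w
    proof -
      have "F (coefn n (f + g) (ev w)) = F (coefn n f (ev w) + coefn n g (ev w))"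
        using fg w by (intro Fcong csubspace_add[OF X] cX) (auto simp: coefn_def word_op_shift_add fock.ip_add_left word_op_shift_fock)
      then show ?thesis using fg w by (simp add: Fadd cX)
    qed
    then show "T (f + g) = T f + T g" by (auto simp: T_def fun_eq_iff)
  next
    fix c f assume f: "f \<in> fock n"
    have "F (coefn n (c *\<^sub>C f) (ev w)) = c * F (coefn n f (ev w))" if w: "w \<in> words n" for w
    proof -
      have "F (coefn n (c *\<^sub>C f) (ev w)) = F (c *\<^sub>C coefn n f (ev w))"
        using f w by (intro Fcong csubspace_scale[OF X] cX) (auto simp: coefn_def word_op_shift_scale fock.ip_scale_left word_op_shift_fock)
      then show ?thesis using f w by (simp add: Fscale cX)
    qed
    then show "T (c *\<^sub>C f) = c *\<^sub>C T f" by (auto simp: T_def fun_eq_iff)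
  next
    fix f w assume f: "f \<in> fock n" and w: "w \<in> words n"
    \<comment> \<open>At a word \<open>u\<close> both functionals give the value of \<open>f\<close>
      at what remains of \<open>w\<close> after the prefix \<open>u\<close>, or 0 if
      \<open>u\<close> is no prefix; the convolution formula for \<open>T\<close> is then linearity
      of \<open>F\<close>.\<close>
    have "F (coefn n f (ev w)) = F (\<Sum>i\<in>{..length w}. f (drop i w) *\<^sub>C coefn n (ev []) (ev (take i w)))"
    proof (rule Fcong)
      show "(\<Sum>i\<in>{..length w}. f (drop i w) *\<^sub>C coefn n (ev []) (ev (take i w))) \<in> X"
        using w by (intro csubspace_sum[OF X] csubspace_scale[OF X] cX) (auto intro: words_take)
      fix u assume u: "u \<in> words n"
      have "(\<Sum>i\<in>{..length w}. f (drop i w) * coefn n (ev []) (ev (take i w)) u)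
          = (\<Sum>i\<in>{..length w}. if i = length u then (if take (length u) w = u then f (drop i w) else 0) else 0)"
      proof (intro sum.cong refl)
        fix i assume i: "i \<in> {..length w}"
        have "coefn n (ev []) (ev (take i w)) u = word_op shift_op u (ev []) (take i w)"
          using u w by (simp add: coefn_def fock_ip_ev word_op_shift_fock words_take)
        also have "\<dots> = (if take i w = u then 1 else 0)" by (rule word_op_shift_ev_Nil)
        finally show "f (drop i w) * coefn n (ev []) (ev (take i w)) u
            = (if i = length u then (if take (length u) w = u then f (drop i w) else 0) else 0)"
          using i by auto
      qed
      also have "\<dots> = coefn n f (ev w) u"
        using u w f by (auto simp: coefn_def fock_ip_ev word_op_shift_fock word_op_shift)
      finally show "coefn n f (ev w) u = (\<Sum>i\<in>{..length w}. f (drop i w) *\<^sub>C coefn n (ev []) (ev (take i w))) u"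
        by (simp add: sum_fun_apply)
    qed
    also have "\<dots> = (\<Sum>i\<in>{..length w}. f (drop i w) * F (coefn n (ev []) (ev (take i w))))"
      by (rule Fsum) (use w in \<open>auto intro!: cX words_take\<close>)
    finally show "T f w = conv (T (ev [])) f w"
      using w by (auto simp: T_def conv_def words_take mult.commute intro!: sum.cong)
  qed (use T_fock T_norm in auto)
  obtain \<xi> \<eta> where rep: "normal_rep n \<phi>0 \<xi> \<eta>" using norm0 by (auto simp: normal_def)
  have sq: "sq_summable (fock n) (fock_ip n) \<xi>" "sq_summable (fock n) (fock_ip n) \<eta>"
    using rep by (auto simp: normal_rep_def)
  note mem = sq_summable_mem[OF sq(1)] sq_summable_mem[OF sq(2)]
  let ?t = "\<lambda>x K. \<Sum>k. (fnorm n (x (k + K)))\<^sup>2"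
  have tail: "(\<lambda>K. ?t x K) \<longlonglongrightarrow> 0" if "sq_summable (fock n) (fock_ip n) x" for x
  proof -
    have s: "summable (\<lambda>k. (fnorm n (x k))\<^sup>2)" using that by (simp add: sq_summable_def)
    have "(\<lambda>K. (\<Sum>k. (fnorm n (x k))\<^sup>2) - (\<Sum>k<K. (fnorm n (x k))\<^sup>2)) \<longlonglongrightarrow> (\<Sum>k. (fnorm n (x k))\<^sup>2) - (\<Sum>k. (fnorm n (x k))\<^sup>2)"
      by (intro tendsto_intros summable_LIMSEQ s)
    then show ?thesis by (simp add: suminf_minus_initial_segment[OF s])
  qed
  have "(\<lambda>K. \<Sum>k<K. fock_ip n (T (\<xi> k)) (\<eta> k)) \<longlonglongrightarrow> F \<phi>0"
  proof (rule LIM_zero_cancel, rule Lim_null_comparison[OF always_eventually], rule allI)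
    show "(\<lambda>K. ?t \<xi> K + ?t \<eta> K) \<longlonglongrightarrow> 0" using tendsto_add[OF tail[OF sq(1)] tail[OF sq(2)]] by simp
    fix K
    \<comment> \<open>The tail of \<open>\<phi>0\<close>, represented by the shifted sequences,
      whose gauge tends to 0. The factor 1 gives the finite part the shape that \<open>Fsum\<close>
      asks for.\<close>
    define \<psi> where "\<psi> = \<phi>0 - (\<Sum>k<K. 1 *\<^sub>C coefn n (\<xi> k) (\<eta> k))"
    have "normal_rep n \<psi> (\<lambda>k. \<xi> (k + K)) (\<lambda>k. \<eta> (k + K))"
      unfolding normal_rep_def
    proof (intro conjI ballI)
      show "sq_summable (fock n) (fock_ip n) (\<lambda>k. \<xi> (k + K))" "sq_summable (fock n) (fock_ip n) (\<lambda>k. \<eta> (k + K))"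
        using sq unfolding sq_summable_def by (simp_all add: summable_iff_shift[of "\<lambda>k. (fnorm n (_ k))\<^sup>2"])
      fix w assume w: "w \<in> words n"
      show "\<psi> w = (\<Sum>k. fock_ip n (word_op shift_op w (\<xi> (k + K))) (\<eta> (k + K)))"
        using suminf_minus_initial_segment[OF summable_norm_cancel[OF normal_rep_summable(1)[OF rep w]], of K] rep w
        by (simp add: \<psi>_def sum_fun_apply normal_rep_def coefn_def scaleC_one)
    qed
    moreover have "?t \<xi> K \<ge> 0" "?t \<eta> K \<ge> 0"
      using sq by (auto simp: sq_summable_def summable_iff_shift[of "\<lambda>k. (fnorm n (_ k))\<^sup>2"] intro!: suminf_nonneg)
    ultimately have bdK: "normal_bd n \<psi> (?t \<xi> K + ?t \<eta> K)"
      unfolding normal_bd_def by (intro exI conjI) auto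
    have sX: "(\<Sum>k<K. 1 *\<^sub>C coefn n (\<xi> k) (\<eta> k)) \<in> X"
      using mem by (intro csubspace_sum[OF X] csubspace_scale[OF X] cX) auto
    have "F \<psi> = F \<phi>0 - (\<Sum>k<K. fock_ip n (T (\<xi> k)) (\<eta> k))"
      unfolding \<psi>_def Fdiff[OF \<phi>0 sX] using mem by (subst Fsum) (auto simp: T_F intro: cX)
    then have "cmod ((\<Sum>k<K. fock_ip n (T (\<xi> k)) (\<eta> k)) - F \<phi>0) = cmod (F \<psi>)" by (simp add: norm_minus_commute)
    also have "\<dots> \<le> ?t \<xi> K + ?t \<eta> K" using Fbd[OF XI[OF bdK]] ple[OF bdK] by linarith
    finally show "norm ((\<Sum>k<K. fock_ip n (T (\<xi> k)) (\<eta> k)) - F \<phi>0) \<le> ?t \<xi> K + ?t \<eta> K" .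
  qed
  then have F_eq: "F \<phi>0 = (\<Sum>k. fock_ip n (T (\<xi> k)) (\<eta> k))"
    by (simp add: sums_def[symmetric] sums_unique)
  have "cmod (F \<phi>0) \<le> b"
  proof (rule LIMSEQ_le_const2)
    show "(\<lambda>j. cmod (\<Sum>w\<in>wd n j. cesaro j (T (ev [])) w * \<phi>0 w)) \<longlonglongrightarrow> cmod (F \<phi>0)"
      unfolding F_eq by (rule tendsto_norm[OF normal_cesaro_tendsto[OF rep T_conv]])
    \<comment> \<open>Only here is the hypothesis on polynomials applied: the Cesaro means of the
      contraction \<open>T\<close> are polynomials of norm at most 1.\<close>
    have "cmod (\<Sum>w\<in>wd n j. cesaro j (T (ev [])) w * \<phi>0 w) \<le> b * 1" if "j \<ge> 1" for j
      using bd[unfolded poly_bd_def, rule_format, OF finite_wd wd_words cesaro_bound[OF T_conv T_norm]] that by simp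
    then show "\<exists>N. \<forall>j\<ge>N. cmod (\<Sum>w\<in>wd n j. cesaro j (T (ev [])) w * \<phi>0 w) \<le> b" by auto
  qed
  then have "p \<phi>0 < b + e" using F0 complex_Re_le_cmod[of "F \<phi>0"] e by linarith
  then obtain b' where "normal_bd n \<phi>0 b'" "b' < b + e"
    unfolding p_def using bdd \<phi>0 by (subst (asm) cInf_less_iff) (auto simp: X_def normal_iff_bd)
  then show ?thesis using normal_bd_mono by fastforce
qed

text \<open>\<open>normal_bd_approx\<close> costs an arbitrary positive excess; taking
  \<open>(1/2)^k\<close> for the term \<open>k\<close> keeps the bounds summable.\<close>

lemma normal_suminf:
  assumes "\<And>k. normal n (\<psi> k)" "\<And>k. poly_bd n (\<psi> k) (b k)" "summable b"
  shows "normal n (\<lambda>w. \<Sum>k. \<psi> k w)"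
proof -
  have "normal_bd n (\<psi> k) (b k + (1/2) ^ k)" for k by (rule normal_bd_approx[OF assms(1,2)]) simp
  moreover have "summable (\<lambda>k. b k + (1/2) ^ k)"
    by (intro summable_add assms(3) summable_geometric) simp
  ultimately show ?thesis unfolding normal_iff_bd by (intro exI) (rule normal_bd_suminf(1))
qed

subsection \<open>Isometric tuples\<close>

context ip_space begin

text \<open>Finitely many vectors occur in the tensor estimate, so a finite orthonormal family gives
  all of them scalar coordinates.\<close>

lemma gram_schmidt:
  assumes "finite S" "S \<subseteq> M"
  shows "\<exists>E. finite E \<and> E \<subseteq> M \<and> (\<forall>e\<in>E. \<forall>e'\<in>E. ip e e' = (if e = e' then 1 else 0)) \<and>
    (\<forall>x\<in>S. x = (\<Sum>e\<in>E. ip x e *\<^sub>C e))"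
  using assms
proof (induction S rule: finite_induct)
  case empty
  then show ?case by (intro exI[of _ "{}"]) auto
next
  case (insert a S)
  have a: "a \<in> M" and SM: "S \<subseteq> M" using insert.prems by auto
  from insert.IH[OF SM] obtain E where E: "finite E" "E \<subseteq> M" "\<And>e e'. e \<in> E \<Longrightarrow> e' \<in> E \<Longrightarrow> ip e e' = (if e = e' then 1 else 0)"
    "\<And>x. x \<in> S \<Longrightarrow> x = (\<Sum>e\<in>E. ip x e *\<^sub>C e)" by blast
  define r where "r = a - (\<Sum>e\<in>E. ip a e *\<^sub>C e)"
  have r: "r \<in> M" unfolding r_def using a E by (intro diff_mem sum_mem) auto
  have re: "ip r e = 0" if "e \<in> E" for e
  proof -
    have eM: "e \<in> M" using that E by auto
    have "ip (\<Sum>e'\<in>E. ip a e' *\<^sub>C e') e = (\<Sum>e'\<in>E. ip a e' * ip e' e)"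
      using E eM by (subst ip_sum_left) (auto simp: ip_scale_left subset_iff)
    also have "\<dots> = (\<Sum>e'\<in>E. if e' = e then ip a e else 0)"
      using E that by (intro sum.cong) auto
    finally show ?thesis using E that eM a
      by (simp add: r_def ip_diff_left sum_mem subset_iff)
  qed
  show ?case
  proof (cases "r = 0")
    case True
    then have "a = (\<Sum>e\<in>E. ip a e *\<^sub>C e)" by (simp add: r_def)
    then show ?thesis using E(1,2,3) E(4) by (intro exI[of _ E] conjI ballI) blast+
  next
    case False
    define d where "d = complex_of_real (1 / nm r) *\<^sub>C r"
    have nr: "nm r \<noteq> 0" using False r nm_eq_0 by blast
    have d: "d \<in> M" "ip d d = 1"
      using r nr by (auto simp: d_def ip_scale_left ip_scale_right ip_self[OF r] power2_eq_square)
    have de: "ip d e = 0" "ip e d = 0" if "e \<in> E" for e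
    proof -
      have eM: "e \<in> M" using that E by auto
      show "ip d e = 0" using re[OF that] r eM by (simp add: d_def ip_scale_left)
      then show "ip e d = 0" using ip_cnj[OF d(1) eM] by simp
    qed
    have dE: "d \<notin> E" using de(1)[of d] d(2) by auto
    have ad: "ip a d *\<^sub>C d = r"
    proof -
      have "ip a d = ip r d + ip (\<Sum>e\<in>E. ip a e *\<^sub>C e) d"
        using a d E by (simp add: r_def ip_diff_left sum_mem subset_iff)
      also have "ip (\<Sum>e\<in>E. ip a e *\<^sub>C e) d = 0"
        using E d de by (subst ip_sum_left) (auto simp: ip_scale_left subset_iff)
      also have "ip r d = of_real (nm r)"
        using r nr by (simp add: d_def ip_scale_right ip_self[OF r] power2_eq_square)
      finally show ?thesis using nr by (simp add: d_def scaleC_scaleC scaleC_one)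
    qed
    have "x = (\<Sum>e\<in>insert d E. ip x e *\<^sub>C e)" if x: "x \<in> insert a S" for x
    proof (cases "x = a")
      case True
      then show ?thesis using E dE ad by (simp add: r_def)
    next
      case False
      then have xS: "x \<in> S" using x by simp
      then have "ip x d = ip (\<Sum>e\<in>E. ip x e *\<^sub>C e) d" using E(4) by simp
      also have "\<dots> = 0" using E d de by (subst ip_sum_left) (auto simp: ip_scale_left subset_iff)
      finally show ?thesis using E(1) dE E(4)[OF xS] by simp
    qed
    then have 4: "\<forall>x\<in>insert a S. x = (\<Sum>e\<in>insert d E. ip x e *\<^sub>C e)" by blast
    have "\<forall>e\<in>insert d E. \<forall>e'\<in>insert d E. ip e e' = (if e = e' then 1 else 0)"
      using E(3) d(2) de dE by auto
    with 4 show ?thesis using E(1,2) d(1) by (intro exI[of _ "insert d E"] conjI) blast+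
  qed
qed

text \<open>The operator \<open>p(L) \<otimes> I\<close> has the same norm as \<open>p(L)\<close>, in coordinates.\<close>
lemma poly_op_tensor_bound:
  assumes W: "finite W" "W \<subseteq> words n"
    and B: "\<And>h. h \<in> fock n \<Longrightarrow> fnorm n (poly_op W c h) \<le> B * fnorm n h"
    and D: "finite D" "D \<subseteq> words n" and f: "\<And>w. w \<in> D \<Longrightarrow> f w \<in> M"
    and g: "\<And>w. w \<in> D \<Longrightarrow> g w \<in> M" "\<And>w. w \<notin> D \<Longrightarrow> g w = 0"
  shows "cmod (\<Sum>w\<in>D. \<Sum>v\<in>W. c v * ip (f w) (g (v @ w)))
    \<le> B * (sqrt (\<Sum>w\<in>D. (nm (f w))\<^sup>2) * sqrt (\<Sum>w\<in>D. (nm (g w))\<^sup>2))"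
proof -
  have "finite (f ` D \<union> g ` D)" "f ` D \<union> g ` D \<subseteq> M" using D(1) f g(1) by auto
  from gram_schmidt[OF this] obtain E where E0: "finite E \<and> E \<subseteq> M \<and> (\<forall>e\<in>E. \<forall>e'\<in>E. ip e e' = (if e = e' then 1 else 0)) \<and>
    (\<forall>x\<in>f ` D \<union> g ` D. x = (\<Sum>e\<in>E. ip x e *\<^sub>C e))" by (rule exE)
  have E: "finite E" "E \<subseteq> M" using E0 by simp_all
  have exp: "x = (\<Sum>e\<in>E. ip x e *\<^sub>C e)" if "x \<in> f ` D \<union> g ` D" for x
    using E0[THEN conjunct2, THEN conjunct2, THEN conjunct2] that by (rule bspec)
  have parseval: "ip x y = (\<Sum>e\<in>E. ip x e * cnj (ip y e))" if "x \<in> f ` D \<union> g ` D" "y \<in> M" for x y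
  proof -
    have "ip x y = ip (\<Sum>e\<in>E. ip x e *\<^sub>C e) y" using exp[OF that(1)] by simp
    also have "\<dots> = (\<Sum>e\<in>E. ip x e * ip e y)"
      using E that by (subst ip_sum_left) (auto simp: ip_scale_left subset_iff)
    also have "\<dots> = (\<Sum>e\<in>E. ip x e * cnj (ip y e))"
      using ip_cnj[OF that(2)] E(2) by (intro sum.cong) auto
    finally show ?thesis .
  qed
  have nsq: "(nm x)\<^sup>2 = (\<Sum>e\<in>E. (cmod (ip x e))\<^sup>2)" if "x \<in> f ` D \<union> g ` D" for x
  proof -
    have x: "x \<in> M" using that f g by auto
    have "complex_of_real ((nm x)\<^sup>2) = of_real (\<Sum>e\<in>E. (cmod (ip x e))\<^sup>2)"
      unfolding ip_self[OF x, symmetric] parseval[OF that x] of_real_sum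
      by (intro sum.cong refl) (rule complex_norm_square[symmetric])
    then show ?thesis by (simp only: of_real_eq_iff)
  qed
  \<comment> \<open>The coefficients of \<open>h\<close> at \<open>e\<close> as one Fock vector: the
    polynomial acts on each of these separately, and Cauchy-Schwarz over \<open>E\<close> recombines
    the estimates.\<close>
  define co where "co = (\<lambda>(h::nat list \<Rightarrow> 'a) e w. if w \<in> D then ip (h w) e else 0)"
  have co0: "co h e w = 0" if "w \<notin> D" for h e w using that by (simp add: co_def)
  have co_fock: "co h e \<in> fock n" for h e
    by (rule fock_finite_support(1)[OF D co0])
  have co_ip: "fock_ip n (co h e) k = (\<Sum>w\<in>D. co h e w * cnj (k w))" for h e k
    by (rule fock_finite_support(2)[OF D co0])
  have co_norm: "(fnorm n (co h e))\<^sup>2 = (\<Sum>w\<in>D. (cmod (co h e w))\<^sup>2)" for h e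
    by (rule fock_finite_support(3)[OF D co0])
  have co_sum: "(\<Sum>e\<in>E. (fnorm n (co h e))\<^sup>2) = (\<Sum>w\<in>D. (nm (h w))\<^sup>2)" if h: "h ` D \<subseteq> f ` D \<union> g ` D" for h
  proof -
    have "(\<Sum>e\<in>E. (fnorm n (co h e))\<^sup>2) = (\<Sum>w\<in>D. \<Sum>e\<in>E. (cmod (co h e w))\<^sup>2)"
      unfolding co_norm by (rule sum.swap)
    also have "\<dots> = (\<Sum>w\<in>D. (nm (h w))\<^sup>2)"
      using h by (intro sum.cong refl) (simp add: co_def nsq image_subset_iff)
    finally show ?thesis .
  qed
  have poly: "fock_ip n (poly_op W c (co f e)) (co g e) = (\<Sum>v\<in>W. c v * (\<Sum>w\<in>D. co f e w * cnj (co g e (v @ w))))" for e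
  proof -
    have "fock_ip n (poly_op W c (co f e)) (co g e) = (\<Sum>v\<in>W. c v * fock_ip n (word_op shift_op v (co f e)) (co g e))"
      unfolding poly_op_def using W co_fock
      by (subst fock.ip_sum_left) (auto simp: fock.ip_scale_left word_op_shift_fock subset_iff)
    also have "\<dots> = (\<Sum>v\<in>W. c v * fock_ip n (co f e) (word_adj n v (co g e)))"
      using W co_fock by (intro sum.cong) (auto simp: word_adj_ip)
    moreover have "word_adj n v (co g e) w = co g e (v @ w)" if "w \<in> D" for v w
      using D(2) that by (auto simp: word_adj_def)
    ultimately show ?thesis by (simp add: co_ip cong: sum.cong)
  qed
  have "(\<Sum>w\<in>D. \<Sum>v\<in>W. c v * ip (f w) (g (v @ w))) = (\<Sum>w\<in>D. \<Sum>v\<in>W. c v * (\<Sum>e\<in>E. co f e w * cnj (co g e (v @ w))))"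
  proof (intro sum.cong refl)
    fix w v assume w: "w \<in> D" and v: "v \<in> W"
    show "c v * ip (f w) (g (v @ w)) = c v * (\<Sum>e\<in>E. co f e w * cnj (co g e (v @ w)))"
    proof (cases "v @ w \<in> D")
      case True
      then show ?thesis using w parseval[of "f w" "g (v @ w)"] g(1) by (simp add: co_def)
    next
      case False
      then show ?thesis using w f g(2) by (simp add: co_def)
    qed
  qed
  also have "\<dots> = (\<Sum>w\<in>D. \<Sum>e\<in>E. \<Sum>v\<in>W. c v * (co f e w * cnj (co g e (v @ w))))"
    unfolding sum_distrib_left by (rule sum.cong[OF refl], rule sum.swap)
  also have "\<dots> = (\<Sum>e\<in>E. \<Sum>w\<in>D. \<Sum>v\<in>W. c v * (co f e w * cnj (co g e (v @ w))))"
    by (rule sum.swap)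
  also have "\<dots> = (\<Sum>e\<in>E. \<Sum>v\<in>W. \<Sum>w\<in>D. c v * (co f e w * cnj (co g e (v @ w))))"
    by (rule sum.cong[OF refl], rule sum.swap)
  also have "\<dots> = (\<Sum>e\<in>E. fock_ip n (poly_op W c (co f e)) (co g e))"
    unfolding poly sum_distrib_left ..
  finally have eq: "(\<Sum>w\<in>D. \<Sum>v\<in>W. c v * ip (f w) (g (v @ w))) = (\<Sum>e\<in>E. fock_ip n (poly_op W c (co f e)) (co g e))" .
  have B0: "B \<ge> 0" using B[of "ev []"] fock.nm_nonneg[OF poly_op_fock[OF W(2), of "ev []" c]] by simp
  have "cmod (\<Sum>e\<in>E. fock_ip n (poly_op W c (co f e)) (co g e)) \<le> (\<Sum>e\<in>E. B * (\<bar>fnorm n (co f e)\<bar> * \<bar>fnorm n (co g e)\<bar>))"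
  proof (rule sum_norm_le)
    fix e
    have "cmod (fock_ip n (poly_op W c (co f e)) (co g e)) \<le> fnorm n (poly_op W c (co f e)) * fnorm n (co g e)"
      by (intro fock.cauchy_schwarz poly_op_fock W co_fock)
    also have "\<dots> \<le> (B * fnorm n (co f e)) * fnorm n (co g e)"
      by (intro mult_right_mono B co_fock fock.nm_nonneg)
    finally show "cmod (fock_ip n (poly_op W c (co f e)) (co g e)) \<le> B * (\<bar>fnorm n (co f e)\<bar> * \<bar>fnorm n (co g e)\<bar>)"
      using co_fock by (simp add: mult.assoc)
  qed
  also have "\<dots> \<le> B * (L2_set (\<lambda>e. fnorm n (co f e)) E * L2_set (\<lambda>e. fnorm n (co g e)) E)"
    unfolding sum_distrib_left[symmetric] by (intro mult_left_mono L2_set_mult_ineq B0)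
  finally show ?thesis by (simp add: eq L2_set_def co_sum)
qed

lemma adj_eqI:
  assumes "z \<in> M" "\<And>x. x \<in> M \<Longrightarrow> T x \<in> M" "\<And>x. x \<in> M \<Longrightarrow> ip (T x) y = ip x z"
  shows "adj M ip T y = z"
  unfolding adj_def by (rule the_equality) (use assms in \<open>auto intro!: ip_ext_right\<close>)

end

lemma (in hspace) adj_props:
  assumes T: "bounded_op M ip T" and y: "y \<in> M"
  shows "adj M ip T y \<in> M" "x \<in> M \<Longrightarrow> ip (T x) y = ip x (adj M ip T y)"
proof -
  obtain C where C: "\<And>x. x \<in> M \<Longrightarrow> nm (T x) \<le> C * nm x" and TM: "\<And>x. x \<in> M \<Longrightarrow> T x \<in> M"
    and lin: "\<And>x y. x \<in> M \<Longrightarrow> y \<in> M \<Longrightarrow> T (x + y) = T x + T y" "\<And>c x. x \<in> M \<Longrightarrow> T (c *\<^sub>C x) = c *\<^sub>C T x"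
    using T unfolding bounded_op_def by blast
  obtain z where z: "z \<in> M" "\<And>x. x \<in> M \<Longrightarrow> ip (T x) y = ip x z"
  proof (rule riesz[of "\<lambda>x. ip (T x) y" "C * nm y"])
    fix x assume x: "x \<in> M"
    have "cmod (ip (T x) y) \<le> nm (T x) * nm y" by (intro cauchy_schwarz TM x y)
    also have "\<dots> \<le> (C * nm x) * nm y" using C[OF x] y by (intro mult_right_mono) auto
    finally show "cmod (ip (T x) y) \<le> C * nm y * nm x" by (simp add: ac_simps)
  qed (use TM lin y in \<open>auto simp: ip_add_left ip_scale_left\<close>)
  have "adj M ip T y = z" by (rule adj_eqI[OF z(1) TM z(2)])
  then show "adj M ip T y \<in> M" "x \<in> M \<Longrightarrow> ip (T x) y = ip x (adj M ip T y)" using z by auto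
qed

locale iso_tuple =
  fixes ip :: "'h::cvec \<Rightarrow> 'h \<Rightarrow> complex" and n :: nat and V :: "nat \<Rightarrow> 'h \<Rightarrow> 'h"
  assumes hilbert_UNIV: "hilbert_space UNIV ip" and iso: "isometric_tuple UNIV ip n V"

sublocale iso_tuple \<subseteq> hspace UNIV ip
  by unfold_locales (rule hilbert_UNIV)

context iso_tuple begin

lemma V_bounded: "i < n \<Longrightarrow> bounded_op UNIV ip (V i)"
  using iso by (simp add: isometric_tuple_def)

lemma V_add: "i < n \<Longrightarrow> V i (x + y) = V i x + V i y"
  and V_scale: "i < n \<Longrightarrow> V i (c *\<^sub>C x) = c *\<^sub>C V i x"
  using V_bounded[of i] by (simp_all add: bounded_op_def)

lemma V_ip: "i < n \<Longrightarrow> j < n \<Longrightarrow> ip (V j x) (V i y) = (if i = j then ip x y else 0)"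
  using iso by (simp add: isometric_tuple_def)

lemma nm_V: "i < n \<Longrightarrow> nm (V i x) = nm x"
  by (simp add: cnorm_def V_ip)

abbreviation Vs :: "nat \<Rightarrow> 'h \<Rightarrow> 'h" where "Vs i \<equiv> adj UNIV ip (V i)"

lemma Vs_ip: "i < n \<Longrightarrow> ip (V i x) y = ip x (Vs i y)"
  using adj_props(2)[OF V_bounded] by simp

lemma ip_Vs: "i < n \<Longrightarrow> ip (Vs i x) y = ip x (V i y)"
  using ip_cnj[of "V i y" x] ip_cnj[of y "Vs i x"] by (simp add: Vs_ip)

lemma Vs_add: "i < n \<Longrightarrow> Vs i (x + y) = Vs i x + Vs i y"
  by (rule ip_ext) (auto simp: ip_Vs ip_add_left)

lemma Vs_scale: "i < n \<Longrightarrow> Vs i (c *\<^sub>C x) = c *\<^sub>C Vs i x"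
  by (rule ip_ext) (auto simp: ip_Vs ip_scale_left)

lemma nm_Vs: 
  assumes i: "i < n" shows "nm (Vs i x) \<le> nm x"
proof (cases "nm (Vs i x) = 0")
  case False
  have "(nm (Vs i x))\<^sup>2 = Re (ip (V i (Vs i x)) x)" by (simp add: nm_sq Vs_ip i)
  also have "\<dots> \<le> nm (V i (Vs i x)) * nm x"
    using cauchy_schwarz[of "V i (Vs i x)" x] complex_Re_le_cmod[of "ip (V i (Vs i x)) x"] by simp
  finally have "nm (Vs i x) * nm (Vs i x) \<le> nm (Vs i x) * nm x" by (simp add: nm_V i power2_eq_square)
  moreover have "nm (Vs i x) > 0" using False nm_nonneg[OF UNIV_I, of "Vs i x"] by linarith
  ultimately show ?thesis by (simp add: mult_le_cancel_left_pos)
qed simp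

abbreviation Wv :: "nat list \<Rightarrow> 'h \<Rightarrow> 'h" where "Wv \<equiv> word_op V"
text \<open>\<open>fold\<close> applies the first letter first, so this is the adjoint of
  \<open>Wv w\<close>.\<close>

abbreviation Ws :: "nat list \<Rightarrow> 'h \<Rightarrow> 'h" where "Ws \<equiv> fold Vs"

lemma Wv_add: "w \<in> words n \<Longrightarrow> Wv w (x + y) = Wv w x + Wv w y"
  by (induction w) (auto simp: V_add)

lemma Wv_scale: "w \<in> words n \<Longrightarrow> Wv w (c *\<^sub>C x) = c *\<^sub>C Wv w x"
  by (induction w) (auto simp: V_scale)

lemma Wv_diff: "w \<in> words n \<Longrightarrow> Wv w (x - y) = Wv w x - Wv w y"
  using Wv_add[of w x "(-1) *\<^sub>C y"] Wv_scale[of w "-1" y] by simp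

lemma nm_Wv: "w \<in> words n \<Longrightarrow> nm (Wv w x) = nm x"
  by (induction w) (auto simp: nm_V)

lemma Wv_ip: "w \<in> words n \<Longrightarrow> ip (Wv w x) y = ip x (Ws w y)"
  by (induction w arbitrary: y) (auto simp: Vs_ip)

definition phi :: "'h \<Rightarrow> 'h \<Rightarrow> nat list \<Rightarrow> complex" where "phi x y w = ip (Wv w x) y"

subsection \<open>The von Neumann inequality for isometric tuples\<close>

text \<open>The projection onto the joint kernel of the adjoints; the tuple is unitary iff it is
  zero.\<close>

definition defect :: "'h \<Rightarrow> 'h" where "defect x = x - (\<Sum>i<n. V i (Vs i x))"

lemma ip_defect: "ip (defect x) (defect y) = ip x y - (\<Sum>i<n. ip (Vs i x) (Vs i y))"
proof -
  have 1: "ip (\<Sum>i<n. V i (Vs i x)) y = (\<Sum>i<n. ip (Vs i x) (Vs i y))" for x y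
    by (subst ip_sum_left) (auto simp: Vs_ip)
  have 2: "ip x (\<Sum>i<n. V i (Vs i y)) = (\<Sum>i<n. ip (Vs i x) (Vs i y))" for x y
    by (subst ip_sum_right) (auto simp: ip_Vs)
  have "ip (\<Sum>i<n. V i (Vs i x)) (\<Sum>i<n. V i (Vs i y)) = (\<Sum>i<n. \<Sum>j<n. ip (V j (Vs j x)) (V i (Vs i y)))"
    by (simp add: ip_sum_left ip_sum_right)
  also have "\<dots> = (\<Sum>i<n. ip (Vs i x) (Vs i y))"
    by (simp add: V_ip)
  finally show ?thesis
    unfolding defect_def by (simp only: ip_diff_left ip_diff_right UNIV_I 1[of x y] 2[of x y]) simp
qed

text \<open>Let \<open>e_k\<close> be the basis of \<open>\<ell>\<^sup>2(\<nat>)\<close>. The tuple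
  \<open>V_i\<close> tensored with the shift has as wandering space the whole space at
  \<open>e_0\<close> together with the range of \<open>defect\<close> at every later
  \<open>e_j\<close>. The entry at \<open>j\<close> and \<open>w\<close> is the component along the
  word \<open>w\<close> of \<open>x\<close> placed at \<open>e_k\<close>, where
  \<open>k = j + length w\<close>.\<close>

definition coord :: "'h \<Rightarrow> nat \<Rightarrow> nat list \<Rightarrow> 'h" where
  "coord x j w = (if j = 0 then Ws w x else defect (Ws w x))"

lemma coord_append: "coord y j (v @ w) = coord (Ws v y) j w"
  by (simp add: coord_def)

text \<open>Parseval's identity for vectors placed at \<open>e_k\<close>. By
  \<open>ip_defect\<close>, each step replaces the vectors of the last level by their defects and by
  the vectors one letter further.\<close>

lemma coord_level: "(\<Sum>w\<in>wd n (Suc k). ip (coord x (k - length w) w) (coord y (k - length w) w)) = ip x y"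
proof -
  define wl where "wl = (\<lambda>k. {w \<in> words n. length w = k})"
  have fin: "finite (wl k)" for k by (rule finite_subset[OF _ finite_wd[of n "Suc k"]]) (auto simp: wl_def wd_def)
  have "(\<Sum>w\<in>wl k. ip (Ws w x) (Ws w y)) + (\<Sum>w\<in>wd n k. ip (defect (Ws w x)) (defect (Ws w y))) = ip x y" for k
  proof (induction k)
    case 0
    have "wl 0 = {[]}" "wd n 0 = {}" by (auto simp: wl_def wd_def)
    then show ?case by simp
  next
    case (Suc k)
    have "wd n (Suc k) = wd n k \<union> wl k" "wd n k \<inter> wl k = {}" by (auto simp: wd_def wl_def)
    then have 1: "(\<Sum>w\<in>wd n (Suc k). ip (defect (Ws w x)) (defect (Ws w y)))
      = (\<Sum>w\<in>wd n k. ip (defect (Ws w x)) (defect (Ws w y))) + (\<Sum>w\<in>wl k. ip (defect (Ws w x)) (defect (Ws w y)))"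
      using fin by (simp add: sum.union_disjoint)
    have "(\<Sum>w\<in>wl (Suc k). ip (Ws w x) (Ws w y)) = (\<Sum>(w,i)\<in>wl k \<times> {..<n}. ip (Vs i (Ws w x)) (Vs i (Ws w y)))"
    proof (rule sum.reindex_bij_witness[of _ "\<lambda>(w,i). w @ [i]" "\<lambda>w. (butlast w, last w)"])
      fix w assume w: "w \<in> wl (Suc k)"
      then have nw: "w \<noteq> []" by (auto simp: wl_def)
      then obtain v i where v: "w = v @ [i]" by (metis append_butlast_last_id)
      then show "(\<lambda>(w,i). w @ [i]) (butlast w, last w) = w" "(butlast w, last w) \<in> wl k \<times> {..<n}"
        "(case (butlast w, last w) of (w, i) \<Rightarrow> ip (Vs i (Ws w x)) (Vs i (Ws w y))) = ip (Ws w x) (Ws w y)"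
        using w by (auto simp: wl_def)
    qed (auto simp: wl_def)
    also have "\<dots> = (\<Sum>w\<in>wl k. \<Sum>i<n. ip (Vs i (Ws w x)) (Vs i (Ws w y)))"
      by (simp add: sum.cartesian_product)
    finally show ?case using Suc.IH unfolding 1 by (simp add: ip_defect sum_subtractf algebra_simps)
  qed
  note lev = this[of k]
  have "wd n (Suc k) = wl k \<union> wd n k" "wl k \<inter> wd n k = {}" by (auto simp: wd_def wl_def)
  then have "(\<Sum>w\<in>wd n (Suc k). ip (coord x (k - length w) w) (coord y (k - length w) w))
    = (\<Sum>w\<in>wl k. ip (coord x (k - length w) w) (coord y (k - length w) w)) + (\<Sum>w\<in>wd n k. ip (coord x (k - length w) w) (coord y (k - length w) w))"
    using fin by (simp add: sum.union_disjoint)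
  also have "\<dots> = (\<Sum>w\<in>wl k. ip (Ws w x) (Ws w y)) + (\<Sum>w\<in>wd n k. ip (defect (Ws w x)) (defect (Ws w y)))"
    by (intro arg_cong2[of _ _ _ _ "(+)"] sum.cong) (auto simp: coord_def wl_def wd_def)
  finally show ?thesis by (simp add: lev)
qed

lemma coord_sum: "(\<Sum>j<m. \<Sum>w\<in>wd n (m - j). ip (coord x j w) (coord y j w)) = of_nat m * ip x y"
proof -
  have "(\<Sum>j<m. \<Sum>w\<in>wd n (m - j). ip (coord x j w) (coord y j w))
    = (\<Sum>(j, w)\<in>(SIGMA j:{..<m}. wd n (m - j)). ip (coord x j w) (coord y j w))"
    by (simp add: sum.Sigma)
  \<comment> \<open>Regrouping by the level \<open>k = j + length w\<close>.\<close>
  also have "\<dots> = (\<Sum>(k, w)\<in>(SIGMA k:{..<m}. wd n (Suc k)). ip (coord x (k - length w) w) (coord y (k - length w) w))"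
    by (rule sum.reindex_bij_witness[of _ "\<lambda>(k, w). (k - length w, w)" "\<lambda>(j, w). (j + length w, w)"]) (auto simp: wd_def)
  also have "\<dots> = (\<Sum>k<m. \<Sum>w\<in>wd n (Suc k). ip (coord x (k - length w) w) (coord y (k - length w) w))"
    by (simp add: sum.Sigma)
  finally show ?thesis by (simp add: coord_level)
qed

text \<open>The tuple \<open>V\<^sub>i \<otimes> S\<close>, with \<open>S\<close> the unilateral shift on \<open>\<ell>\<^sup>2(\<nat>)\<close>, is pure; \<open>coord\<close> gives the
  coordinates of \<open>x \<otimes> (e\<^sub>0 + \<dots> + e\<^sub>m\<^sub>-\<^sub>1)\<close> in its Wold decomposition. As \<open>m\<close> grows, the
  normalised vectors recover \<open>\<langle>p(V)x, y\<rangle>\<close> from \<open>p(V \<otimes> S)\<close>.\<close>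
lemma von_neumann: "poly_bd n (phi x y) (nm x * nm y)"
  unfolding poly_bd_def
proof (intro allI impI)
  fix W c and B :: real
  assume W: "finite W" "W \<subseteq> words n" and B: "\<forall>f\<in>fock n. fnorm n (poly_op W c f) \<le> B * fnorm n f"
  have B0: "B \<ge> 0" using B[rule_format, of "ev []"] fock.nm_nonneg[OF poly_op_fock[OF W(2), of "ev []" c]] by simp
  have nsq: "(\<Sum>j<m. \<Sum>w\<in>wd n (m - j). (nm (coord z j w))\<^sup>2) = m * (nm z)\<^sup>2" for m z
  proof -
    have "complex_of_real (\<Sum>j<m. \<Sum>w\<in>wd n (m - j). (nm (coord z j w))\<^sup>2) = of_real (m * (nm z)\<^sup>2)"
      using coord_sum[where m = m and x = z and y = z] by (simp add: ip_self)
    then show ?thesis by (simp only: of_real_eq_iff)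
  qed
  \<comment> \<open>Shifting by \<open>v\<close> moves the first \<open>m\<close> basis vectors up
    by \<open>length v\<close>, so \<open>m - length v\<close> of them still overlap with the
    original ones; truncated subtraction gives the right count 0 for small \<open>m\<close>.\<close>
  have main: "cmod (\<Sum>v\<in>W. c v * (of_nat (m - length v) * phi x y v)) \<le> B * (m * (nm x * nm y))" for m
  proof -
    \<comment> \<open>Cutting off at length \<open>m - j\<close> discards the words
      \<open>v @ w\<close> that leave the overlap.\<close>
    define g where "g = (\<lambda>j w. if w \<in> wd n (m - j) then coord y j w else 0)"
    have "(\<Sum>v\<in>W. c v * (of_nat (m - length v) * phi x y v))
      = (\<Sum>v\<in>W. \<Sum>j<m. \<Sum>w\<in>wd n (m - j). c v * ip (coord x j w) (g j (v @ w)))"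
    proof (rule sum.cong[OF refl])
      fix v assume v: "v \<in> W"
      have vw: "v \<in> words n" using v W by auto
      have "of_nat (m - length v) * phi x y v = (\<Sum>j<m - length v. \<Sum>w\<in>wd n (m - length v - j). ip (coord x j w) (coord (Ws v y) j w))"
        by (simp only: phi_def Wv_ip[OF vw] coord_sum)
      also have "\<dots> = (\<Sum>j<m. \<Sum>w\<in>wd n (m - length v - j). ip (coord x j w) (coord (Ws v y) j w))"
        by (rule sum.mono_neutral_left) (auto simp: wd_def)
      also have "\<dots> = (\<Sum>j<m. \<Sum>w\<in>wd n (m - j). ip (coord x j w) (g j (v @ w)))"
      proof (rule sum.cong[OF refl])
        fix j
        have "(\<Sum>w\<in>wd n (m - j). ip (coord x j w) (g j (v @ w)))
          = (\<Sum>w\<in>wd n (m - length v - j). ip (coord x j w) (g j (v @ w)))"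
          using vw by (intro sum.mono_neutral_right finite_wd) (auto simp: wd_def g_def)
        also have "\<dots> = (\<Sum>w\<in>wd n (m - length v - j). ip (coord x j w) (coord (Ws v y) j w))"
          using vw by (intro sum.cong) (auto simp: wd_def g_def coord_append)
        finally show "(\<Sum>w\<in>wd n (m - length v - j). ip (coord x j w) (coord (Ws v y) j w))
          = (\<Sum>w\<in>wd n (m - j). ip (coord x j w) (g j (v @ w)))" by simp
      qed
      finally show "c v * (of_nat (m - length v) * phi x y v)
        = (\<Sum>j<m. \<Sum>w\<in>wd n (m - j). c v * ip (coord x j w) (g j (v @ w)))"
        by (simp add: sum_distrib_left)
    qed
    also have "\<dots> = (\<Sum>j<m. \<Sum>v\<in>W. \<Sum>w\<in>wd n (m - j). c v * ip (coord x j w) (g j (v @ w)))"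
      by (rule sum.swap)
    also have "\<dots> = (\<Sum>j<m. \<Sum>w\<in>wd n (m - j). \<Sum>v\<in>W. c v * ip (coord x j w) (g j (v @ w)))"
      by (rule sum.cong[OF refl], rule sum.swap)
    finally have eq: "(\<Sum>v\<in>W. c v * (of_nat (m - length v) * phi x y v))
      = (\<Sum>j<m. \<Sum>w\<in>wd n (m - j). \<Sum>v\<in>W. c v * ip (coord x j w) (g j (v @ w)))" .
    define a where "a = (\<lambda>z j. sqrt (\<Sum>w\<in>wd n (m - j). (nm (coord z j w))\<^sup>2))"
    have a: "(a z j)\<^sup>2 = (\<Sum>w\<in>wd n (m - j). (nm (coord z j w))\<^sup>2)" for z j
      by (simp add: a_def sum_nonneg)
    have "cmod (\<Sum>j<m. \<Sum>w\<in>wd n (m - j). \<Sum>v\<in>W. c v * ip (coord x j w) (g j (v @ w)))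
      \<le> (\<Sum>j<m. B * (\<bar>a x j\<bar> * \<bar>a y j\<bar>))"
    proof (rule sum_norm_le)
      fix j
      have gn: "(\<Sum>w\<in>wd n (m - j). (nm (g j w))\<^sup>2) = (\<Sum>w\<in>wd n (m - j). (nm (coord y j w))\<^sup>2)"
        by (intro sum.cong) (auto simp: g_def)
      have "cmod (\<Sum>w\<in>wd n (m - j). \<Sum>v\<in>W. c v * ip (coord x j w) (g j (v @ w)))
        \<le> B * (sqrt (\<Sum>w\<in>wd n (m - j). (nm (coord x j w))\<^sup>2) * sqrt (\<Sum>w\<in>wd n (m - j). (nm (g j w))\<^sup>2))"
        by (rule poly_op_tensor_bound[OF W _ finite_wd wd_words]) (use B in \<open>auto simp: g_def\<close>)
      then show "cmod (\<Sum>w\<in>wd n (m - j). \<Sum>v\<in>W. c v * ip (coord x j w) (g j (v @ w))) \<le> B * (\<bar>a x j\<bar> * \<bar>a y j\<bar>)"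
        unfolding gn by (simp add: a_def sum_nonneg)
    qed
    also have "\<dots> \<le> B * (L2_set (a x) {..<m} * L2_set (a y) {..<m})"
      unfolding sum_distrib_left[symmetric] by (intro mult_left_mono L2_set_mult_ineq B0)
    also have "\<dots> = B * (m * (nm x * nm y))"
      by (simp add: L2_set_def a nsq real_sqrt_mult)
    finally show ?thesis unfolding eq .
  qed
  have "cmod (\<Sum>v\<in>W. c v * phi x y v) \<le> B * (nm x * nm y)"
  proof (rule LIMSEQ_le_const2)
    have lim: "(\<lambda>m. of_nat (m - k) / of_nat m :: complex) \<longlonglongrightarrow> 1" for k
    proof (rule tendsto_cong[THEN iffD1])
      show "\<forall>\<^sub>F m in sequentially. 1 - of_nat k / of_nat m = (of_nat (m - k) / of_nat m :: complex)"
        using eventually_gt_at_top[of k] by eventually_elim (simp add: of_nat_diff field_simps)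
      have "(\<lambda>m. 1 - of_nat k / of_nat m :: complex) \<longlonglongrightarrow> 1 - 0" by (intro tendsto_intros lim_const_over_n)
      then show "(\<lambda>m. 1 - of_nat k / of_nat m :: complex) \<longlonglongrightarrow> 1" by simp
    qed
    have "(\<lambda>m. \<Sum>v\<in>W. c v * (of_nat (m - length v) / of_nat m * phi x y v)) \<longlonglongrightarrow> (\<Sum>v\<in>W. c v * (1 * phi x y v))"
      by (intro tendsto_intros lim)
    then show "(\<lambda>m. cmod (\<Sum>v\<in>W. c v * (of_nat (m - length v) / of_nat m * phi x y v))) \<longlonglongrightarrow> cmod (\<Sum>v\<in>W. c v * phi x y v)"
      by (intro tendsto_norm) simp
    have "cmod (\<Sum>v\<in>W. c v * (of_nat (m - length v) / of_nat m * phi x y v)) \<le> B * (nm x * nm y)" if m: "m \<ge> 1" for m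
    proof -
      have "(\<Sum>v\<in>W. c v * (of_nat (m - length v) / of_nat m * phi x y v)) = (\<Sum>v\<in>W. c v * (of_nat (m - length v) * phi x y v)) / of_nat m"
        by (simp add: sum_divide_distrib)
      then show ?thesis using main[of m] m by (simp add: norm_divide divide_le_eq ac_simps)
    qed
    then show "\<exists>N. \<forall>m\<ge>N. cmod (\<Sum>v\<in>W. c v * (of_nat (m - length v) / of_nat m * phi x y v)) \<le> B * (nm x * nm y)" by blast
  qed
  then show "cmod (\<Sum>w\<in>W. c w * phi x y w) \<le> nm x * nm y * B" by (simp add: ac_simps)
qed

end

subsection \<open>Weak-* continuous representations give normal functionals\<close>

text \<open>Induction on the list: after restriction to the kernel of \<open>f\<close>, a multiple
  of \<open>f\<close> corrects the result in the one missing direction. \<open>C\<close> shrinks to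
  that kernel, hence linearity of the members of \<open>S\<close> is asked on a fixed larger
  \<open>D\<close>; working with a subspace \<open>S\<close> instead of a span turns the conclusion
  into membership.\<close>

lemma common_kernel_combination:
  fixes C :: "'c::cvec set" and S :: "('c \<Rightarrow> complex) set"
  assumes S: "csubspace S"
    and lin: "\<And>f x y. f \<in> S \<Longrightarrow> x \<in> D \<Longrightarrow> y \<in> D \<Longrightarrow> f (x + y) = f x + f y"
      "\<And>f x a. f \<in> S \<Longrightarrow> x \<in> D \<Longrightarrow> f (a *\<^sub>C x) = a * f x"
  shows "csubspace C \<Longrightarrow> C \<subseteq> D \<Longrightarrow> set fs \<subseteq> S \<Longrightarrow> (\<And>x y. x \<in> C \<Longrightarrow> y \<in> C \<Longrightarrow> g (x + y) = g x + g y) \<Longrightarrow>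
    (\<And>x a. x \<in> C \<Longrightarrow> g (a *\<^sub>C x) = a * g x) \<Longrightarrow> (\<And>x. x \<in> C \<Longrightarrow> \<forall>f\<in>set fs. f x = 0 \<Longrightarrow> g x = (0::complex))
    \<Longrightarrow> \<exists>h\<in>S. \<forall>x\<in>C. g x = h x"
proof (induction fs arbitrary: C)
  case Nil
  then show ?case using csubspace_zero[OF S] by (intro bexI[of _ 0]) auto
next
  case (Cons f fs)
  have f: "f \<in> S" using Cons.prems(3) by simp
  note CD = subsetD[OF Cons.prems(2)]
  define C' where "C' = {x \<in> C. f x = 0}"
  have "csubspace C'"
    unfolding csubspace_def C'_def
    using csubspace_zero[OF Cons.prems(1)] csubspace_add[OF Cons.prems(1)] csubspace_scale[OF Cons.prems(1)]
      lin(1)[OF f CD CD] lin(2)[OF f CD, of _ 0] lin(2)[OF f CD] by (auto simp del: scaleC_complex_eq)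
  moreover have "C' \<subseteq> D" "set fs \<subseteq> S" using Cons.prems(2,3) by (auto simp: C'_def)
  ultimately have "\<exists>h\<in>S. \<forall>x\<in>C'. g x = h x"
    by (rule Cons.IH) (use Cons.prems(4-6) in \<open>auto simp: C'_def\<close>)
  then obtain h where h: "h \<in> S" "\<And>x. x \<in> C' \<Longrightarrow> g x = h x" by blast
  show ?case
  proof (cases "\<exists>e\<in>C. f e \<noteq> 0")
    case False
    then show ?thesis using h by (intro bexI[of _ h]) (auto simp: C'_def)
  next
    case True
    then obtain e where e: "e \<in> C" "f e \<noteq> 0" by blast
    \<comment> \<open>Agrees with \<open>g\<close> on the kernel of \<open>f\<close> and at
      \<open>e\<close>, which together span \<open>C\<close>.\<close>
    define k where "k = h + ((g e - h e) / f e) *\<^sub>C f"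
    have "k \<in> S" unfolding k_def by (intro csubspace_add[OF S] csubspace_scale[OF S] h(1) f)
    moreover have "g x = k x" if x: "x \<in> C" for x
    proof -
      define t where "t = - (f x / f e)"
      have te: "t *\<^sub>C e \<in> C" by (rule csubspace_scale[OF Cons.prems(1) e(1)])
      have "f (x + t *\<^sub>C e) = 0"
        unfolding lin(1)[OF f CD[OF x] CD[OF te]] lin(2)[OF f CD[OF e(1)]] using e by (simp add: t_def)
      then have "x + t *\<^sub>C e \<in> C'" using csubspace_add[OF Cons.prems(1) x te] by (simp add: C'_def)
      from h(2)[OF this] have "g x + t * g e = h x + t * h e"
        by (simp add: Cons.prems(4)[OF x te] Cons.prems(5)[OF e(1)] lin(1)[OF h(1) CD[OF x] CD[OF te]] lin(2)[OF h(1) CD[OF e(1)]])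
      then show ?thesis using e by (simp add: k_def t_def field_simps)
    qed
    ultimately show ?thesis by blast
  qed
qed

lemma bounded_op_poly_op:
  assumes "finite W" "W \<subseteq> words n" shows "bounded_op (fock n) (fock_ip n) (poly_op W c)"
  unfolding bounded_op_def
proof (intro conjI ballI allI)
  show "poly_op W c f \<in> fock n" if "f \<in> fock n" for f by (rule poly_op_fock[OF assms(2) that])
  show "poly_op W c (f + g) = poly_op W c f + poly_op W c g" for f g
    by (simp add: poly_op_def word_op_shift_add scaleC_add_right sum.distrib)
  show "poly_op W c (a *\<^sub>C f) = a *\<^sub>C poly_op W c f" for a f
    by (simp add: poly_op_def word_op_shift_scale scaleC_sum_right scaleC_scaleC mult.commute)
  have "fnorm n (poly_op W c f) \<le> (\<Sum>w\<in>W. cmod (c w)) * fnorm n f" if f: "f \<in> fock n" for f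
  proof -
    have "fnorm n (poly_op W c f) \<le> (\<Sum>w\<in>W. fnorm n (c w *\<^sub>C word_op shift_op w f))"
      unfolding poly_op_def using f assms by (intro fock.nm_sum) (auto simp: word_op_shift_fock)
    also have "\<dots> = (\<Sum>w\<in>W. cmod (c w) * fnorm n f)"
      using f assms by (intro sum.cong) (auto simp: fock.nm_scale word_op_shift_fock subset_iff)
    finally show ?thesis by (simp add: sum_distrib_right)
  qed
  then show "\<exists>C. \<forall>f\<in>fock n. fnorm n (poly_op W c f) \<le> C * fnorm n f" by blast
qed

lemma poly_op_Ln:
  assumes "finite W" "W \<subseteq> words n" shows "poly_op W c \<in> Ln n"
proof -
  have "poly_op W c \<in> poly_ops n" using assms by (auto simp: poly_ops_def poly_op_def)
  then show ?thesis using bounded_op_poly_op[OF assms] unfolding Ln_def by force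
qed

lemma word_op_eq_poly_op: "word_op shift_op w = poly_op {w} (\<lambda>_. 1)"
  by (auto simp: poly_op_def scaleC_one fun_eq_iff)

lemma word_op_Ln: "w \<in> words n \<Longrightarrow> word_op shift_op w \<in> Ln n"
  unfolding word_op_eq_poly_op by (rule poly_op_Ln) auto

text \<open>The topology is given by generators, so a neighbourhood of 0 is unwound by induction:
  intersections append the lists of functionals, unions choose one member, and a generator
  contributes its own functional.\<close>

lemma sigma_weak_top_kernel:
  assumes "openin (sigma_weak_top (fock n) (fock_ip n) (Ln n)) U" "0 \<in> U"
  shows "\<exists>L. (\<forall>(a, b)\<in>set L. sq_summable (fock n) (fock_ip n) a \<and> sq_summable (fock n) (fock_ip n) b) \<and>
    (\<forall>T\<in>Ln n. (\<forall>(a, b)\<in>set L. (\<Sum>k. fock_ip n (T (a k)) (b k)) = 0) \<longrightarrow> T \<in> U)"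
  using assms(1)[unfolded sigma_weak_top_def openin_topology_generated_by_iff] assms(2)
proof (induction rule: generate_topology_on.induct)
  case (Int U U')
  then obtain L L' where
    "(\<forall>(a, b)\<in>set L. sq_summable (fock n) (fock_ip n) a \<and> sq_summable (fock n) (fock_ip n) b) \<and>
    (\<forall>T\<in>Ln n. (\<forall>(a, b)\<in>set L. (\<Sum>k. fock_ip n (T (a k)) (b k)) = 0) \<longrightarrow> T \<in> U)"
    "(\<forall>(a, b)\<in>set L'. sq_summable (fock n) (fock_ip n) a \<and> sq_summable (fock n) (fock_ip n) b) \<and>
    (\<forall>T\<in>Ln n. (\<forall>(a, b)\<in>set L'. (\<Sum>k. fock_ip n (T (a k)) (b k)) = 0) \<longrightarrow> T \<in> U')"
    by blast
  then show ?case by (intro exI[of _ "L @ L'"]) auto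
next
  case (UN K)
  from UN.prems obtain U where U: "U \<in> K" "0 \<in> U" by blast
  from UN.IH[OF this] U(1) show ?case by blast
next
  case (Basis U)
  then consider "U = Ln n" | a b X where "U = {T \<in> Ln n. (\<Sum>k. fock_ip n (T (a k)) (b k)) \<in> X}"
    "sq_summable (fock n) (fock_ip n) a" "sq_summable (fock n) (fock_ip n) b"
    unfolding sq_summable_def by auto
  then show ?case
  proof cases
    case 1
    then show ?thesis by (intro exI[of _ "[]"]) auto
  next
    case 2
    have "fock_ip n ((0 :: (nat list \<Rightarrow> complex) \<Rightarrow> nat list \<Rightarrow> complex) (a k)) (b k) = 0" for k
      by (subst zero_fun_apply) (rule fock.ip_zero_left[OF sq_summable_mem[OF 2(3)]])
    then have "(\<Sum>k. fock_ip n ((0 :: (nat list \<Rightarrow> complex) \<Rightarrow> nat list \<Rightarrow> complex) (a k)) (b k)) = 0"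
      by (simp only: suminf_zero)
    then have "0 \<in> X" using Basis(2) unfolding 2(1) mem_Collect_eq by (elim conjE) (simp only:)
    then show ?thesis using 2 by (intro exI[of _ "[(a, b)]"]) auto
  qed
qed simp

context ip_space begin

text \<open>Continuity of \<open>\<rho>\<close> at 0 bounds the coefficient by 1 on the common
  kernel of finitely many normal functionals. The kernel is a linear space, so by scaling the
  coefficient vanishes on it and is a combination of those functionals.\<close>

lemma abs_continuous_imp_normal:
  assumes ac: "abs_continuous M ip n V" and x: "x \<in> M" and y: "y \<in> M"
  shows "normal n (\<lambda>w. ip (word_op V w x) y)"
proof -
  obtain \<rho> where bdd: "\<And>T. T \<in> Ln n \<Longrightarrow> bounded_op M ip (\<rho> T)"
    and cong: "\<And>S T x. S \<in> Ln n \<Longrightarrow> T \<in> Ln n \<Longrightarrow> (\<forall>f\<in>fock n. S f = T f) \<Longrightarrow> x \<in> M \<Longrightarrow> \<rho> S x = \<rho> T x"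
    and add: "\<And>S T x. S \<in> Ln n \<Longrightarrow> T \<in> Ln n \<Longrightarrow> x \<in> M \<Longrightarrow> \<rho> (S + T) x = \<rho> S x + \<rho> T x"
    and scale: "\<And>c S x. S \<in> Ln n \<Longrightarrow> x \<in> M \<Longrightarrow> \<rho> (c *\<^sub>C S) x = c *\<^sub>C \<rho> S x"
    and comp: "\<And>S T x. S \<in> Ln n \<Longrightarrow> T \<in> Ln n \<Longrightarrow> x \<in> M \<Longrightarrow> \<rho> (S \<circ> T) x = \<rho> S (\<rho> T x)"
    and one: "\<And>x. x \<in> M \<Longrightarrow> \<rho> id x = x" and gen: "\<And>i x. i < n \<Longrightarrow> x \<in> M \<Longrightarrow> \<rho> (shift_op i) x = V i x"
    and cont: "continuous_map (sigma_weak_top (fock n) (fock_ip n) (Ln n)) (sigma_weak_top M ip {T. bounded_op M ip T}) \<rho>"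
    using ac unfolding abs_continuous_def by (elim conjE exE) (rule that, blast+)
  have iso: "isometric_tuple M ip n V" using ac by (simp add: abs_continuous_def)
  have VM: "V i z \<in> M" if "i < n" "z \<in> M" for i z
    using iso that by (simp add: isometric_tuple_def bounded_op_def)
  have WM: "word_op V w z \<in> M" if "w \<in> words n" "z \<in> M" for w z
    using that by (induction w) (auto intro: VM)
  have idLn: "id \<in> Ln n" using word_op_Ln[of "[]" n] by (simp add: word_op_def)
  have \<rho>_word: "\<rho> (word_op shift_op w) x = word_op V w x" if "w \<in> words n" for w
    using that
  proof (induction w)
    case Nil
    have e: "word_op shift_op [] = id" by (rule ext) simp
    show ?case by (subst e) (simp only: word_op_Nil one[OF x])
  next
    case (Cons i w)
    then have iw: "i < n" "w \<in> words n" by simp_all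
    have "word_op shift_op (i # w) = shift_op i \<circ> word_op shift_op w" by (rule ext) simp
    moreover have "shift_op i = word_op shift_op [i]" by (rule ext) simp
    then have "shift_op i \<in> Ln n" using word_op_Ln[of "[i]" n] iw by simp
    ultimately have "\<rho> (word_op shift_op (i # w)) x = \<rho> (shift_op i) (\<rho> (word_op shift_op w) x)"
      using comp[OF _ word_op_Ln[OF iw(2)] x] by simp
    also have "\<dots> = V i (word_op V w x)" unfolding Cons.IH[OF iw(2)] by (rule gen[OF iw(1) WM[OF iw(2) x]])
    also have "\<dots> = word_op V (i # w) x" by (rule word_op_Cons[symmetric])
    finally show ?case .
  qed
  have \<rho>_zero: "\<rho> 0 x = 0" using scale[OF idLn x, of 0] by simp
  have \<rho>_poly: "\<rho> (poly_op W c) x = (\<Sum>w\<in>W. c w *\<^sub>C word_op V w x)" if "finite W" "W \<subseteq> words n" for W c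
    using that
  proof (induction W rule: finite_induct)
    case empty
    have e: "poly_op {} c = 0" by (auto simp: poly_op_def fun_eq_iff)
    show ?case by (subst e) (simp only: \<rho>_zero sum.empty)
  next
    case (insert w W)
    then have w: "w \<in> words n" and W: "W \<subseteq> words n" by simp_all
    have e1: "poly_op (insert w W) c = c w *\<^sub>C word_op shift_op w + poly_op W c"
      using insert.hyps by (auto simp: poly_op_def fun_eq_iff)
    have e2: "poly_op {w} c = c w *\<^sub>C word_op shift_op w"
      by (auto simp: poly_op_def fun_eq_iff)
    have "c w *\<^sub>C word_op shift_op w \<in> Ln n" by (subst e2[symmetric], rule poly_op_Ln) (use w in auto)
    then have "\<rho> (poly_op (insert w W) c) x = \<rho> (c w *\<^sub>C word_op shift_op w) x + \<rho> (poly_op W c) x"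
      by (subst e1) (rule add[OF _ poly_op_Ln[OF insert.hyps(1) W] x])
    also have "\<rho> (c w *\<^sub>C word_op shift_op w) x = c w *\<^sub>C \<rho> (word_op shift_op w) x"
      by (rule scale[OF word_op_Ln[OF w] x])
    finally show ?case unfolding \<rho>_word[OF w] insert.IH[OF W] using insert.hyps by simp
  qed
  define \<phi> where "\<phi> w = ip (word_op V w x) y" for w
  have ip_poly: "ip (\<rho> (poly_op W c) x) y = (\<Sum>w\<in>W. c w * \<phi> w)" if "finite W" "W \<subseteq> words n" for W c
    using that x y WM by (simp add: \<rho>_poly \<phi>_def ip_sum_left ip_scale_left subset_iff)
  \<comment> \<open>The generators of the topology are infinite sums, so the single pair
    \<open>x\<close>, \<open>y\<close> is padded with zeros.\<close>
  define U where "U = {T \<in> {T. bounded_op M ip T}. (\<Sum>k. ip (T (if k = 0 then x else 0)) (if k = (0::nat) then y else 0)) \<in> ball 0 1}"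
  have oU: "openin (sigma_weak_top M ip {T. bounded_op M ip T}) U"
    unfolding sigma_weak_top_def U_def
  proof (rule topology_generated_by_Basis, rule insertI2, rule CollectI, rule exI[of _ "\<lambda>k. if k = 0 then x else 0"],
      rule exI[of _ "\<lambda>k. if k = 0 then y else 0"], rule exI[of _ "ball 0 1"], intro conjI)
    show "summable (\<lambda>k. (nm (if k = 0 then x else 0))\<^sup>2)" by (rule suminf_at_0) simp
    show "summable (\<lambda>k. (nm (if k = 0 then y else 0))\<^sup>2)" by (rule suminf_at_0) simp
  qed (use x y in auto)
  have U: "T \<in> U \<longleftrightarrow> cmod (ip (T x) y) < 1" if T: "bounded_op M ip T" for T
  proof -
    have "T 0 \<in> M" using T by (simp add: bounded_op_def)
    then have "(\<Sum>k. ip (T (if k = 0 then x else 0)) (if k = (0::nat) then y else 0)) = ip (T x) y"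
      by (subst suminf_at_0) auto
    then show ?thesis using T by (simp add: U_def)
  qed
  have tops: "topspace (sigma_weak_top (fock n) (fock_ip n) (Ln n)) = Ln n"
    unfolding sigma_weak_top_def topology_generated_by_topspace by auto
  have zLn: "0 \<in> Ln n" using poly_op_Ln[of "{}" n] by (simp add: poly_op_def[abs_def] zero_fun_def)
  have "openin (sigma_weak_top (fock n) (fock_ip n) (Ln n)) {T \<in> Ln n. \<rho> T \<in> U}"
    using openin_continuous_map_preimage[OF cont oU] by (simp add: tops)
  moreover have "0 \<in> {T \<in> Ln n. \<rho> T \<in> U}" using zLn U[OF bdd[OF zLn]] y by (simp add: \<rho>_zero)
  ultimately obtain L where Lsq: "\<And>a b. (a, b) \<in> set L \<Longrightarrow> sq_summable (fock n) (fock_ip n) a \<and> sq_summable (fock n) (fock_ip n) b"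
    and LU: "\<And>T. T \<in> Ln n \<Longrightarrow> (\<forall>(a, b)\<in>set L. (\<Sum>k. fock_ip n (T (a k)) (b k)) = 0) \<Longrightarrow> \<rho> T \<in> U"
    using sigma_weak_top_kernel[of n "{T \<in> Ln n. \<rho> T \<in> U}"] by blast
  \<comment> \<open>Coefficient functions stand for polynomials: functions on words become linear
    functionals on one vector space, to which \<open>common_kernel_combination\<close>
    applies.\<close>
  define C where "C = {c. finite {w. c w \<noteq> (0::complex)} \<and> {w. c w \<noteq> 0} \<subseteq> words n}"
  define lin where "lin \<psi> c = (\<Sum>w\<in>{w. c w \<noteq> 0}. c w * \<psi> w)" for \<psi> c :: "nat list \<Rightarrow> complex"
  have lin_sup: "lin \<psi> c = (\<Sum>w\<in>A. c w * \<psi> w)" if "finite A" "{w. c w \<noteq> 0} \<subseteq> A" for \<psi> c A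
    unfolding lin_def by (rule sum.mono_neutral_left) (use that in auto)
  have C: "csubspace C"
    unfolding csubspace_def
  proof (intro conjI ballI allI)
    fix c d assume cd: "c \<in> C" "d \<in> C"
    have "{w. (c + d) w \<noteq> 0} \<subseteq> {w. c w \<noteq> 0} \<union> {w. d w \<noteq> 0}" by auto
    then show "c + d \<in> C" using cd finite_subset by (auto simp: C_def)
  next
    fix a c assume c: "c \<in> C"
    have "{w. (a *\<^sub>C c) w \<noteq> 0} \<subseteq> {w. c w \<noteq> 0}" by auto
    then show "a *\<^sub>C c \<in> C" using c finite_subset by (auto simp: C_def)
  qed (auto simp: C_def)
  have lin_add: "lin \<psi> (c + d) = lin \<psi> c + lin \<psi> d" if "c \<in> C" "d \<in> C" for \<psi> c d
  proof -
    let ?A = "{w. c w \<noteq> 0} \<union> {w. d w \<noteq> 0}"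
    have A: "finite ?A" using that by (simp add: C_def)
    show ?thesis
      by (subst (1 2 3) lin_sup[OF A]) (auto simp: sum.distrib distrib_right)
  qed
  have lin_scale: "lin \<psi> (a *\<^sub>C c) = a * lin \<psi> c" if "c \<in> C" for \<psi> a c
  proof -
    have A: "finite {w. c w \<noteq> 0}" using that by (simp add: C_def)
    show ?thesis
      by (subst (1 2) lin_sup[OF A]) (auto simp: sum_distrib_left mult.assoc)
  qed
  define S where "S = lin ` {\<psi>. normal n \<psi>}"
  have S: "csubspace S"
    unfolding csubspace_def
  proof (intro conjI ballI allI)
    have "normal n (\<lambda>w. 0)" using normal_bd_zero unfolding normal_iff_bd by blast
    moreover have "lin (\<lambda>w. 0) = 0" by (auto simp: lin_def)
    ultimately show "0 \<in> S" unfolding S_def by force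
  next
    fix f g assume "f \<in> S" "g \<in> S"
    then obtain \<psi> \<psi>' where "normal n \<psi>" "normal n \<psi>'" "f = lin \<psi>" "g = lin \<psi>'" by (auto simp: S_def)
    moreover have "lin (\<psi> + \<psi>') = lin \<psi> + lin \<psi>'" by (auto simp: lin_def sum.distrib distrib_left)
    ultimately show "f + g \<in> S" using normal_add[of n \<psi> \<psi>'] unfolding S_def by (metis image_eqI mem_Collect_eq)
  next
    fix a f assume "f \<in> S"
    then obtain \<psi> where "normal n \<psi>" "f = lin \<psi>" by (auto simp: S_def)
    moreover have "lin (a *\<^sub>C \<psi>) = a *\<^sub>C lin \<psi>" by (auto simp: lin_def sum_distrib_left ac_simps)
    ultimately show "a *\<^sub>C f \<in> S" using normal_scale[of n \<psi> a] unfolding S_def by (metis image_eqI mem_Collect_eq)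
  qed
  define \<psi> where "\<psi> ab w = (\<Sum>k. fock_ip n (word_op shift_op w (fst ab k)) (snd ab k))" for ab w
  have \<psi>_rep: "normal_rep n (\<psi> ab) (fst ab) (snd ab)" if "ab \<in> set L" for ab
    using Lsq[of "fst ab" "snd ab"] that by (simp add: normal_rep_def \<psi>_def)
  have "\<exists>h\<in>S. \<forall>c\<in>C. lin \<phi> c = h c"
  proof (rule common_kernel_combination[OF S _ _ C order_refl, of "map (\<lambda>ab. lin (\<psi> ab)) L"])
    have "normal n (\<psi> ab)" if "ab \<in> set L" for ab using \<psi>_rep[OF that] unfolding normal_def by blast
    then show "set (map (\<lambda>ab. lin (\<psi> ab)) L) \<subseteq> S" by (auto simp: S_def intro!: imageI)
    fix c assume c: "c \<in> C" and ker: "\<forall>f\<in>set (map (\<lambda>ab. lin (\<psi> ab)) L). f c = 0"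
    have "cmod (lin \<phi> (complex_of_real t *\<^sub>C c)) < 1" for t
    proof -
      define d where "d = complex_of_real t *\<^sub>C c"
      have d: "d \<in> C" unfolding d_def by (rule csubspace_scale[OF C c])
      let ?W = "{w. d w \<noteq> 0}"
      have W: "finite ?W" "?W \<subseteq> words n" using d by (auto simp: C_def)
      have "\<rho> (poly_op ?W d) \<in> U"
      proof (rule LU[OF poly_op_Ln[OF W]], rule ballI, clarify)
        fix a b assume ab: "(a, b) \<in> set L"
        have "(\<Sum>k. fock_ip n (poly_op ?W d (a k)) (b k)) = lin (\<psi> (a, b)) d"
          using normal_poly_eval[OF \<psi>_rep[OF ab] W, of d] by (simp add: lin_def)
        also have "\<dots> = of_real t * lin (\<psi> (a, b)) c" unfolding d_def by (rule lin_scale[OF c])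
        also have "\<dots> = 0" using ker ab by auto
        finally show "(\<Sum>k. fock_ip n (poly_op ?W d (a k)) (b k)) = 0" .
      qed
      then show ?thesis using U[OF bdd[OF poly_op_Ln[OF W]]] ip_poly[OF W, of d] by (simp add: lin_def d_def)
    qed
    then have *: "\<bar>t\<bar> * cmod (lin \<phi> c) < 1" for t by (simp add: lin_scale[OF c] norm_mult)
    show "lin \<phi> c = 0"
    proof (rule ccontr)
      assume "lin \<phi> c \<noteq> 0"
      then show False using *[of "1 / cmod (lin \<phi> c)"] by simp
    qed
  qed (use lin_add lin_scale in \<open>auto simp: S_def\<close>)
  then obtain \<psi>' where \<psi>': "normal n \<psi>'" "\<And>c. c \<in> C \<Longrightarrow> lin \<phi> c = lin \<psi>' c" by (auto simp: S_def)
  have "\<phi> w = \<psi>' w" if w: "w \<in> words n" for w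
  proof -
    have "ev w \<in> C" using w by (auto simp: C_def ev_def)
    moreover have "{v. ev w v \<noteq> 0} = {w}" by (auto simp: ev_def)
    ultimately show ?thesis using \<psi>'(2)[of "ev w"] by (simp add: lin_def ev_def)
  qed
  then show ?thesis using normal_cong[OF \<psi>'(1)] by (simp add: \<phi>_def)
qed

end

subsection \<open>The absolutely continuous vectors\<close>

context iso_tuple begin

definition Vac :: "'h set" where "Vac = {x. \<forall>y. normal n (phi x y)}"

lemma phi_add: "w \<in> words n \<Longrightarrow> phi (x + x') y w = phi x y w + phi x' y w"
  by (simp add: phi_def Wv_add ip_add_left)

lemma phi_scale: "w \<in> words n \<Longrightarrow> phi (c *\<^sub>C x) y w = c * phi x y w"
  by (simp add: phi_def Wv_scale ip_scale_left)

lemma phi_diff: "w \<in> words n \<Longrightarrow> phi (x - x') y w = phi x y w - phi x' y w"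
  by (simp add: phi_def Wv_diff ip_diff_left)

lemma csubspace_Vac: "csubspace Vac"
  unfolding csubspace_def Vac_def
proof (intro conjI ballI allI CollectI)
  fix y
  show "normal n (phi 0 y)"
  proof (rule normal_cong)
    show "normal n (\<lambda>w. 0)" using normal_bd_zero unfolding normal_iff_bd by blast
    show "phi 0 y w = 0" if "w \<in> words n" for w using phi_scale[OF that, of 0 0 y] by simp
  qed
next
  fix x x' y assume "x \<in> {x. \<forall>y. normal n (phi x y)}" "x' \<in> {x. \<forall>y. normal n (phi x y)}"
  then have "normal n (phi x y + phi x' y)" by (intro normal_add) auto
  then show "normal n (phi (x + x') y)" by (rule normal_cong) (simp add: phi_add)
next
  fix c x y assume "x \<in> {x. \<forall>y. normal n (phi x y)}"
  then have "normal n (c *\<^sub>C phi x y)" by (intro normal_scale) auto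
  then show "normal n (phi (c *\<^sub>C x) y)" by (rule normal_cong) (simp add: phi_scale)
qed

text \<open>A convergent sequence thinned to geometric speed is a telescoping series;
  \<open>von_neumann\<close> makes the functional norms of its increments summable, so
  \<open>normal_suminf\<close> handles the limit.\<close>

lemma closed_Vac: "closed_subspace UNIV ip Vac"
  unfolding closed_subspace_def
proof (intro conjI allI impI csubspace_Vac subset_UNIV)
  fix s x assume s: "(\<forall>k. s k \<in> Vac) \<and> x \<in> UNIV \<and> (\<lambda>k. nm (s k - x)) \<longlonglongrightarrow> 0"
  have "\<exists>r. nm (s r - x) < (1/2) ^ k" for k
  proof -
    have "\<forall>\<^sub>F r in sequentially. nm (s r - x) < (1/2) ^ k"
      using s by (intro order_tendstoD) auto
    then show ?thesis by (auto simp: eventually_sequentially)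
  qed
  then obtain r where r: "\<And>k. nm (s (r k) - x) < (1/2) ^ k" by metis
  define t where "t k = s (r k)" for k
  have tV: "t k \<in> Vac" for k using s by (simp add: t_def)
  have tx: "(\<lambda>k. nm (t k - x)) \<longlonglongrightarrow> 0"
  proof (rule Lim_null_comparison[OF always_eventually], rule allI)
    show "norm (nm (t k - x)) \<le> (1/2) ^ k" for k using r[of k] by (simp add: t_def)
    show "(\<lambda>k. (1/2) ^ k :: real) \<longlonglongrightarrow> 0" by (rule LIMSEQ_power_zero) simp
  qed
  have nd: "nm (t (Suc k) - t k) \<le> 2 * (1/2) ^ k" for k
  proof -
    have "(t (Suc k) - x) - (t k - x) = t (Suc k) - t k" by simp
    then have "nm (t (Suc k) - t k) \<le> nm (t (Suc k) - x) + nm (t k - x)"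
      using nm_triangle_diff[OF UNIV_I UNIV_I, of "t (Suc k) - x" "t k - x"] by simp
    moreover have "(1/2) ^ Suc k \<le> ((1/2) ^ k :: real)" by simp
    moreover have "(1/2) ^ k \<ge> (0::real)" by simp
    ultimately show ?thesis using r[of k] r[of "Suc k"] unfolding t_def by linarith
  qed
  have "normal n (phi x y)" for y
  proof -
    have "normal n (\<lambda>w. \<Sum>k. phi (t (Suc k) - t k) y w)"
    proof (rule normal_suminf)
      show "normal n (phi (t (Suc k) - t k) y)" for k
        using csubspace_diff[OF csubspace_Vac tV tV] by (auto simp: Vac_def)
      show "poly_bd n (phi (t (Suc k) - t k) y) (nm (t (Suc k) - t k) * nm y)" for k by (rule von_neumann)
      show "summable (\<lambda>k. nm (t (Suc k) - t k) * nm y)"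
      proof (rule summable_mult2, rule summable_comparison_test_ev[OF always_eventually], rule allI)
        show "summable (\<lambda>k. 2 * (1/2) ^ k :: real)" by (intro summable_mult summable_geometric) simp
        show "norm (nm (t (Suc k) - t k)) \<le> 2 * (1/2) ^ k" for k using nd[of k] by simp
      qed
    qed
    then have "normal n (phi (t 0) y + (\<lambda>w. \<Sum>k. phi (t (Suc k) - t k) y w))"
      using tV[of 0] by (intro normal_add) (auto simp: Vac_def)
    then show ?thesis
    proof (rule normal_cong)
      fix w assume w: "w \<in> words n"
      have "(\<lambda>k. ip (t k) (Ws w y)) \<longlonglongrightarrow> ip x (Ws w y)"
        by (rule tendsto_ip_left[OF _ _ _ tx]) auto
      then have "(\<lambda>k. phi (t k) y w) \<longlonglongrightarrow> phi x y w" using w by (simp add: phi_def Wv_ip)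
      then have "(\<lambda>k. phi (t (Suc k)) y w - phi (t k) y w) sums (phi x y w - phi (t 0) y w)"
        by (rule telescope_sums)
      then show "phi x y w = (phi (t 0) y + (\<lambda>w. \<Sum>k. phi (t (Suc k) - t k) y w)) w"
        using w by (simp add: phi_diff sums_iff)
    qed
  qed
  then show "x \<in> Vac" by (simp add: Vac_def)
qed

text \<open>The extra letter stands at the right end of the word, next to the vector, so it can be
  absorbed into \<open>\<xi>\<close> as one more shift.\<close>

lemma Vac_V:
  assumes x: "x \<in> Vac" and i: "i < n" shows "V i x \<in> Vac"
  unfolding Vac_def
proof (intro CollectI allI)
  fix y
  obtain \<xi> \<eta> where rep: "normal_rep n (phi x y) \<xi> \<eta>" using x unfolding Vac_def normal_def by blast
  have "normal_rep n (\<lambda>w. \<Sum>k. fock_ip n (word_op shift_op w (word_op shift_op [i] (\<xi> k))) (\<eta> k)) (\<lambda>k. word_op shift_op [i] (\<xi> k)) \<eta>"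
    by (rule normal_rep_compose[OF rep, where B = "\<lambda>f. f" and a = 1 and b = 1]) (use i in \<open>auto intro: word_op_shift_fock simp del: word_op_Cons\<close>)
  then have "normal_rep n (phi (V i x) y) (\<lambda>k. word_op shift_op [i] (\<xi> k)) \<eta>"
  proof (rule normal_rep_cong)
    fix w assume w: "w \<in> words n"
    have "phi (V i x) y w = phi x y (w @ [i])" by (simp add: phi_def word_op_append)
    also have "\<dots> = (\<Sum>k. fock_ip n (word_op shift_op (w @ [i]) (\<xi> k)) (\<eta> k))"
      using rep w i by (simp add: normal_rep_def)
    finally show "phi (V i x) y w = (\<Sum>k. fock_ip n (word_op shift_op w (word_op shift_op [i] (\<xi> k))) (\<eta> k))"
      by (simp only: word_op_append)
  qed
  then show "normal n (phi (V i x) y)" by (auto simp: normal_def)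
qed

lemma invariant_Wv: "w \<in> words n \<Longrightarrow> (\<And>i x. i < n \<Longrightarrow> x \<in> N \<Longrightarrow> V i x \<in> N) \<Longrightarrow> x \<in> N \<Longrightarrow> Wv w x \<in> N"
  by (induction w) auto

text \<open>A representation on \<open>N\<close> only tests \<open>y\<close> in \<open>N\<close>.
  Any other \<open>y\<close> may be replaced by its projection, because words applied to
  \<open>x\<close> stay in \<open>N\<close>.\<close>

lemma abs_continuous_subset_Vac:
  assumes N: "closed_subspace UNIV ip N" and ac: "abs_continuous N ip n V"
  shows "N \<subseteq> Vac"
proof
  fix x assume x: "x \<in> N"
  have cN: "csubspace N" using N by (simp add: closed_subspace_def)
  interpret N: ip_space N ip by (rule ip_space_subset[OF cN]) simp
  have VN: "V i z \<in> N" if "i < n" "z \<in> N" for i z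
    using ac that by (auto simp: abs_continuous_def isometric_tuple_def bounded_op_def)
  show "x \<in> Vac"
    unfolding Vac_def
  proof (intro CollectI allI)
    fix y
    obtain z where z: "z \<in> N" "\<And>v. v \<in> N \<Longrightarrow> ip (y - z) v = 0" using projection[OF N UNIV_I, of y] by blast
    have "normal n (\<lambda>w. ip (Wv w x) z)" by (rule N.abs_continuous_imp_normal[OF ac x z(1)])
    then show "normal n (phi x y)"
    proof (rule normal_cong)
      fix w assume w: "w \<in> words n"
      have "ip (y - z) (Wv w x) = 0" by (rule z(2)) (rule invariant_Wv[OF w VN x])
      then have "ip (Wv w x) (y - z) = 0" using ip_cnj[of "y - z" "Wv w x"] by simp
      then show "phi x y w = ip (Wv w x) z" by (simp add: phi_def ip_diff_right)
    qed
  qed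
qed

section \<open>The functional calculus on \<open>Vac\<close>\<close>

definition ces_eval :: "((nat list \<Rightarrow> complex) \<Rightarrow> nat list \<Rightarrow> complex) \<Rightarrow> 'h \<Rightarrow> 'h \<Rightarrow> nat \<Rightarrow> complex" where
  "ces_eval T x y j = (\<Sum>w\<in>wd n j. cesaro j (T (ev [])) w * phi x y w)"

text \<open>The extension of the functional calculus \<open>p \<mapsto> \<langle>p(V)x, y\<rangle>\<close> to \<open>\<L>\<^sub>n\<close>.\<close>
definition evl :: "((nat list \<Rightarrow> complex) \<Rightarrow> nat list \<Rightarrow> complex) \<Rightarrow> 'h \<Rightarrow> 'h \<Rightarrow> complex" where
  "evl T x y = lim (ces_eval T x y)"

lemma ces_eval_tendsto_rep:
  assumes T: "T \<in> conv_ops n" and rep: "normal_rep n (phi x y) \<xi> \<eta>"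
  shows "ces_eval T x y \<longlonglongrightarrow> (\<Sum>k. fock_ip n (T (\<xi> k)) (\<eta> k))"
  using normal_cesaro_tendsto[OF rep T] by (simp add: ces_eval_def[abs_def])

lemma evl_rep:
  assumes T: "T \<in> conv_ops n" and rep: "normal_rep n (phi x y) \<xi> \<eta>"
  shows "evl T x y = (\<Sum>k. fock_ip n (T (\<xi> k)) (\<eta> k))"
  unfolding evl_def by (rule limI[OF ces_eval_tendsto_rep[OF assms]])

lemma ces_eval_tendsto:
  assumes T: "T \<in> conv_ops n" and x: "x \<in> Vac"
  shows "ces_eval T x y \<longlonglongrightarrow> evl T x y"
proof -
  obtain \<xi> \<eta> where rep: "normal_rep n (phi x y) \<xi> \<eta>" using x unfolding Vac_def normal_def by blast
  then show ?thesis using ces_eval_tendsto_rep[OF T rep] evl_rep[OF T rep] by simp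
qed

lemma ces_eval_bound:
  assumes T: "T \<in> conv_ops n" and B: "\<And>f. f \<in> fock n \<Longrightarrow> fnorm n (T f) \<le> B * fnorm n f" and j: "j > 0"
  shows "cmod (ces_eval T x y j) \<le> nm x * nm y * B"
  unfolding ces_eval_def
  using von_neumann[of x y, unfolded poly_bd_def, rule_format, OF finite_wd wd_words cesaro_bound[OF T B _ j]] .

lemma evl_bound:
  assumes T: "T \<in> conv_ops n" and B: "\<And>f. f \<in> fock n \<Longrightarrow> fnorm n (T f) \<le> B * fnorm n f" and x: "x \<in> Vac"
  shows "cmod (evl T x y) \<le> nm x * nm y * B"
proof (rule LIMSEQ_le_const2[OF tendsto_norm[OF ces_eval_tendsto[OF T x]]])
  have "cmod (ces_eval T x y j) \<le> nm x * nm y * B" if "j \<ge> 1" for j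
    by (rule ces_eval_bound[OF T B]) (use that in auto)
  then show "\<exists>N. \<forall>j\<ge>N. cmod (ces_eval T x y j) \<le> nm x * nm y * B" by blast
qed

lemma evl_eqI:
  assumes T: "T \<in> conv_ops n" "x \<in> Vac" and lim: "ces_eval T x y \<longlonglongrightarrow> l" shows "evl T x y = l"
  using LIMSEQ_unique[OF ces_eval_tendsto[OF T] lim] .

lemma evl_add_right:
  assumes T: "T \<in> conv_ops n" and x: "x \<in> Vac" shows "evl T x (y + z) = evl T x y + evl T x z"
proof (rule evl_eqI[OF T x])
  have "ces_eval T x (y + z) = (\<lambda>j. ces_eval T x y j + ces_eval T x z j)"
    by (auto simp: ces_eval_def phi_def ip_add_right distrib_left sum.distrib)
  then show "ces_eval T x (y + z) \<longlonglongrightarrow> evl T x y + evl T x z"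
    using tendsto_add[OF ces_eval_tendsto[OF T x] ces_eval_tendsto[OF T x]] by simp
qed

lemma evl_scale_right:
  assumes T: "T \<in> conv_ops n" and x: "x \<in> Vac" shows "evl T x (c *\<^sub>C y) = cnj c * evl T x y"
proof (rule evl_eqI[OF T x])
  have "ces_eval T x (c *\<^sub>C y) = (\<lambda>j. cnj c * ces_eval T x y j)"
    by (auto simp: ces_eval_def phi_def ip_scale_right sum_distrib_left ac_simps)
  then show "ces_eval T x (c *\<^sub>C y) \<longlonglongrightarrow> cnj c * evl T x y"
    using tendsto_mult_left[OF ces_eval_tendsto[OF T x]] by simp
qed

lemma evl_add_left:
  assumes T: "T \<in> conv_ops n" and x: "x \<in> Vac" "x' \<in> Vac" shows "evl T (x + x') y = evl T x y + evl T x' y"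
proof (rule evl_eqI[OF T csubspace_add[OF csubspace_Vac x]])
  have "ces_eval T (x + x') y = (\<lambda>j. ces_eval T x y j + ces_eval T x' y j)"
    by (rule ext) (simp add: ces_eval_def sum.distrib[symmetric] distrib_left[symmetric] phi_add wd_words[THEN subsetD] cong: sum.cong)
  then show "ces_eval T (x + x') y \<longlonglongrightarrow> evl T x y + evl T x' y"
    using tendsto_add[OF ces_eval_tendsto[OF T x(1)] ces_eval_tendsto[OF T x(2)]] by simp
qed

lemma evl_scale_left:
  assumes T: "T \<in> conv_ops n" and x: "x \<in> Vac" shows "evl T (c *\<^sub>C x) y = c * evl T x y"
proof (rule evl_eqI[OF T csubspace_scale[OF csubspace_Vac x]])
  have "ces_eval T (c *\<^sub>C x) y = (\<lambda>j. c * ces_eval T x y j)"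
    by (rule ext) (simp add: ces_eval_def sum_distrib_left phi_scale wd_words[THEN subsetD] mult.left_commute cong: sum.cong)
  then show "ces_eval T (c *\<^sub>C x) y \<longlonglongrightarrow> c * evl T x y"
    using tendsto_mult_left[OF ces_eval_tendsto[OF T x]] by simp
qed

text \<open>\<open>evl T x\<close> is conjugate linear in its last argument, so its representing
  vector stands on the left of \<open>ip\<close>.\<close>

definition rho :: "((nat list \<Rightarrow> complex) \<Rightarrow> nat list \<Rightarrow> complex) \<Rightarrow> 'h \<Rightarrow> 'h" where
  "rho T x = (THE z. \<forall>y. ip z y = evl T x y)"

lemma rho_ip:
  assumes T: "T \<in> conv_ops n" and x: "x \<in> Vac" shows "ip (rho T x) y = evl T x y"
proof -
  obtain B where B: "\<And>f. f \<in> fock n \<Longrightarrow> fnorm n (T f) \<le> B * fnorm n f"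
    using T unfolding conv_ops_def bounded_op_def by blast
  obtain z where z: "\<And>y. cnj (evl T x y) = ip y z"
  proof (rule riesz[of "\<lambda>y. cnj (evl T x y)" "nm x * B"])
    show "cmod (cnj (evl T x y)) \<le> nm x * B * nm y" for y
      using evl_bound[OF T B x, of y] by (simp add: ac_simps)
  qed (auto simp: evl_add_right[OF T x] evl_scale_right[OF T x])
  have e: "ip z y = evl T x y" for y
    using ip_cnj[OF UNIV_I UNIV_I, of z y] unfolding z[symmetric] by simp
  have "rho T x = z"
    unfolding rho_def
  proof (rule the_equality)
    fix z' assume "\<forall>y. ip z' y = evl T x y"
    then show "z' = z" by (intro ip_ext[OF UNIV_I UNIV_I]) (simp add: e)
  qed (simp add: e)
  then show ?thesis by (simp add: e)
qed

lemma rho_eqI: "T \<in> conv_ops n \<Longrightarrow> x \<in> Vac \<Longrightarrow> (\<And>y. evl T x y = ip z y) \<Longrightarrow> rho T x = z"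
  by (rule ip_ext) (auto simp: rho_ip)

lemma nm_rho:
  assumes T: "T \<in> conv_ops n" and B: "\<And>f. f \<in> fock n \<Longrightarrow> fnorm n (T f) \<le> B * fnorm n f" and x: "x \<in> Vac"
  shows "nm (rho T x) \<le> B * nm x"
proof (cases "nm (rho T x) = 0")
  case True
  have "0 \<le> B" using B[of "ev []"] fock.nm_nonneg[OF conv_ops_fock[OF T, of "ev []"]] by simp
  then show ?thesis using True by simp
next
  case False
  then have pos: "nm (rho T x) > 0" using nm_nonneg[OF UNIV_I, of "rho T x"] by linarith
  have "complex_of_real ((nm (rho T x))\<^sup>2) = evl T x (rho T x)"
    using rho_ip[OF T x, of "rho T x"] by (simp add: ip_self)
  then have "(nm (rho T x))\<^sup>2 = cmod (evl T x (rho T x))" by (metis abs_power2 norm_of_real)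
  then have "nm (rho T x) * nm (rho T x) \<le> nm (rho T x) * (B * nm x)"
    using evl_bound[OF T B x, of "rho T x"] by (simp add: power2_eq_square ac_simps)
  then show ?thesis using pos by (simp add: mult_le_cancel_left_pos)
qed

text \<open>\<open>phi x\<close> vanishes against vectors orthogonal to \<open>N\<close>, hence so
  does \<open>evl T x\<close>; the part of \<open>rho T x\<close> orthogonal to \<open>N\<close> is
  therefore orthogonal to itself.\<close>

lemma rho_mem:
  assumes T: "T \<in> conv_ops n" and N: "closed_subspace UNIV ip N" "N \<subseteq> Vac"
    and VN: "\<And>i x. i < n \<Longrightarrow> x \<in> N \<Longrightarrow> V i x \<in> N" and x: "x \<in> N"
  shows "rho T x \<in> N"
proof -
  obtain z where z: "z \<in> N" "\<And>v. v \<in> N \<Longrightarrow> ip (rho T x - z) v = 0" using projection[OF N(1) UNIV_I, of "rho T x"] by blast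
  let ?r = "rho T x - z"
  have xV: "x \<in> Vac" using x N by auto
  have "phi x ?r w = 0" if "w \<in> words n" for w
    using z(2)[OF invariant_Wv[OF that VN x]] ip_cnj[of ?r "Wv w x"] by (simp add: phi_def)
  then have "ces_eval T x ?r = (\<lambda>j. 0)"
    by (auto simp: ces_eval_def wd_def intro!: sum.neutral)
  then have "evl T x ?r = 0" by (intro evl_eqI[OF T xV]) simp
  then have "ip ?r ?r = 0"
    using rho_ip[OF T xV, of ?r] z(2)[OF z(1)] ip_cnj[of ?r z] by (simp add: ip_diff_left)
  then have "?r = 0" by (intro ip_self_eq_0) auto
  then show ?thesis using z(1) by simp
qed

text \<open>The source of multiplicativity: the calculus acts on a representation through
  \<open>\<xi>\<close>. Moving \<open>Wv u\<close> to \<open>y\<close> as an adjoint corresponds to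
  moving the shift by \<open>u\<close> to \<open>\<eta>\<close>, which leaves the place next to
  \<open>\<xi>\<close> free for \<open>T\<close>.\<close>

lemma phi_rho:
  assumes T: "T \<in> conv_ops n" and x: "x \<in> Vac" and rep: "normal_rep n (phi x y) \<xi> \<eta>"
  shows "normal_rep n (phi (rho T x) y) (\<lambda>k. T (\<xi> k)) \<eta>"
proof -
  obtain B where B: "\<And>f. f \<in> fock n \<Longrightarrow> fnorm n (T f) \<le> B * fnorm n f"
    using T unfolding conv_ops_def bounded_op_def by blast
  have mem: "\<xi> k \<in> fock n" "\<eta> k \<in> fock n" for k using rep by (auto simp: normal_rep_def sq_summable_def)
  have "normal_rep n (\<lambda>w. \<Sum>k. fock_ip n (word_op shift_op w (T (\<xi> k))) (\<eta> k)) (\<lambda>k. T (\<xi> k)) \<eta>"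
    by (rule normal_rep_compose[OF rep, where B = "\<lambda>f. f" and b = 1 and a = B]) (use B conv_ops_fock[OF T] in auto)
  then show ?thesis
  proof (rule normal_rep_cong)
    fix u assume u: "u \<in> words n"
    have "normal_rep n (\<lambda>w. \<Sum>k. fock_ip n (word_op shift_op w (\<xi> k)) (word_adj n u (\<eta> k))) \<xi> (\<lambda>k. word_adj n u (\<eta> k))"
      by (rule normal_rep_compose[OF rep, where A = "\<lambda>f. f" and b = 1 and a = 1])
        (use u in \<open>auto intro: word_adj_fock fnorm_word_adj\<close>)
    then have rep': "normal_rep n (phi x (Ws u y)) \<xi> (\<lambda>k. word_adj n u (\<eta> k))"
    proof (rule normal_rep_cong)
      fix w assume w: "w \<in> words n"
      have "phi x (Ws u y) w = phi x y (u @ w)" using u by (simp add: phi_def word_op_append Wv_ip)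
      also have "\<dots> = (\<Sum>k. fock_ip n (word_op shift_op (u @ w) (\<xi> k)) (\<eta> k))"
        using rep u w by (simp add: normal_rep_def)
      also have "\<dots> = (\<Sum>k. fock_ip n (word_op shift_op w (\<xi> k)) (word_adj n u (\<eta> k)))"
        by (simp only: word_op_append word_adj_ip[OF u word_op_shift_fock[OF w mem(1)]])
      finally show "phi x (Ws u y) w = (\<Sum>k. fock_ip n (word_op shift_op w (\<xi> k)) (word_adj n u (\<eta> k)))" .
    qed
    have "phi (rho T x) y u = ip (rho T x) (Ws u y)" using u by (simp add: phi_def Wv_ip)
    also have "\<dots> = (\<Sum>k. fock_ip n (T (\<xi> k)) (word_adj n u (\<eta> k)))"
      by (simp add: rho_ip[OF T x] evl_rep[OF T rep'])
    finally show "phi (rho T x) y u = (\<Sum>k. fock_ip n (word_op shift_op u (T (\<xi> k))) (\<eta> k))"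
      by (simp only: word_adj_ip[OF u conv_ops_fock[OF T mem(1)]])
  qed
qed

lemma rho_comp:
  assumes S: "S \<in> conv_ops n" and T: "T \<in> conv_ops n" and x: "x \<in> Vac" and Tx: "rho T x \<in> Vac"
  shows "rho (S \<circ> T) x = rho S (rho T x)"
proof (rule rho_eqI[OF conv_ops_comp[OF S T] x])
  fix y
  obtain \<xi> \<eta> where rep: "normal_rep n (phi x y) \<xi> \<eta>" using x unfolding Vac_def normal_def by blast
  show "evl (S \<circ> T) x y = ip (rho S (rho T x)) y"
    by (simp add: rho_ip[OF S Tx] evl_rep[OF S phi_rho[OF T x rep]] evl_rep[OF conv_ops_comp[OF S T] rep])
qed

text \<open>This is weak-* continuity of \<open>rho\<close>: a functional defining the topology on
  the image must pull back to one defining the topology on \<open>Ln n\<close>, with one pair of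
  sequences for every \<open>T\<close>. \<open>normal_suminf\<close> provides the pair on words, and
  Cesaro limits carry the identity over to \<open>T\<close>.\<close>

lemma normal_rep_phi_sum:
  assumes x: "sq_summable Vac ip x" and y: "sq_summable UNIV ip y"
  obtains \<xi> \<eta> where "sq_summable (fock n) (fock_ip n) \<xi>" "sq_summable (fock n) (fock_ip n) \<eta>"
    "\<And>T. T \<in> conv_ops n \<Longrightarrow> (\<Sum>k. ip (rho T (x k)) (y k)) = (\<Sum>k. fock_ip n (T (\<xi> k)) (\<eta> k))"
proof -
  have x': "sq_summable UNIV ip x" and xV: "x k \<in> Vac" for k using x by (auto simp: sq_summable_def)
  have sn: "summable (\<lambda>k. nm (x k) * nm (y k))"
  proof (rule summable_comparison_test_ev[OF always_eventually], rule allI)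
    show "summable (\<lambda>k. (nm (x k))\<^sup>2 + (nm (y k))\<^sup>2)"
      using x' y by (intro summable_add) (auto simp: sq_summable_def)
    have "a * b \<le> a\<^sup>2 + b\<^sup>2" if "a \<ge> 0" "b \<ge> 0" for a b :: real
      using zero_le_power2[of "a - b"] mult_nonneg_nonneg[OF that] unfolding power2_diff by argo
    then show "norm (nm (x k) * nm (y k)) \<le> (nm (x k))\<^sup>2 + (nm (y k))\<^sup>2" for k by (simp add: abs_mult)
  qed
  have "normal n (\<lambda>w. \<Sum>k. phi (x k) (y k) w)"
    by (rule normal_suminf[OF _ von_neumann sn]) (use xV in \<open>auto simp: Vac_def\<close>)
  then obtain \<xi> \<eta> where rep: "normal_rep n (\<lambda>w. \<Sum>k. phi (x k) (y k) w) \<xi> \<eta>" by (auto simp: normal_def)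
  show ?thesis
  proof (rule that)
    show "sq_summable (fock n) (fock_ip n) \<xi>" "sq_summable (fock n) (fock_ip n) \<eta>" using rep by (auto simp: normal_rep_def)
    fix T assume T: "T \<in> conv_ops n"
    obtain B where B: "\<And>f. f \<in> fock n \<Longrightarrow> fnorm n (T f) \<le> B * fnorm n f"
      using T unfolding conv_ops_def bounded_op_def by blast
    have sphi: "summable (\<lambda>k. phi (x k) (y k) w)" if w: "w \<in> words n" for w
    proof (rule summable_comparison_test_ev[OF always_eventually sn], rule allI)
      show "norm (phi (x k) (y k) w) \<le> nm (x k) * nm (y k)" for k
        using cauchy_schwarz[OF UNIV_I UNIV_I, of "Wv w (x k)" "y k"] nm_Wv[OF w] by (simp add: phi_def)
    qed
    have eq: "(\<Sum>w\<in>wd n j. cesaro j (T (ev [])) w * (\<Sum>k. phi (x k) (y k) w)) = (\<Sum>k. ces_eval T (x k) (y k) j)" for j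
    proof -
      have "(\<Sum>w\<in>wd n j. cesaro j (T (ev [])) w * (\<Sum>k. phi (x k) (y k) w)) = (\<Sum>w\<in>wd n j. \<Sum>k. cesaro j (T (ev [])) w * phi (x k) (y k) w)"
        by (intro sum.cong refl suminf_mult[symmetric] sphi wd_words[THEN subsetD])
      also have "\<dots> = (\<Sum>k. ces_eval T (x k) (y k) j)"
        unfolding ces_eval_def by (intro suminf_sum[symmetric] summable_mult sphi wd_words[THEN subsetD])
      finally show ?thesis .
    qed
    have "(\<lambda>j. \<Sum>k. ces_eval T (x k) (y k) (Suc j)) \<longlonglongrightarrow> (\<Sum>k. fock_ip n (T (\<xi> k)) (\<eta> k))"
      using LIMSEQ_Suc[OF normal_cesaro_tendsto[OF rep T]] unfolding eq .
    \<comment> \<open>The von Neumann bound is uniform in \<open>j\<close>, so the limit and the sum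
      over \<open>k\<close> may be exchanged.\<close>
    moreover have "(\<lambda>j. \<Sum>k. ces_eval T (x k) (y k) (Suc j)) \<longlonglongrightarrow> (\<Sum>k. evl T (x k) (y k))"
    proof (rule tannerys_theorem[THEN conjunct2, THEN conjunct2])
      show "summable (\<lambda>k. nm (x k) * nm (y k) * B)" by (rule summable_mult2[OF sn])
      show "(\<lambda>j. ces_eval T (x k) (y k) (Suc j)) \<longlonglongrightarrow> evl T (x k) (y k)" for k
        by (rule LIMSEQ_Suc[OF ces_eval_tendsto[OF T xV]])
      have "cmod (ces_eval T (x k) (y k) (Suc j)) \<le> nm (x k) * nm (y k) * B" for k j
        by (rule ces_eval_bound[OF T B]) auto
      then show "\<forall>\<^sub>F (k, j) in sequentially \<times>\<^sub>F sequentially. norm (ces_eval T (x k) (y k) (Suc j)) \<le> nm (x k) * nm (y k) * B"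
        by (intro always_eventually) auto
    qed auto
    ultimately have "(\<Sum>k. fock_ip n (T (\<xi> k)) (\<eta> k)) = (\<Sum>k. evl T (x k) (y k))" by (rule LIMSEQ_unique)
    then show "(\<Sum>k. ip (rho T (x k)) (y k)) = (\<Sum>k. fock_ip n (T (\<xi> k)) (\<eta> k))"
      by (simp add: rho_ip[OF T xV])
  qed
qed

lemma isometric_tuple_restrict:
  assumes "\<And>i x. i < n \<Longrightarrow> x \<in> N \<Longrightarrow> V i x \<in> N" shows "isometric_tuple N ip n V"
  unfolding isometric_tuple_def bounded_op_def
  using assms by (auto simp: V_add V_scale V_ip nm_V intro!: exI[of _ 1])

lemma rho_word:
  assumes u: "u \<in> words n" and x: "x \<in> Vac" shows "rho (word_op shift_op u) x = Wv u x"
proof -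
  have T: "word_op shift_op u \<in> conv_ops n" using word_op_Ln[OF u] Ln_conv_ops by blast
  show ?thesis
  proof (rule rho_eqI[OF T x])
    fix y
    obtain \<xi> \<eta> where rep: "normal_rep n (phi x y) \<xi> \<eta>" using x unfolding Vac_def normal_def by blast
    show "evl (word_op shift_op u) x y = ip (Wv u x) y"
      using rep u by (simp only: evl_rep[OF T rep]) (simp add: normal_rep_def phi_def)
  qed
qed

lemma abs_continuous_if_subset_Vac:
  assumes N: "closed_subspace UNIV ip N" "N \<subseteq> Vac" and VN: "\<And>i x. i < n \<Longrightarrow> x \<in> N \<Longrightarrow> V i x \<in> N"
  shows "abs_continuous N ip n V"
  unfolding abs_continuous_def
proof (intro conjI exI[of _ rho] ballI allI impI)
  note LC = subsetD[OF Ln_conv_ops]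
  have NV: "x \<in> Vac" if "x \<in> N" for x using that N by auto
  have cN: "csubspace N" using N by (simp add: closed_subspace_def)
  have mem: "rho T x \<in> N" if "T \<in> Ln n" "x \<in> N" for T x
    by (rule rho_mem[OF LC[OF that(1)] N VN that(2)])
  show "isometric_tuple N ip n V" by (rule isometric_tuple_restrict[OF VN])
  show bdd: "bounded_op N ip (rho T)" if T: "T \<in> Ln n" for T
    unfolding bounded_op_def
  proof (intro conjI ballI allI)
    obtain B where B: "\<And>f. f \<in> fock n \<Longrightarrow> fnorm n (T f) \<le> B * fnorm n f"
      using T unfolding Ln_def bounded_op_def by blast
    show "\<exists>C. \<forall>x\<in>N. nm (rho T x) \<le> C * nm x" using nm_rho[OF LC[OF T] B NV] by blast
    show "rho T (x + y) = rho T x + rho T y" if "x \<in> N" "y \<in> N" for x y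
      using that by (intro rho_eqI LC T NV csubspace_add[OF cN]) (auto simp: evl_add_left LC T NV rho_ip ip_add_left)
    show "rho T (c *\<^sub>C x) = c *\<^sub>C rho T x" if "x \<in> N" for c x
      using that by (intro rho_eqI LC T NV csubspace_scale[OF cN]) (auto simp: evl_scale_left LC T NV rho_ip ip_scale_left)
  qed (rule mem[OF T])
  have cs: "ces_eval T x y \<longlonglongrightarrow> ip (rho T x) y" if "T \<in> Ln n" "x \<in> N" for T x y
    using ces_eval_tendsto[OF LC[OF that(1)] NV[OF that(2)]] by (simp add: rho_ip LC that NV)
  \<comment> \<open>Determines \<open>rho T x\<close> from limits alone, so it applies to sums and
    multiples of operators directly.\<close>
  have rho_lim: "rho T x = z" if "x \<in> N" "\<And>y. ces_eval T x y \<longlonglongrightarrow> ip z y" for T x z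
  proof -
    have e: "evl T x y = ip z y" for y unfolding evl_def by (rule limI[OF that(2)])
    show ?thesis unfolding rho_def e by (rule the_equality) (simp_all add: ip_ext[OF UNIV_I UNIV_I])
  qed
  \<comment> \<open>The calculus sees an operator only through its value at the Fock vector
    \<open>ev []\<close>.\<close>
  show "rho S x = rho T x" if "S \<in> Ln n" "T \<in> Ln n" "\<forall>f\<in>fock n. S f = T f" "x \<in> N" for S T x
    using that by (simp add: rho_def evl_def ces_eval_def[abs_def])
  show "rho (S + T) x = rho S x + rho T x" if "S \<in> Ln n" "T \<in> Ln n" "x \<in> N" for S T x
  proof (rule rho_lim[OF that(3)])
    fix y
    have "ces_eval (S + T) x y = (\<lambda>j. ces_eval S x y j + ces_eval T x y j)"
    proof
      show "ces_eval (S + T) x y j = ces_eval S x y j + ces_eval T x y j" for j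
        unfolding ces_eval_def sum.distrib[symmetric]
        by (intro sum.cong refl) (simp add: cesaro_def algebra_simps)
    qed
    then show "ces_eval (S + T) x y \<longlonglongrightarrow> ip (rho S x + rho T x) y"
      using tendsto_add[OF cs[OF that(1,3)] cs[OF that(2,3)]] by (simp add: ip_add_left)
  qed
  show "rho (c *\<^sub>C S) x = c *\<^sub>C rho S x" if "S \<in> Ln n" "x \<in> N" for c S x
  proof (rule rho_lim[OF that(2)])
    fix y
    have "ces_eval (c *\<^sub>C S) x y = (\<lambda>j. c * ces_eval S x y j)"
    proof
      show "ces_eval (c *\<^sub>C S) x y j = c * ces_eval S x y j" for j
        unfolding ces_eval_def sum_distrib_left
        by (intro sum.cong refl) (simp add: cesaro_def algebra_simps)
    qed
    then show "ces_eval (c *\<^sub>C S) x y \<longlonglongrightarrow> ip (c *\<^sub>C rho S x) y"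
      using tendsto_mult_left[OF cs[OF that]] by (simp add: ip_scale_left)
  qed
  show "rho (S \<circ> T) x = rho S (rho T x)" if "S \<in> Ln n" "T \<in> Ln n" "x \<in> N" for S T x
    by (rule rho_comp[OF LC[OF that(1)] LC[OF that(2)] NV[OF that(3)] NV[OF mem[OF that(2,3)]]])
  have id_eq: "id = word_op shift_op []" by (rule ext) simp
  show "rho id x = x" if "x \<in> N" for x
    by (subst id_eq, subst rho_word) (use that NV in auto)
  have shift_eq: "shift_op i = word_op shift_op [i]" for i by (rule ext) simp
  show "rho (shift_op i) x = V i x" if "i < n" "x \<in> N" for i x
    by (subst shift_eq, subst rho_word) (use that NV in auto)
  have top_fock: "topspace (sigma_weak_top (fock n) (fock_ip n) (Ln n)) = Ln n"
    unfolding sigma_weak_top_def topology_generated_by_topspace by auto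
  show "continuous_map (sigma_weak_top (fock n) (fock_ip n) (Ln n)) (sigma_weak_top N ip {T. bounded_op N ip T}) rho"
    unfolding sigma_weak_top_def[of N]
  proof (rule continuous_on_generated_topo)
    fix U assume "U \<in> insert {T. bounded_op N ip T}
        {{T \<in> {T. bounded_op N ip T}. (\<Sum>k. ip (T (x k)) (y k)) \<in> U} |x y U.
         open U \<and> (\<forall>k. x k \<in> N \<and> y k \<in> N) \<and> summable (\<lambda>k. (nm (x k))\<^sup>2) \<and> summable (\<lambda>k. (nm (y k))\<^sup>2)}"
    then consider "U = {T. bounded_op N ip T}" | x y X where "U = {T. bounded_op N ip T \<and> (\<Sum>k. ip (T (x k)) (y k)) \<in> X}"
      "open X" "sq_summable N ip x" "sq_summable N ip y"
      unfolding sq_summable_def by auto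
    then show "openin (sigma_weak_top (fock n) (fock_ip n) (Ln n)) (rho -` U \<inter> topspace (sigma_weak_top (fock n) (fock_ip n) (Ln n)))"
    proof cases
      case 1
      then have "rho -` U \<inter> topspace (sigma_weak_top (fock n) (fock_ip n) (Ln n)) = topspace (sigma_weak_top (fock n) (fock_ip n) (Ln n))"
        using bdd by (auto simp: top_fock)
      then show ?thesis by simp
    next
      case 2
      have "sq_summable Vac ip x" "sq_summable UNIV ip y" using 2 NV by (auto simp: sq_summable_def)
      then obtain \<xi> \<eta> where sq: "sq_summable (fock n) (fock_ip n) \<xi>" "sq_summable (fock n) (fock_ip n) \<eta>"
        and eq: "\<And>T. T \<in> conv_ops n \<Longrightarrow> (\<Sum>k. ip (rho T (x k)) (y k)) = (\<Sum>k. fock_ip n (T (\<xi> k)) (\<eta> k))"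
        by (rule normal_rep_phi_sum) blast
      have "rho -` U \<inter> topspace (sigma_weak_top (fock n) (fock_ip n) (Ln n)) = {T \<in> Ln n. (\<Sum>k. fock_ip n (T (\<xi> k)) (\<eta> k)) \<in> X}"
        using bdd eq[OF LC] 2(1) by (auto simp: top_fock)
      moreover have "openin (sigma_weak_top (fock n) (fock_ip n) (Ln n)) {T \<in> Ln n. (\<Sum>k. fock_ip n (T (\<xi> k)) (\<eta> k)) \<in> X}"
        unfolding sigma_weak_top_def
        by (rule topology_generated_by_Basis, rule insertI2, rule CollectI, rule exI[of _ \<xi>], rule exI[of _ \<eta>], rule exI[of _ X])
          (use sq 2 in \<open>auto simp: sq_summable_def\<close>)
      ultimately show ?thesis by simp
    qed
  next
    show "rho ` topspace (sigma_weak_top (fock n) (fock_ip n) (Ln n)) \<subseteq> \<Union> (insert {T. bounded_op N ip T}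
        {{T \<in> {T. bounded_op N ip T}. (\<Sum>k. ip (T (x k)) (y k)) \<in> U} |x y U.
         open U \<and> (\<forall>k. x k \<in> N \<and> y k \<in> N) \<and> summable (\<lambda>k. (nm (x k))\<^sup>2) \<and> summable (\<lambda>k. (nm (y k))\<^sup>2)})"
      using bdd by (auto simp: top_fock)
  qed
qed

end

subsection \<open>Orthonormal bases\<close>

context hspace begin

context
  fixes I :: "'i set" and e :: "'i \<Rightarrow> 'a"
  assumes e_mem: "\<And>i. i \<in> I \<Longrightarrow> e i \<in> M"
    and e_orth: "\<And>i j. i \<in> I \<Longrightarrow> j \<in> I \<Longrightarrow> ip (e i) (e j) = (if i = j then 1 else 0)"
    and e_total: "\<And>x. x \<in> M \<Longrightarrow> (\<And>i. i \<in> I \<Longrightarrow> ip x (e i) = 0) \<Longrightarrow> x = 0"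
begin

definition fourier :: "'a \<Rightarrow> 'i \<Rightarrow> complex" where
  "fourier x i = (if i \<in> I then ip x (e i) else 0)"

lemma bessel:
  assumes x: "x \<in> M" and F: "finite F" "F \<subseteq> I"
  shows "(\<Sum>i\<in>F. (cmod (fourier x i))\<^sup>2) \<le> (nm x)\<^sup>2"
proof -
  define y where "y = (\<Sum>i\<in>F. ip x (e i) *\<^sub>C e i)"
  define S where "S = (\<Sum>i\<in>F. (cmod (ip x (e i)))\<^sup>2)"
  have eF: "e i \<in> M" if "i \<in> F" for i using that F e_mem by auto
  have y: "y \<in> M" unfolding y_def by (rule sum_mem) (use eF in auto)
  have ye: "ip y (e j) = ip x (e j)" if j: "j \<in> F" for j
  proof -
    have "ip y (e j) = (\<Sum>i\<in>F. ip x (e i) * ip (e i) (e j))"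
      unfolding y_def using eF j by (subst ip_sum_left) (auto simp: ip_scale_left)
    also have "\<dots> = (\<Sum>i\<in>F. if i = j then ip x (e j) else 0)"
      using F j by (intro sum.cong) (auto simp: e_orth subset_iff)
    finally show ?thesis using F j by simp
  qed
  have S: "ip z y = of_real S" if "z \<in> M" "\<And>j. j \<in> F \<Longrightarrow> ip z (e j) = ip x (e j)" for z
  proof -
    have "ip z y = (\<Sum>i\<in>F. cnj (ip x (e i)) * ip z (e i))"
      unfolding y_def using eF that(1) by (subst ip_sum_right) (auto simp: ip_scale_right)
    also have "\<dots> = (\<Sum>i\<in>F. of_real ((cmod (ip x (e i)))\<^sup>2))"
      unfolding complex_norm_square using that(2) by (intro sum.cong) (auto simp: mult.commute)
    finally show ?thesis by (simp add: S_def)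
  qed
  have "(nm y)\<^sup>2 = S" using S[OF y ye] by (simp add: nm_sq[OF y])
  moreover have "0 \<le> (nm (x - y))\<^sup>2" by simp
  ultimately have "S \<le> (nm x)\<^sup>2" using S[OF x] by (simp add: nm_sq_diff[OF x y])
  moreover have "(\<Sum>i\<in>F. (cmod (fourier x i))\<^sup>2) = S"
    unfolding S_def using F by (intro sum.cong) (auto simp: fourier_def)
  ultimately show ?thesis by simp
qed

lemma fourier_l2:
  assumes x: "x \<in> M" shows "fourier x \<in> l2 I" "cnorm (l2_ip I) (fourier x) \<le> nm x"
proof -
  have s: "(\<lambda>i. (cmod (fourier x i))\<^sup>2) summable_on I"
    by (rule nonneg_bdd_above_summable_on) (use bessel[OF x] in \<open>auto intro!: bdd_aboveI2\<close>)
  then show f: "fourier x \<in> l2 I" by (simp add: l2_def fourier_def)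
  interpret l: ip_space "l2 I" "l2_ip I" by (rule ip_space_l2)
  have "(cnorm (l2_ip I) (fourier x))\<^sup>2 \<le> (nm x)\<^sup>2"
    unfolding l2_norm_sq[of I "fourier x"] by (rule infsum_le_finite_sums[OF s bessel[OF x]])
  then show "cnorm (l2_ip I) (fourier x) \<le> nm x" using x f by (simp add: abs_le_square_iff[symmetric])
qed

lemma fourier_add: "x \<in> M \<Longrightarrow> y \<in> M \<Longrightarrow> fourier (x + y) = fourier x + fourier y"
  by (auto simp: fourier_def ip_add_left e_mem)

lemma fourier_scale: "x \<in> M \<Longrightarrow> fourier (c *\<^sub>C x) = c *\<^sub>C fourier x"
  by (auto simp: fourier_def ip_scale_left e_mem)

text \<open>The vector with coefficients \<open>f\<close> is produced by \<open>riesz\<close>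
  instead of as the sum of a series, which suits an index set of any cardinality; its coefficients
  are read off by testing on the basis vectors.\<close>

lemma riesz_fischer:
  assumes f: "f \<in> l2 I"
  obtains z where "z \<in> M" "fourier z = f" "\<And>y. y \<in> M \<Longrightarrow> ip y z = l2_ip I (fourier y) f"
proof -
  interpret l: ip_space "l2 I" "l2_ip I" by (rule ip_space_l2)
  obtain z where z: "z \<in> M" "\<And>y. y \<in> M \<Longrightarrow> l2_ip I (fourier y) f = ip y z"
  proof (rule riesz[of "\<lambda>y. l2_ip I (fourier y) f" "cnorm (l2_ip I) f"])
    show "l2_ip I (fourier (x + y)) f = l2_ip I (fourier x) f + l2_ip I (fourier y) f" if "x \<in> M" "y \<in> M" for x y
      unfolding fourier_add[OF that] by (rule l.ip_add_left[OF fourier_l2(1) fourier_l2(1) f]) (use that in auto)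
    show "l2_ip I (fourier (c *\<^sub>C x)) f = c * l2_ip I (fourier x) f" if "x \<in> M" for c x
      unfolding fourier_scale[OF that] by (rule l.ip_scale_left[OF fourier_l2(1) f]) (use that in auto)
    show "cmod (l2_ip I (fourier x) f) \<le> cnorm (l2_ip I) f * nm x" if x: "x \<in> M" for x
    proof -
      have "cmod (l2_ip I (fourier x) f) \<le> cnorm (l2_ip I) (fourier x) * cnorm (l2_ip I) f"
        by (rule l.cauchy_schwarz[OF fourier_l2(1)[OF x] f])
      also have "\<dots> \<le> nm x * cnorm (l2_ip I) f" by (intro mult_right_mono fourier_l2(2) x l.nm_nonneg f)
      finally show ?thesis by (simp add: mult.commute)
    qed
  qed blast
  have "fourier z i = f i" for i
  proof (cases "i \<in> I")
    case True
    have "ip (e i) z = (\<Sum>\<^sub>\<infinity>j\<in>I. fourier (e i) j * cnj (f j))"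
      using z(2)[OF e_mem[OF True]] by (simp add: l2_ip_def)
    also have "\<dots> = (\<Sum>\<^sub>\<infinity>j\<in>{i}. fourier (e i) j * cnj (f j))"
      by (rule infsum_cong_neutral) (use True e_orth in \<open>auto simp: fourier_def\<close>)
    also have "\<dots> = cnj (f i)" using True by (simp add: fourier_def e_orth)
    finally show ?thesis using True ip_cnj[OF e_mem[OF True] z(1)] by (simp add: fourier_def)
  next
    case False
    then show ?thesis using f by (simp add: fourier_def l2_def)
  qed
  then have "fourier z = f" by (rule ext)
  then show ?thesis using that z by metis
qed

text \<open>By totality \<open>y\<close> is the only vector with its coefficients, so it is the one
  that \<open>riesz_fischer\<close> assigns to them.\<close>

lemma fourier_ip:
  assumes x: "x \<in> M" and y: "y \<in> M" shows "l2_ip I (fourier x) (fourier y) = ip x y"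
proof -
  obtain z where z: "z \<in> M" "fourier z = fourier y" "\<And>x. x \<in> M \<Longrightarrow> ip x z = l2_ip I (fourier x) (fourier y)"
    using riesz_fischer[OF fourier_l2(1)[OF y]] by metis
  have "ip (z - y) (e i) = 0" if "i \<in> I" for i
    using fun_cong[OF z(2), of i] that z(1) y by (simp add: fourier_def ip_diff_left e_mem)
  then have "z - y = 0" using z(1) y by (intro e_total) auto
  then show ?thesis using z(3)[OF x] by simp
qed

lemma fourier_image: "fourier ` M = l2 I"
proof
  show "fourier ` M \<subseteq> l2 I" using fourier_l2(1) by auto
  show "l2 I \<subseteq> fourier ` M" using riesz_fischer by (metis image_eqI subsetI)
qed

end

text \<open>Zorn's lemma gives a maximal orthonormal set; a nonzero vector orthogonal to it could be
  normalised and adjoined.\<close>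

lemma orthonormal_basis_exists:
  assumes N: "csubspace N" "N \<subseteq> M"
  obtains A where "A \<subseteq> N" "\<And>a b. a \<in> A \<Longrightarrow> b \<in> A \<Longrightarrow> ip a b = (if a = b then 1 else 0)"
    "\<And>x. x \<in> N \<Longrightarrow> (\<And>a. a \<in> A \<Longrightarrow> ip x a = 0) \<Longrightarrow> x = 0"
proof -
  define P where "P = {A. A \<subseteq> N \<and> (\<forall>a\<in>A. \<forall>b\<in>A. ip a b = (if a = b then 1 else 0))}"
  have "\<exists>A\<in>P. \<forall>X\<in>P. A \<subseteq> X \<longrightarrow> X = A"
  proof (rule subset_Zorn')
    fix K assume K: "subset.chain P K"
    then have KP: "K \<subseteq> P" by (auto simp: subset.chain_def)
    have "ip a b = (if a = b then 1 else 0)" if ab: "a \<in> \<Union>K" "b \<in> \<Union>K" for a b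
    proof -
      obtain X Y where XY: "X \<in> K" "a \<in> X" "Y \<in> K" "b \<in> Y" using ab by blast
      then have "X \<subseteq> Y \<or> Y \<subseteq> X" using K by (auto simp: subset_chain_def)
      then obtain Z where "Z \<in> K" "a \<in> Z" "b \<in> Z" using XY by blast
      then show ?thesis using KP unfolding P_def by blast
    qed
    moreover have "\<Union>K \<subseteq> N" using KP by (auto simp: P_def)
    ultimately show "\<Union>K \<in> P" unfolding P_def by blast
  qed
  then obtain A where A: "A \<in> P" "\<And>X. X \<in> P \<Longrightarrow> A \<subseteq> X \<Longrightarrow> X = A" by blast
  have AN: "A \<subseteq> N" and orth: "\<And>a b. a \<in> A \<Longrightarrow> b \<in> A \<Longrightarrow> ip a b = (if a = b then 1 else 0)"
    using A(1) unfolding P_def by blast+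
  have "x = 0" if x: "x \<in> N" and xA: "\<And>a. a \<in> A \<Longrightarrow> ip x a = 0" for x
  proof (rule ccontr)
    assume "x \<noteq> 0"
    have xM: "x \<in> M" using x N by auto
    then have nx: "nm x \<noteq> 0" using \<open>x \<noteq> 0\<close> nm_eq_0 by blast
    define d where "d = complex_of_real (1 / nm x) *\<^sub>C x"
    have d: "d \<in> N" "d \<in> M" unfolding d_def using x xM csubspace_scale[OF N(1)] by auto
    have dd: "ip d d = 1"
      using nx xM by (simp add: d_def ip_scale_left ip_scale_right ip_self[OF xM] power2_eq_square)
    have da: "ip d a = 0" "ip a d = 0" if "a \<in> A" for a
    proof -
      have aM: "a \<in> M" using that AN N by auto
      show "ip d a = 0" using xA[OF that] xM aM by (simp add: d_def ip_scale_left)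
      then show "ip a d = 0" using ip_cnj[OF d(2) aM] by simp
    qed
    have dA: "d \<notin> A" using da(1)[of d] dd by auto
    then have "insert d A \<in> P" using d AN orth dd da by (auto simp: P_def)
    then have "insert d A = A" by (rule A(2)) auto
    then show False using dA by auto
  qed
  then show ?thesis using that AN orth by blast
qed

end

subsection \<open>Reducing subspaces\<close>

lemma closed_subspace_trans:
  assumes "closed_subspace UNIV ip M" "closed_subspace M ip N" shows "closed_subspace UNIV ip N"
  unfolding closed_subspace_def
proof (intro conjI allI impI)
  show "csubspace N" using assms(2) by (simp add: closed_subspace_def)
  fix s x assume s: "(\<forall>k. s k \<in> N) \<and> x \<in> UNIV \<and> (\<lambda>k. cnorm ip (s k - x)) \<longlonglongrightarrow> 0"
  then have "\<forall>k. s k \<in> M" using assms(2) by (auto simp: closed_subspace_def)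
  then have "x \<in> M"
    using s assms(1)[unfolded closed_subspace_def, THEN conjunct2, THEN conjunct2, THEN spec, THEN spec, of s x] by simp
  then show "x \<in> N"
    using s assms(2)[unfolded closed_subspace_def, THEN conjunct2, THEN conjunct2, THEN spec, THEN spec, of s x] by simp
qed simp

lemma closed_subspace_Int:
  assumes "closed_subspace UNIV ip M" "closed_subspace UNIV ip N" shows "closed_subspace UNIV ip (M \<inter> N)"
  unfolding closed_subspace_def
proof (intro conjI allI impI)
  show "csubspace (M \<inter> N)"
    using assms by (simp add: closed_subspace_def csubspace_def)
  fix s x assume s: "(\<forall>k. s k \<in> M \<inter> N) \<and> x \<in> UNIV \<and> (\<lambda>k. cnorm ip (s k - x)) \<longlonglongrightarrow> 0"
  show "x \<in> M \<inter> N"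
    using s assms(1)[unfolded closed_subspace_def, THEN conjunct2, THEN conjunct2, THEN spec, THEN spec, of s x]
      assms(2)[unfolded closed_subspace_def, THEN conjunct2, THEN conjunct2, THEN spec, THEN spec, of s x] by simp
qed simp

lemma closed_subspace_relative:
  assumes "closed_subspace UNIV ip N" "N \<subseteq> M" shows "closed_subspace M ip N"
  using assms unfolding closed_subspace_def by blast

context iso_tuple begin

definition oc :: "'h set \<Rightarrow> 'h set" where "oc A = {x. \<forall>a\<in>A. ip x a = 0}"

lemma oc_sym: "x \<in> oc A \<Longrightarrow> a \<in> A \<Longrightarrow> ip a x = 0"
  using ip_cnj[OF UNIV_I UNIV_I, of x a] by (simp add: oc_def)

lemma closed_oc: "closed_subspace UNIV ip (oc A)"
  unfolding closed_subspace_def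
proof (intro conjI allI impI)
  show "csubspace (oc A)" by (auto simp: csubspace_def oc_def ip_add_left ip_scale_left)
  fix s x assume s: "(\<forall>k. s k \<in> oc A) \<and> x \<in> UNIV \<and> (\<lambda>k. nm (s k - x)) \<longlonglongrightarrow> 0"
  have "ip x a = 0" if "a \<in> A" for a
  proof -
    have "(\<lambda>k. ip (s k) a) \<longlonglongrightarrow> ip x a" using s by (intro tendsto_ip_left) auto
    moreover have "(\<lambda>k. ip (s k) a) = (\<lambda>k. 0)" using s that by (auto simp: oc_def)
    ultimately show ?thesis by (simp add: LIMSEQ_const_iff)
  qed
  then show "x \<in> oc A" by (simp add: oc_def)
qed simp

lemma oc_decompose:
  assumes "closed_subspace UNIV ip N" obtains z where "z \<in> N" "x - z \<in> oc N"
  by (rule projection[OF assms UNIV_I, of x]) (rule that, auto simp: oc_def)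

lemma oc_inter: "x \<in> N \<Longrightarrow> x \<in> oc N \<Longrightarrow> x = 0"
  by (rule ip_self_eq_0) (auto simp: oc_def)

lemma oc_oc:
  assumes N: "closed_subspace UNIV ip N" and x: "x \<in> oc (oc N)" shows "x \<in> N"
proof -
  obtain z where z: "z \<in> N" "x - z \<in> oc N" by (rule oc_decompose[OF N])
  have "ip x (x - z) = 0" using x z(2) by (simp add: oc_def)
  moreover have "ip z (x - z) = 0" by (rule oc_sym[OF z(2,1)])
  ultimately have "ip (x - z) (x - z) = 0" by (simp add: ip_diff_left)
  then have "x - z = 0" by (intro ip_self_eq_0) auto
  then show ?thesis using z by simp
qed

abbreviation reducing :: "'h set \<Rightarrow> bool" where "reducing N \<equiv> reducing_subspace UNIV ip n V N"

lemma reducing_iff: "reducing N \<longleftrightarrow> closed_subspace UNIV ip N \<and>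
    (\<forall>i<n. \<forall>x\<in>N. V i x \<in> N) \<and> (\<forall>i<n. \<forall>x\<in>N. Vs i x \<in> N)"
  by (auto simp: reducing_subspace_def invariant_subspace_def)

lemma reducing_oc:
  assumes "\<And>i x. i < n \<Longrightarrow> x \<in> A \<Longrightarrow> V i x \<in> A" "\<And>i x. i < n \<Longrightarrow> x \<in> A \<Longrightarrow> Vs i x \<in> A"
  shows "reducing (oc A)"
  unfolding reducing_iff
  by (intro conjI closed_oc) (use assms in \<open>auto simp: oc_def Vs_ip ip_Vs\<close>)

text \<open>\<open>unitary_tuple\<close> and \<open>reducing_subspace\<close> take adjoints relative
  to their carrier; this lets a reducing subspace use the global ones.\<close>

lemma adj_reducing:
  assumes N: "reducing N" and i: "i < n" and x: "x \<in> N" shows "adj N ip (V i) x = Vs i x"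
proof -
  have "csubspace N" using N by (simp add: reducing_iff closed_subspace_def)
  then interpret N: ip_space N ip by (rule ip_space_subset) simp
  show ?thesis by (rule N.adj_eqI) (use N i x in \<open>auto simp: reducing_iff Vs_ip\<close>)
qed

text \<open>The projection onto a reducing subspace commutes with all words, so it can be moved from
  \<open>v\<close> to \<open>y\<close>. Because of this a singular reducing subspace is orthogonal
  to \<open>Vac\<close> instead of merely meeting it in 0.\<close>

lemma projection_reducing:
  assumes N: "reducing N" and v: "v \<in> Vac" and z: "z \<in> N" "v - z \<in> oc N" shows "z \<in> Vac"
  unfolding Vac_def
proof (intro CollectI allI)
  fix y
  have cN: "closed_subspace UNIV ip N" using N by (simp add: reducing_iff)
  obtain y' where y': "y' \<in> N" "y - y' \<in> oc N" by (rule oc_decompose[OF cN])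
  have rN: "reducing (oc N)" using N by (intro reducing_oc) (auto simp: reducing_iff)
  have "normal n (phi v y')" using v by (simp add: Vac_def)
  then show "normal n (phi z y)"
  proof (rule normal_cong)
    fix w assume w: "w \<in> words n"
    have zN: "Wv w z \<in> N" by (rule invariant_Wv[OF w _ z(1)]) (use N in \<open>auto simp: reducing_iff\<close>)
    have "Wv w (v - z) \<in> oc N" by (rule invariant_Wv[OF w _ z(2)]) (use rN in \<open>auto simp: reducing_iff\<close>)
    then have "ip (Wv w v) y' = ip (Wv w z) y'" using y'(1) w by (simp add: oc_def Wv_diff ip_diff_left)
    moreover have "ip (Wv w z) y = ip (Wv w z) y'"
      using oc_sym[OF y'(2) zN] by (simp add: ip_diff_right)
    ultimately show "phi z y w = phi v y' w" by (simp add: phi_def)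
  qed
qed

text \<open>The words in \<open>V\<^sub>i\<close> and \<open>V\<^sub>i\<^sup>*\<close>; \<open>core S\<close> is the largest reducing subspace inside \<open>S\<close>.\<close>
inductive_set star_words :: "('h \<Rightarrow> 'h) set" where
  star_id: "(\<lambda>x. x) \<in> star_words"
| star_V: "A \<in> star_words \<Longrightarrow> i < n \<Longrightarrow> (\<lambda>x. A (V i x)) \<in> star_words"
| star_Vs: "A \<in> star_words \<Longrightarrow> i < n \<Longrightarrow> (\<lambda>x. A (Vs i x)) \<in> star_words"

definition core :: "'h set \<Rightarrow> 'h set" where "core S = {x. \<forall>A\<in>star_words. A x \<in> S}"

lemma star_words_linear:
  assumes "A \<in> star_words"
  shows "A (x + y) = A x + A y" "A (c *\<^sub>C x) = c *\<^sub>C A x" "nm (A x) \<le> nm x"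
  using assms
proof (induction arbitrary: x y)
  case (star_Vs A i)
  { case 1 then show ?case using star_Vs by (simp add: Vs_add) }
  { case 2 then show ?case using star_Vs by (simp add: Vs_scale) }
  { case 3 then show ?case by (rule order_trans[OF star_Vs.IH(3) nm_Vs[OF star_Vs.hyps(2)]]) }
next
  case (star_V A i)
  { case 1 then show ?case using star_V by (simp add: V_add) }
  { case 2 then show ?case using star_V by (simp add: V_scale) }
  { case 3 then show ?case using star_V.IH(3)[of "V i x"] nm_V[OF star_V.hyps(2)] by simp }
qed auto

lemma core_subset: "core S \<subseteq> S"
  using star_id by (auto simp: core_def)

text \<open>Star words are contractions, so the condition survives limits; letters are added next to
  the argument, so it survives \<open>V i\<close> and \<open>Vs i\<close>.\<close>

lemma reducing_core:
  assumes S: "closed_subspace UNIV ip S" shows "reducing (core S)"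
  unfolding reducing_iff
proof (intro conjI allI impI ballI)
  have cS: "csubspace S" using S by (simp add: closed_subspace_def)
  show "closed_subspace UNIV ip (core S)"
    unfolding closed_subspace_def
  proof (intro conjI allI impI)
    show "csubspace (core S)"
      unfolding csubspace_def core_def
    proof (intro conjI ballI allI CollectI)
      show "A 0 \<in> S" if "A \<in> star_words" for A
        using star_words_linear(2)[OF that, of 0 0] csubspace_zero[OF cS] by simp
    qed (auto simp: star_words_linear intro: csubspace_add[OF cS] csubspace_scale[OF cS])
    fix s x assume s: "(\<forall>k. s k \<in> core S) \<and> x \<in> UNIV \<and> (\<lambda>k. nm (s k - x)) \<longlonglongrightarrow> 0"
    have "A x \<in> S" if A: "A \<in> star_words" for A
    proof -
      have "(\<lambda>k. nm (A (s k) - A x)) \<longlonglongrightarrow> 0"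
      proof (rule Lim_null_comparison[OF always_eventually], rule allI)
        show "(\<lambda>k. nm (s k - x)) \<longlonglongrightarrow> 0" using s by simp
        fix k
        have "A (s k) = A (s k - x) + A x" using star_words_linear(1)[OF A, of "s k - x" x] by simp
        then have "A (s k) - A x = A (s k - x)" by simp
        then show "norm (nm (A (s k) - A x)) \<le> nm (s k - x)" using star_words_linear(3)[OF A] by simp
      qed
      moreover have "\<forall>k. A (s k) \<in> S" using s A by (auto simp: core_def)
      ultimately show ?thesis
        using S[unfolded closed_subspace_def, THEN conjunct2, THEN conjunct2, THEN spec, THEN spec, of "\<lambda>k. A (s k)" "A x"] by simp
    qed
    then show "x \<in> core S" by (simp add: core_def)
  qed simp
qed (auto simp: core_def dest: star_V star_Vs)

lemma core_greatest:
  assumes N: "reducing N" and S: "N \<subseteq> S" shows "N \<subseteq> core S"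
proof -
  have "A x \<in> N" if "A \<in> star_words" "x \<in> N" for A x
    using that by (induction arbitrary: x) (use N in \<open>auto simp: reducing_iff\<close>)
  then show ?thesis using S by (auto simp: core_def)
qed

subsection \<open>The Wold decomposition\<close>

definition wandering :: "'h set" where "wandering = {x. \<forall>i<n. Vs i x = 0}"

text \<open>The complement of the shift part; it is the summand on which the tuple is
  unitary.\<close>

definition H1 :: "'h set" where "H1 = oc {Wv w a | w a. w \<in> words n \<and> a \<in> wandering}"

lemma wandering_eq_oc: "wandering = oc {V i y | i y. i < n}"
proof -
  have "Vs i x = 0 \<longleftrightarrow> (\<forall>y. ip x (V i y) = 0)" if "i < n" for i x
    using that ip_self_eq_0[OF UNIV_I, of "Vs i x"] by (auto simp: ip_Vs[symmetric])
  then show ?thesis by (simp add: wandering_def oc_def set_eq_iff) blast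
qed

lemma closed_wandering: "closed_subspace UNIV ip wandering"
  unfolding wandering_eq_oc by (rule closed_oc)

lemma H1_iff: "x \<in> H1 \<longleftrightarrow> (\<forall>w\<in>words n. \<forall>a\<in>wandering. ip x (Wv w a) = 0)"
  by (auto simp: H1_def oc_def)

lemma reducing_H1: "reducing H1"
  unfolding reducing_iff
proof (intro conjI allI impI ballI)
  show "closed_subspace UNIV ip H1" unfolding H1_def by (rule closed_oc)
  fix i x assume i: "i < n" and x: "x \<in> H1"
  show "Vs i x \<in> H1"
    unfolding H1_iff
  proof (intro ballI)
    fix w a assume "w \<in> words n" "a \<in> wandering"
    then have "ip x (Wv (i # w) a) = 0" using x[unfolded H1_iff, rule_format, of "i # w" a] i by simp
    then show "ip (Vs i x) (Wv w a) = 0" using i by (simp add: ip_Vs)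
  qed
  show "V i x \<in> H1"
    unfolding H1_iff
  proof (intro ballI)
    fix w a assume w: "w \<in> words n" and a: "a \<in> wandering"
    show "ip (V i x) (Wv w a) = 0"
    proof (cases w)
      case Nil
      then show ?thesis using a i by (simp add: Vs_ip wandering_def)
    next
      case (Cons j v)
      then show ?thesis using w a x i by (simp add: V_ip H1_iff)
    qed
  qed
qed

text \<open>\<open>defect x\<close> is wandering, hence orthogonal to \<open>x\<close> and to the
  range of every \<open>V i\<close>, and so to itself. Three summands of the decomposition use this,
  hence the arbitrary reducing \<open>N\<close> inside \<open>H1\<close>.\<close>

lemma unitary_on_H1:
  assumes N: "reducing N" and NH: "N \<subseteq> H1" shows "unitary_tuple N ip n V"
  unfolding unitary_tuple_def
proof (intro conjI ballI)
  show "isometric_tuple N ip n V" by (rule isometric_tuple_restrict) (use N in \<open>auto simp: reducing_iff\<close>)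
  fix x assume x: "x \<in> N"
  have "Vs j (\<Sum>i<n. V i (Vs i x)) = Vs j x" if j: "j < n" for j
  proof (rule ip_ext[OF UNIV_I UNIV_I])
    fix y
    have "ip (\<Sum>i<n. V i (Vs i x)) (V j y) = (\<Sum>i<n. if i = j then ip (Vs j x) y else 0)"
      using j by (subst ip_sum_left) (auto simp: V_ip intro!: sum.cong)
    then show "ip (Vs j (\<Sum>i<n. V i (Vs i x))) y = ip (Vs j x) y" using j by (simp add: ip_Vs)
  qed
  moreover have Vs_diff: "Vs j (u - v) = Vs j u - Vs j v" if "j < n" for j u v
    using Vs_add[OF that, of u "(-1) *\<^sub>C v"] Vs_scale[OF that, of "-1" v] by simp
  ultimately have dW: "defect x \<in> wandering" by (auto simp: wandering_def defect_def)
  have "ip x (Wv [] (defect x)) = 0" using x NH dW H1_iff[of x] words_Nil by blast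
  moreover have "ip (\<Sum>i<n. V i (Vs i x)) (defect x) = 0"
    using dW by (subst ip_sum_left) (auto simp: Vs_ip wandering_def)
  ultimately have "ip (defect x) (defect x) = 0" by (simp add: defect_def ip_diff_left)
  then have "defect x = 0" by (intro ip_self_eq_0) auto
  then show "(\<Sum>i<n. V i (adj N ip (V i) x)) = x" by (simp add: adj_reducing[OF N _ x] defect_def)
qed

lemma ip_wandering:
  assumes "w \<in> words n" "v \<in> words n" "a \<in> wandering" "b \<in> wandering"
  shows "ip (Wv w a) (Wv v b) = (if w = v then ip a b else 0)"
  using assms
proof (induction w arbitrary: v)
  case Nil
  then show ?case by (cases v) (auto simp: ip_Vs[symmetric] wandering_def)
next
  case (Cons i w)
  show ?case
  proof (cases v)
    case Nil
    then show ?thesis using Cons.prems by (simp add: Vs_ip wandering_def)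
  next
    case (Cons j u)
    then show ?thesis using Cons.prems Cons.IH[of u] by (auto simp: V_ip)
  qed
qed

text \<open>The vectors \<open>Wv w a\<close>, with \<open>a\<close> from an orthonormal basis of
  the wandering space, form an orthonormal basis on which \<open>V i\<close> acts by prefixing the
  letter \<open>i\<close>; taking coefficients is the unitary equivalence.\<close>

lemma unilateral_shift_oc_H1: "unilateral_shift (oc H1) ip n V"
proof -
  have rH: "reducing (oc H1)" using reducing_H1 by (intro reducing_oc) (auto simp: reducing_iff)
  then have cl: "closed_subspace UNIV ip (oc H1)" and VH: "\<And>i x. i < n \<Longrightarrow> x \<in> oc H1 \<Longrightarrow> V i x \<in> oc H1"
    by (auto simp: reducing_iff)
  interpret H: hspace "oc H1" ip
    using hilbert_closed_subspace[OF hilbert_UNIV cl] by unfold_locales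
  have cW: "csubspace wandering" using closed_wandering by (simp add: closed_subspace_def)
  obtain A where A: "A \<subseteq> wandering" and orth: "\<And>a b. a \<in> A \<Longrightarrow> b \<in> A \<Longrightarrow> ip a b = (if a = b then 1 else 0)"
    and total: "\<And>x. x \<in> wandering \<Longrightarrow> (\<And>a. a \<in> A \<Longrightarrow> ip x a = 0) \<Longrightarrow> x = 0"
    using orthonormal_basis_exists[OF cW subset_UNIV] by blast
  let ?I = "words n \<times> A"
  define e where "e = (\<lambda>(w, a). Wv w a)"
  have e_mem: "e p \<in> oc H1" if pI: "p \<in> ?I" for p
  proof -
    obtain w a where p: "p = (w, a)" "w \<in> words n" "a \<in> wandering" using pI A by auto
    have "ip (Wv w a) h = 0" if "h \<in> H1" for h
      using ip_cnj[OF UNIV_I UNIV_I, of h "Wv w a"] that p by (simp add: H1_iff)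
    then show ?thesis by (simp add: p e_def oc_def)
  qed
  have e_orth: "p \<in> ?I \<Longrightarrow> q \<in> ?I \<Longrightarrow> ip (e p) (e q) = (if p = q then 1 else 0)" for p q
    using A orth by (cases p; cases q) (auto simp: e_def ip_wandering subset_iff)
  have e_total: "x = 0" if x: "x \<in> oc H1" and x0: "\<And>p. p \<in> ?I \<Longrightarrow> ip x (e p) = 0" for x
  proof (rule oc_inter[OF _ x])
    show "x \<in> H1"
      unfolding H1_iff
    proof (intro ballI)
      fix w b assume w: "w \<in> words n" and b: "b \<in> wandering"
      have Ws_eq: "ip (Ws w x) c = ip x (Wv w c)" for c
        using ip_cnj[OF UNIV_I UNIV_I, of "Wv w c" x] ip_cnj[OF UNIV_I UNIV_I, of c "Ws w x"] by (simp add: Wv_ip w)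
      \<comment> \<open>Totality of \<open>A\<close> speaks about members of the wandering space
        only, so \<open>Ws w x\<close> is first projected there.\<close>
      obtain z where z: "z \<in> wandering" "Ws w x - z \<in> oc wandering" by (rule oc_decompose[OF closed_wandering])
      have z_eq: "ip (Ws w x) c = ip z c" if "c \<in> wandering" for c
        using z(2) that by (simp add: oc_def ip_diff_left)
      have "ip z a = 0" if "a \<in> A" for a
        using z_eq[of a] that A x0[of "(w, a)"] w by (auto simp: Ws_eq e_def)
      then have "z = 0" by (rule total[OF z(1)])
      then show "ip x (Wv w b) = 0" using z_eq[OF b] Ws_eq[of b] by simp
    qed
  qed
  define U where "U = H.fourier ?I e"
  note facts = H.fourier_image[of ?I e, OF e_mem e_orth e_total] H.fourier_ip[of ?I e, OF e_mem e_orth e_total]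
    H.fourier_add[of ?I e, OF e_mem e_orth e_total] H.fourier_scale[of ?I e, OF e_mem e_orth e_total]
  have U_def': "U x = (\<lambda>p. if p \<in> ?I then ip x (e p) else 0)" for x
    unfolding U_def by (rule ext) (rule H.fourier_def[of ?I e, OF e_mem e_orth e_total])
  have "unitarily_equivalent (oc H1) ip n V (l2 ?I) (l2_ip ?I) ampl_shift_op"
    unfolding unitarily_equivalent_def
  proof (intro exI[of _ U] conjI ballI allI impI)
    show "U ` oc H1 = l2 ?I" unfolding U_def by (rule facts(1))
    show "l2_ip ?I (U x) (U y) = ip x y" if "x \<in> oc H1" "y \<in> oc H1" for x y
      unfolding U_def by (rule facts(2)) (use that in auto)
    show "U (x + y) = U x + U y" if "x \<in> oc H1" "y \<in> oc H1" for x y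
      unfolding U_def by (rule facts(3)) (use that in auto)
    show "U (c *\<^sub>C x) = c *\<^sub>C U x" if "x \<in> oc H1" for c x
      unfolding U_def by (rule facts(4)) (use that in auto)
    show "U (V i x) = ampl_shift_op i (U x)" if i: "i < n" and x: "x \<in> oc H1" for i x
    proof
      fix p show "U (V i x) p = ampl_shift_op i (U x) p"
      proof (cases p)
        case (Pair w a)
        show ?thesis
        proof (cases w)
          case Nil
          then show ?thesis using Pair i A
            by (auto simp: U_def' ampl_shift_op_def e_def Vs_ip wandering_def)
        next
          case (Cons j v)
          then show ?thesis using Pair i
            by (auto simp: U_def' ampl_shift_op_def e_def V_ip)
        qed
      qed
    qed
  qed
  then show ?thesis
    unfolding unilateral_shift_def using isometric_tuple_restrict[OF VH] by blast
qed

text \<open>Absolutely continuous invariant subspaces are those inside \<open>Vac\<close>, so a reducing subspace is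
  singular iff it is orthogonal to \<open>Vac\<close>; hence \<open>Ha\<close> and \<open>Hs\<close> are the largest unitary reducing
  subspaces of the respective types.\<close>
lemma decomposition:
  "\<exists>Hu Ha Hs Hd. reducing Hu \<and> reducing Ha \<and> reducing Hs \<and> reducing Hd \<and>
     orth ip Hu Ha \<and> orth ip Hu Hs \<and> orth ip Hu Hd \<and>
     orth ip Ha Hs \<and> orth ip Ha Hd \<and> orth ip Hs Hd \<and>
     (\<forall>x. \<exists>u\<in>Hu. \<exists>a\<in>Ha. \<exists>s\<in>Hs. \<exists>d\<in>Hd. x = u + a + s + d) \<and>
     unilateral_shift Hu ip n V \<and>
     unitary_tuple Ha ip n V \<and> abs_continuous Ha ip n V \<and>
     unitary_tuple Hs ip n V \<and> singular_tuple Hs ip n V \<and>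
     unitary_tuple Hd ip n V \<and> dilation_type Hd ip n V"
proof -
  define Hu where "Hu = oc H1"
  define Ha where "Ha = core (H1 \<inter> Vac)"
  define Hs where "Hs = core (H1 \<inter> oc Vac)"
  define Hd where "Hd = oc (Hu \<union> Ha \<union> Hs)"
  have clH1: "closed_subspace UNIV ip H1" using reducing_H1 by (simp add: reducing_iff)
  have rHu: "reducing Hu" unfolding Hu_def using reducing_H1 by (intro reducing_oc) (auto simp: reducing_iff)
  have rHa: "reducing Ha" unfolding Ha_def by (intro reducing_core closed_subspace_Int clH1 closed_Vac)
  have rHs: "reducing Hs" unfolding Hs_def by (intro reducing_core closed_subspace_Int clH1 closed_oc)
  have rHd: "reducing Hd" unfolding Hd_def using rHu rHa rHs by (intro reducing_oc) (auto simp: reducing_iff)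
  have cl: "closed_subspace UNIV ip N" "csubspace N" "\<And>i x. i < n \<Longrightarrow> x \<in> N \<Longrightarrow> V i x \<in> N" if "reducing N" for N
    using that by (auto simp: reducing_iff closed_subspace_def)
  have Ha: "Ha \<subseteq> H1" "Ha \<subseteq> Vac" and Hs: "Hs \<subseteq> H1" "Hs \<subseteq> oc Vac"
    unfolding Ha_def Hs_def using core_subset by blast+
  have Hd: "Hd \<subseteq> H1" "Hd \<subseteq> oc Ha" "Hd \<subseteq> oc Hs" "Hd \<subseteq> oc Hu"
    using oc_oc[OF clH1] by (auto simp: Hd_def Hu_def oc_def)
  have o1: "orth ip Hu Ha" "orth ip Hu Hs" using Ha Hs by (auto simp: orth_def Hu_def oc_def)
  have o2: "orth ip Hu Hd" "orth ip Ha Hd" "orth ip Hs Hd"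
    using Hd oc_sym unfolding orth_def by blast+
  have o3: "orth ip Ha Hs" using Ha Hs oc_sym unfolding orth_def by blast
  have sum: "\<exists>u\<in>Hu. \<exists>a\<in>Ha. \<exists>s\<in>Hs. \<exists>d\<in>Hd. x = u + a + s + d" for x
  proof -
    \<comment> \<open>Each summand receives the projection of \<open>x\<close> itself; as the
      summands are mutually orthogonal, the remainder is orthogonal to all three.\<close>
    obtain u where u: "u \<in> Hu" "x - u \<in> oc Hu" by (rule oc_decompose[OF cl(1)[OF rHu]])
    obtain a where a: "a \<in> Ha" "x - a \<in> oc Ha" by (rule oc_decompose[OF cl(1)[OF rHa]])
    obtain s where s: "s \<in> Hs" "x - s \<in> oc Hs" by (rule oc_decompose[OF cl(1)[OF rHs]])
    define d where "d = x - u - a - s"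
    have xa: "ip x h = ip u h" if "h \<in> Hu" for h using u(2) that by (simp add: oc_def ip_diff_left)
    have xb: "ip x h = ip a h" if "h \<in> Ha" for h using a(2) that by (simp add: oc_def ip_diff_left)
    have xc: "ip x h = ip s h" if "h \<in> Hs" for h using s(2) that by (simp add: oc_def ip_diff_left)
    have swap: "ip p q = 0" if "orth ip B C" "p \<in> C" "q \<in> B" for p q B C
      using that ip_cnj[OF UNIV_I UNIV_I, of q p] by (simp add: orth_def)
    have str: "ip p q = 0" if "orth ip B C" "p \<in> B" "q \<in> C" for p q B C
      using that by (simp add: orth_def)
    have "ip d h = 0" if h: "h \<in> Hu \<union> Ha \<union> Hs" for h
    proof -
      have dh: "ip d h = ip x h - ip u h - ip a h - ip s h" by (simp add: d_def ip_diff_left)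
      from h consider "h \<in> Hu" | "h \<in> Ha" | "h \<in> Hs" by blast
      then show ?thesis
      proof cases
        case 1
        then show ?thesis using dh xa swap[OF o1(1) a(1) 1] swap[OF o1(2) s(1) 1] by simp
      next
        case 2
        then show ?thesis using dh xb str[OF o1(1) u(1) 2] swap[OF o3 s(1) 2] by simp
      next
        case 3
        then show ?thesis using dh xc str[OF o1(2) u(1) 3] str[OF o3 a(1) 3] by simp
      qed
    qed
    then have "d \<in> Hd" by (simp add: Hd_def oc_def)
    moreover have "x = u + a + s + d" by (simp add: d_def)
    ultimately show ?thesis using u a s by blast
  qed
  have ac: "abs_continuous Ha ip n V"
    by (rule abs_continuous_if_subset_Vac[OF cl(1)[OF rHa] Ha(2) cl(3)[OF rHa]])
  have zero_only: "N = {0}" if "csubspace N" "\<And>x. x \<in> N \<Longrightarrow> x = 0" for N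
    using that csubspace_zero by blast
  have sing: "singular_tuple Hs ip n V"
    unfolding singular_tuple_def
  proof (intro conjI notI)
    show "isometric_tuple Hs ip n V" by (rule isometric_tuple_restrict[OF cl(3)[OF rHs]])
    assume "\<exists>N. invariant_subspace Hs ip n V N \<and> N \<noteq> {0} \<and> abs_continuous N ip n V"
    then obtain N where N: "invariant_subspace Hs ip n V N" "N \<noteq> {0}" "abs_continuous N ip n V" by blast
    have clN: "closed_subspace Hs ip N" using N(1) by (simp add: invariant_subspace_def)
    then have NV: "N \<subseteq> Vac"
      by (intro abs_continuous_subset_Vac[OF closed_subspace_trans[OF cl(1)[OF rHs]] N(3)])
    have "x = 0" if "x \<in> N" for x
      using that NV clN Hs(2) by (intro oc_inter[of x Vac]) (auto simp: closed_subspace_def)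
    then show False using zero_only[of N] clN N(2) by (auto simp: closed_subspace_def)
  qed
  have dil: "dilation_type Hd ip n V"
    unfolding dilation_type_def
  proof (intro conjI notI)
    show "isometric_tuple Hd ip n V" by (rule isometric_tuple_restrict[OF cl(3)[OF rHd]])
    assume "\<exists>N. reducing_subspace Hd ip n V N \<and> N \<noteq> {0} \<and> (abs_continuous N ip n V \<or> singular_tuple N ip n V)"
    then obtain N where N: "reducing_subspace Hd ip n V N" "N \<noteq> {0}" "abs_continuous N ip n V \<or> singular_tuple N ip n V" by blast
    have clN: "closed_subspace Hd ip N" and NHd: "N \<subseteq> Hd"
      using N(1) by (auto simp: reducing_subspace_def invariant_subspace_def closed_subspace_def)
    \<comment> \<open>A reducing subspace of \<open>Hd\<close> reduces the tuple on the whole space,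
      because adjoints relative to \<open>Hd\<close> are restrictions.\<close>
    have rN: "reducing N"
      using N(1) NHd closed_subspace_trans[OF cl(1)[OF rHd] clN] adj_reducing[OF rHd]
      unfolding reducing_subspace_def invariant_subspace_def by (metis subsetD)
    have "N \<subseteq> Ha \<or> N \<subseteq> Hs"
      using N(3)
    proof
      assume "abs_continuous N ip n V"
      then have "N \<subseteq> H1 \<inter> Vac" using abs_continuous_subset_Vac[OF cl(1)[OF rN]] NHd Hd(1) by blast
      then show ?thesis unfolding Ha_def using core_greatest[OF rN] by blast
    next
      assume s: "singular_tuple N ip n V"
      \<comment> \<open>An absolutely continuous invariant subspace of \<open>N\<close>, hence zero
        by singularity. Projecting a vector of \<open>Vac\<close> to \<open>N\<close> lands in it,
        so \<open>N\<close> is orthogonal to \<open>Vac\<close>.\<close>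
      let ?K = "N \<inter> Vac"
      have clK: "closed_subspace UNIV ip ?K" by (rule closed_subspace_Int[OF cl(1)[OF rN] closed_Vac])
      have VK: "V i x \<in> ?K" if "i < n" "x \<in> ?K" for i x using that cl(3)[OF rN] Vac_V by blast
      have "abs_continuous ?K ip n V" by (rule abs_continuous_if_subset_Vac[OF clK _ VK]) auto
      moreover have "invariant_subspace N ip n V ?K"
        unfolding invariant_subspace_def using closed_subspace_relative[OF clK, of N] VK by blast
      ultimately have K0: "?K = {0}" using s unfolding singular_tuple_def by blast
      have "ip x v = 0" if x: "x \<in> N" and v: "v \<in> Vac" for x v
      proof -
        obtain z where z: "z \<in> N" "v - z \<in> oc N" by (rule oc_decompose[OF cl(1)[OF rN]])
        have "z \<in> ?K" using z(1) projection_reducing[OF rN v z] by blast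
        then have "z = 0" using K0 by blast
        then show ?thesis using oc_sym[OF z(2) x] by simp
      qed
      then have "N \<subseteq> H1 \<inter> oc Vac" using NHd Hd(1) by (auto simp: oc_def)
      then show ?thesis unfolding Hs_def using core_greatest[OF rN] by blast
    qed
    \<comment> \<open>\<open>Hd\<close> is orthogonal to both \<open>Ha\<close> and
      \<open>Hs\<close>, so a subspace of \<open>Hd\<close> inside one of them is zero.\<close>
    then have "x = 0" if "x \<in> N" for x
      using that NHd Hd(2,3) oc_inter by blast
    then show False using zero_only[OF cl(2)[OF rN]] N(2) by blast
  qed
  show ?thesis
    by (intro exI[of _ Hu] exI[of _ Ha] exI[of _ Hs] exI[of _ Hd] conjI allI rHu rHa rHs rHd o1 o2 o3 sum ac sing dil
        unitary_on_H1 Ha Hs Hd) (simp add: Hu_def unilateral_shift_oc_H1)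
qed

end

theorem theorem6p5:
  fixes ip :: "'h::cvec \<Rightarrow> 'h \<Rightarrow> complex" and n :: nat and V :: "nat \<Rightarrow> 'h \<Rightarrow> 'h"
  assumes "n \<ge> 1"
    and "hilbert_space UNIV ip"
    and "isometric_tuple UNIV ip n V"
  shows "\<exists>Hu Ha Hs Hd.
     reducing_subspace UNIV ip n V Hu \<and> reducing_subspace UNIV ip n V Ha \<and>
     reducing_subspace UNIV ip n V Hs \<and> reducing_subspace UNIV ip n V Hd \<and>
     orth ip Hu Ha \<and> orth ip Hu Hs \<and> orth ip Hu Hd \<and>
     orth ip Ha Hs \<and> orth ip Ha Hd \<and> orth ip Hs Hd \<and>
     (\<forall>x. \<exists>u\<in>Hu. \<exists>a\<in>Ha. \<exists>s\<in>Hs. \<exists>d\<in>Hd. x = u + a + s + d) \<and>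
     unilateral_shift Hu ip n V \<and>
     unitary_tuple Ha ip n V \<and> abs_continuous Ha ip n V \<and>
     unitary_tuple Hs ip n V \<and> singular_tuple Hs ip n V \<and>
     unitary_tuple Hd ip n V \<and> dilation_type Hd ip n V"
proof -
  interpret iso_tuple ip n V using assms(2,3) by unfold_locales
  show ?thesis by (rule decomposition)
qed

end
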